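(* Let $(\alpha,\beta)\in\Gamma$ be a point with $\alpha,\beta>0$, $\alpha<L/2$ and $\beta<M/2$. Assume $f\in C^2[\alpha,L)$ with $f'<0$ and $f''>0$ on $[\alpha,L)$, and $g\in C^2[\beta,M)$ with $g'<0$ and $g''>0$ on $[\beta,M)$. Suppose there is a partition $\alpha=\alpha_0<\alpha_1<\dots<\alpha_m=L$ such that $f''$ is monotonic on each subinterval $(\alpha_i,\alpha_{i+1})$, and a partition $\beta=\beta_0<\beta_1<\dots<\beta_n=M$ such that $g''$ is monotonic on each subinterval $(\beta_i,\beta_{i+1})$. Assume moreover that there are functions $\delta:(0,\infty)\to(0,L/2-\alpha)$ and $\epsilon:(0,\infty)\to(0,M/2-\beta)$ and positive constants $a_1,a_2,b_1,b_2$ such that, as $r\to\infty$, $$\delta(r)=O(r^{-2a_1}),\qquad \frac{1}{f''(L-\delta(r))}=O(r^{1-4a_2}),$$ $$\epsilon(r)=O(r^{-2b_1}),\qquad \frac{1}{g''(M-\epsilon(r))}=O(r^{1-4b_2}).$$ Assume finally that $L=M$. Let $e=\min\left(\tfrac16,a_1,a_2,b_1,b_2\right)$. Then the optimal stretch factor for maximizing $N(r,s)$ approaches $1$ as $r\to\infty$, with $$S(r)\subset\left[1-O(r^{-e}),\,1+O(r^{-e})\right],$$ that is, there are constants $C,r_0>0$ such that $|s-1|\le Cr^{-e}$ for all $r\ge r_0$ and all $s\in S(r)$. Further, as $r\to\infty$, $$\max_{s>0}N(r,s)=r^2\operatorname{Area}(\Gamma)-rL+O(r^{1-2e}).$$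
   Context: Let $L,M>0$ and let $\Gamma$ be a convex, strictly decreasing curve in the first quadrant with $x$-intercept $L$ and $y$-intercept $M$: $\Gamma$ is the graph of $y=f(x)$, where $f:[0,L]\to[0,M]$ is a continuous, convex, strictly decreasing function with $f(0)=M$ and $f(L)=0$. Let $g:[0,M]\to[0,L]$ be the inverse function of $f$ (also convex and strictly decreasing). $\operatorname{Area}(\Gamma)=\int_0^L f(x)\,dx$ is the area enclosed by $\Gamma$ and the coordinate axes. For $r,s>0$, $r\Gamma(s)$ is the graph of $x\mapsto rs\,f(sx/r)$ on $0\le x\le rL/s$. The number of positive-integer lattice points inside or on $r\Gamma(s)$ is $$N(r,s)=\#\{(j,k)\in\mathbb{N}\times\mathbb{N}: js/r\le L,\ k\le rs\,f(js/r)\},\qquad \mathbb{N}=\{1,2,3,\dots\}.$$ For each $r>0$, $S(r)=\operatorname{argmax}_{s>0}N(r,s)$ is the set of $s>0$ at which $s\mapsto N(r,s)$ attains its maximum. *)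

theory Defs
  imports "HOL-Analysis.Analysis" "HOL-Library.Landau_Symbols"
begin

definition convex_decreasing :: "real \<Rightarrow> real \<Rightarrow> (real \<Rightarrow> real) \<Rightarrow> bool" where
  "convex_decreasing L M f \<longleftrightarrow>
     0 < L \<and> 0 < M \<and>
     continuous_on {0..L} f \<and> convex_on {0..L} f \<and> strict_antimono_on {0..L} f \<and>
     f 0 = M \<and> f L = 0"

definition curve :: "real \<Rightarrow> (real \<Rightarrow> real) \<Rightarrow> (real \<times> real) set" where
  "curve L f = {(x, f x) | x. x \<in> {0..L}}"

definition curve_area :: "real \<Rightarrow> (real \<Rightarrow> real) \<Rightarrow> real" where
  "curve_area L f = integral {0..L} f"

definition lattice_count :: "real \<Rightarrow> (real \<Rightarrow> real) \<Rightarrow> real \<Rightarrow> real \<Rightarrow> nat" where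
  "lattice_count L f r s =
     card {(j :: nat, k :: nat). 1 \<le> j \<and> 1 \<le> k \<and>
       real j * s / r \<le> L \<and> real k \<le> r * s * f (real j * s / r)}"

definition optimal_stretches :: "real \<Rightarrow> (real \<Rightarrow> real) \<Rightarrow> real \<Rightarrow> real set" where
  "optimal_stretches L f r = {s. is_arg_max (lattice_count L f r) (\<lambda>s. 0 < s) s}"

definition max_lattice_count :: "real \<Rightarrow> (real \<Rightarrow> real) \<Rightarrow> real \<Rightarrow> nat" where
  "max_lattice_count L f r = Max (lattice_count L f r ` {0<..})"

text \<open>
  \<open>f\<close> is twice continuously differentiable on \<open>A\<close> with derivatives \<open>f'\<close> and \<open>f''\<close>.
  The derivatives are taken within \<open>A\<close>, hence are one-sided at an endpoint that belongs
  to \<open>A\<close>, and the values of \<open>f'\<close> and \<open>f''\<close> outside \<open>A\<close> are irrelevant.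
\<close>

definition C2_on :: "real set \<Rightarrow> (real \<Rightarrow> real) \<Rightarrow> (real \<Rightarrow> real) \<Rightarrow> (real \<Rightarrow> real) \<Rightarrow> bool" where
  "C2_on A f f' f'' \<longleftrightarrow>
     (\<forall>x\<in>A. (f has_real_derivative f' x) (at x within A)) \<and>
     (\<forall>x\<in>A. (f' has_real_derivative f'' x) (at x within A)) \<and>
     continuous_on A f''"

definition piecewise_monotonic :: "real \<Rightarrow> real \<Rightarrow> (real \<Rightarrow> real) \<Rightarrow> bool" where
  "piecewise_monotonic a b h \<longleftrightarrow>
     (\<exists>(m :: nat) (p :: nat \<Rightarrow> real). p 0 = a \<and> p m = b \<and>
       (\<forall>i<m. p i < p (Suc i) \<and>
         (mono_on {p i<..<p (Suc i)} h \<or> antimono_on {p i<..<p (Suc i)} h)))"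

text \<open>
  For fixed \<open>r > 0\<close> the counts are bounded in \<open>s\<close>, so that \<^const>\<open>Max\<close> in
  \<^const>\<open>max_lattice_count\<close> is applied to a finite set and the maximum is attained.
\<close>

lemma finite_lattice_counts:
  assumes f: "convex_decreasing L M f" and r: "0 < r"
  shows "finite (lattice_count L f r ` {0<..})"
proof -
  define n where "n = nat \<lfloor>r\<^sup>2 * L * M\<rfloor>"
  have "lattice_count L f r s \<le> n * n" if s: "0 < s" for s
  proof -
    have "{(j :: nat, k :: nat). 1 \<le> j \<and> 1 \<le> k \<and>
       real j * s / r \<le> L \<and> real k \<le> r * s * f (real j * s / r)} \<subseteq> {1..n} \<times> {1..n}"
    proof clarify
      fix j k :: nat
      assume j: "1 \<le> j" and k: "1 \<le> k" and x: "real j * s / r \<le> L"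
        and y: "real k \<le> r * s * f (real j * s / r)"
      define x where "x = real j * s / r"
      have x0: "0 < x" "x \<le> L" using j s r x by (auto simp: x_def)
      have "f x < f 0"
        using f x0 unfolding convex_decreasing_def monotone_on_def by auto
      hence fx: "f x \<le> M" using f by (simp add: convex_decreasing_def)
      have M: "0 < M" using f by (simp add: convex_decreasing_def)
      have "real j * real k \<le> real j * (r * s * f x)"
        using y by (intro mult_left_mono) (auto simp: x_def)
      also have "\<dots> = r\<^sup>2 * (x * f x)"
        using r by (simp add: x_def power2_eq_square)
      also have "\<dots> \<le> r\<^sup>2 * (x * M)"
        using fx x0 by (intro mult_left_mono) auto
      also have "\<dots> \<le> r\<^sup>2 * (L * M)"
        using x0 M by (intro mult_left_mono mult_right_mono) auto
      finally have "real (j * k) \<le> r\<^sup>2 * L * M" by (simp add: mult.assoc)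
      hence jk: "j * k \<le> n" unfolding n_def by linarith
      have "j \<le> j * k" "k \<le> j * k" using j k by auto
      hence "j \<le> n" "k \<le> n" using jk by (blast intro: le_trans)+
      thus "j \<in> {1..n} \<and> k \<in> {1..n}" using j k by simp
    qed
    from card_mono[OF _ this] show ?thesis by (simp add: lattice_count_def)
  qed
  hence "lattice_count L f r ` {0<..} \<subseteq> {..n * n}" by auto
  thus ?thesis by (rule finite_subset) simp
qed

lemma optimal_stretches_nonempty:
  assumes "convex_decreasing L M f" and "0 < r"
  shows "optimal_stretches L f r \<noteq> {}"
proof -
  note fin = finite_lattice_counts[OF assms]
  have "max_lattice_count L f r \<in> lattice_count L f r ` {0<..}"
    unfolding max_lattice_count_def by (rule Max_in[OF fin]) (use zero_less_one in auto)
  then obtain s where s: "0 < s" "max_lattice_count L f r = lattice_count L f r s" by auto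
  have "lattice_count L f r t \<le> lattice_count L f r s" if "0 < t" for t
    using Max_ge[OF fin, of "lattice_count L f r t"] that s
    by (simp add: max_lattice_count_def)
  hence "s \<in> optimal_stretches L f r"
    using s(1) unfolding optimal_stretches_def is_arg_max_def by (auto dest: leD)
  thus ?thesis by auto
qed

end

theory Submission
  imports Defs "HOL-Real_Asymp.Real_Asymp"
begin

text \<open>
  With $h = s/r$, $c = rs$, the lattice points are split at $(\alpha,\beta)$ into those with
  $jh > \alpha$, counted by columns, those with $k/c > \beta$, counted by rows, and a rectangle.
  Comparing the column and row sums with integrals gives, for $s$ in a compact subset of
  $(0,\infty)$,
  $N(r,s) = r^2 \mathrm{Area}(\Gamma) - r(L/s + sM)/2 + O(r^{1-2e})$,
  provided that the sums of $\psi(c f(jh))$ and of $\psi(h^{-1} g(k/c))$, where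
  $\psi(x) = \{x\} - 1/2$, are $O(r^{1-2e})$. To bound such a sum, $\psi$ is squeezed between
  difference quotients of its antiderivative over steps $r^{-1/3}$; these have absolutely
  convergent Fourier series, and the exponential sums that appear are estimated by
  van der Corput's method. If $f''$ decreases to $0$ at $L$, the range of summation is cut
  where $f''$ drops by factors of $4$, and the contributions form a geometric series
  controlled by the value of $f''$ at $L - \delta(r)$.

  For $L = M$ the main term is maximal at $s = 1$, where it has a nondegenerate maximum.
  That optimal stretch factors stay in a compact subset of $(0,\infty)$ follows from
  $N(r,s) \le r^2\,(\mathrm{Area}(\Gamma) - c \min(1, s/r))$ for all $s > 0$, applied to $f$
  and to its inverse.
\<close>


section \<open>Exponential sums of convex sequences\<close>

text \<open>The exponent 1/6 balances two losses. Smoothing with step 1/K costs about r/K over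
  roughly r sample points. The second difference of c f(jh) is about c h^2 f'' = s^3 f''/r, so for
  bounded s van der Corput's method bounds the k-th exponential sum by a multiple of sqrt(k r);
  weighted by min(1/k, K/k^2) and summed over k this gives sqrt(K r). The two losses agree at K =
  r^{1/3}, where both are r^{2/3} = r^{1 - 2/6}.

  Columns alone do not suffice because f may be infinitely steep at 0, and rows alone because g may
  be. The price of using both is a corner: columns and rows each leave a boundary term of order r at
  (\<alpha>, \<beta>), and these cancel only against the rectangle.

  The expansion is uniform in s only on compact ranges, while the maximum is taken over all s > 0.
  The crude bound for all s therefore has to lose a multiple of r s against r^2 Area as long as s
  \<le> r; since s = 1 loses only O(r), this confines s.\<close>

definition e1 :: "real \<Rightarrow> complex" where "e1 x = cis (2 * pi * x)"

lemma norm_e1 [simp]: "norm (e1 x) = 1"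
  by (simp add: e1_def)

lemma e1_add: "e1 (x + y) = e1 x * e1 y"
  by (simp add: e1_def cis_mult distrib_left)

text \<open>From 1 - e(d) = -2i sin(pi d) e(d/2). As the real part is constant, differences of these
  weights are purely imaginary and are governed by the cotangent alone.\<close>

lemma inverse_one_minus_e1:
  assumes "sin (pi * d) \<noteq> 0"
  shows "1 / (1 - e1 d) = (1 + \<i> * of_real (cot (pi * d))) / 2"
proof -
  let ?s = "sin (pi * d)" and ?c = "cos (pi * d)"
  have "e1 d = Complex (1 - 2 * ?s\<^sup>2) (2 * ?s * ?c)"
    using cos_double_sin[of "pi * d"] sin_double[of "pi * d"]
    by (simp add: e1_def complex_eq_iff mult.assoc mult.left_commute)
  hence "1 - e1 d = Complex (2 * ?s\<^sup>2) (- 2 * ?s * ?c)"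
    by (simp add: complex_eq_iff)
  moreover have "Complex (2 * ?s\<^sup>2) (- 2 * ?s * ?c) * ((1 + \<i> * of_real (cot (pi * d))) / 2) = 1"
    using assms sin_cos_squared_add[of "pi * d"]
    by (simp add: complex_eq_iff cot_def power2_eq_square)
  ultimately have *: "(1 - e1 d) * ((1 + \<i> * of_real (cot (pi * d))) / 2) = 1" by simp
  hence "1 - e1 d \<noteq> 0" by auto
  with * show ?thesis by (simp add: divide_eq_eq mult.commute)
qed

text \<open>Jordan's inequality (the sine lies above its chord on a quarter period), reflected about
  1/2.\<close>

lemma sin_pi_ge:
  assumes "0 < \<theta>" "\<theta> \<le> x" "x \<le> 1 - \<theta>"
  shows "2 * \<theta> \<le> sin (pi * x)"
proof -
  have *: "2 * t \<le> sin (pi * t)" if "0 \<le> t" "t \<le> 1/2" for t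
  proof -
    have "concave_on {0..pi/2} sin"
      by (rule f''_le0_imp_concave[where f' = cos and f'' = "\<lambda>x. - sin x"])
         (auto intro!: derivative_eq_intros sin_ge_zero)
    from concave_onD[OF this, of "2 * t" 0 "pi / 2"] that show ?thesis
      by (simp add: mult.commute)
  qed
  show ?thesis
  proof (cases "x \<le> 1/2")
    case True
    have "2 * x \<le> sin (pi * x)" using * True assms by simp
    thus ?thesis using assms by linarith
  next
    case False
    have "2 * \<theta> \<le> 2 * (1 - x)" using assms by simp
    also have "\<dots> \<le> sin (pi * (1 - x))" by (rule *) (use False assms in auto)
    also have "\<dots> = sin (pi * x)" by (simp add: right_diff_distrib)
    finally show ?thesis .
  qed
qed

lemma cot_pi_antimono:
  assumes "0 < x" "x \<le> y" "y < 1"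
  shows "cot (pi * y) \<le> cot (pi * x)"
proof -
  have s: "0 < sin (pi * x)" "0 < sin (pi * y)" using assms
    by (auto intro!: sin_gt_zero)
  have "0 \<le> sin (pi * y - pi * x)"
    using assms by (intro sin_ge_zero) (auto simp flip: right_diff_distrib)
  thus ?thesis using s
    by (simp add: cot_def field_simps sin_diff)
qed

lemma cot_periodic_int: "cot (pi * (x + of_int m)) = cot (pi * x)"
  by (cases "even m") (simp_all add: cot_def distrib_left sin_add cos_add)

text \<open>
  Summation by parts with the weights $1/(1 - e(d_n))$, whose real part is $1/2$ and whose
  imaginary part is monotone in $n$.
\<close>

lemma kusmin_landau:
  fixes x :: "nat \<Rightarrow> real" and d :: "nat \<Rightarrow> real" and m :: int
  assumes d: "\<And>n. d n = x (Suc n) - x n"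
    and th: "0 < \<theta>"
    and lo: "\<And>n. a \<le> n \<Longrightarrow> n < b \<Longrightarrow> of_int m + \<theta> \<le> d n"
    and hi: "\<And>n. a \<le> n \<Longrightarrow> n < b \<Longrightarrow> d n \<le> of_int m + 1 - \<theta>"
    and mono: "\<And>n. a \<le> n \<Longrightarrow> Suc n < b \<Longrightarrow> d n \<le> d (Suc n)"
  shows "norm (\<Sum>n=a..<b. e1 (x n)) \<le> 1 / \<theta>"
proof (cases "a < b")
  case False thus ?thesis using th by simp
next
  case True
  define C where "C n = cot (pi * d n)" for n
  define c where "c n = 1 / (1 - e1 (d n))" for n
  define u where "u n = d n - of_int m" for n
  have u: "\<theta> \<le> u n" "u n \<le> 1 - \<theta>" if "a \<le> n" "n < b" for n
    using lo[OF that] hi[OF that] by (auto simp: u_def)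
  have dm: "pi * d n = pi * (u n + of_int m)" for n by (simp add: u_def)
  have sabs: "\<bar>sin (pi * d n)\<bar> = sin (pi * u n)" if "a \<le> n" "n < b" for n
  proof -
    have "\<bar>sin (pi * d n)\<bar> = \<bar>sin (pi * u n)\<bar>"
      by (cases "even m") (simp_all add: dm distrib_left sin_add)
    moreover have "0 \<le> sin (pi * u n)"
      using sin_pi_ge[of \<theta> "u n"] u[OF that] th by auto
    ultimately show ?thesis by simp
  qed
  have sge: "2 * \<theta> \<le> \<bar>sin (pi * d n)\<bar>" if "a \<le> n" "n < b" for n
    using sin_pi_ge[of \<theta> "u n"] u[OF that] th sabs[OF that] by auto
  have sne: "sin (pi * d n) \<noteq> 0" if "a \<le> n" "n < b" for n
    using sge[OF that] th by auto
  have ceq: "c n = (1 + \<i> * of_real (C n)) / 2" if "a \<le> n" "n < b" for n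
    unfolding c_def C_def by (rule inverse_one_minus_e1[OF sne[OF that]])
  have cotb: "\<bar>C n\<bar> \<le> 1 / (2 * \<theta>)" if "a \<le> n" "n < b" for n
  proof -
    have "\<bar>C n\<bar> \<le> 1 / \<bar>sin (pi * d n)\<bar>"
      by (auto simp: C_def cot_def intro!: divide_right_mono)
    also have "\<dots> \<le> 1 / (2 * \<theta>)" using sge[OF that] th by (intro divide_left_mono) auto
    finally show ?thesis .
  qed
  have cb: "norm (c n) \<le> 1 / (4 * \<theta>)" if "a \<le> n" "n < b" for n
  proof -
    have "norm (1 - e1 (d n)) \<ge> 4 * \<theta>"
    proof -
      have "(norm (1 - e1 (d n)))\<^sup>2 = (1 - cos (2 * (pi * d n)))\<^sup>2 + (sin (2 * (pi * d n)))\<^sup>2"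
        by (simp add: cmod_power2 e1_def mult.assoc)
      also have "\<dots> = (2 * sin (pi * d n))\<^sup>2"
        unfolding cos_double_sin sin_double using sin_cos_squared_add[of "pi * d n"] by algebra
      finally have "norm (1 - e1 (d n)) = \<bar>2 * sin (pi * d n)\<bar>"
        by (metis abs_norm_cancel real_sqrt_abs)
      thus ?thesis using sge[OF that] by simp
    qed
    thus ?thesis using th unfolding c_def norm_divide
      by (intro frac_le) auto
  qed
  have Cmono: "C (Suc n) \<le> C n" if "a \<le> n" "Suc n < b" for n
  proof -
    have "cot (pi * u (Suc n)) \<le> cot (pi * u n)"
      using u[of n] u[of "Suc n"] mono[OF that] that th by (intro cot_pi_antimono) (auto simp: u_def)
    thus ?thesis unfolding C_def dm cot_periodic_int .
  qed
  have step_eq: "e1 (x n) = c n * (e1 (x n) - e1 (x (Suc n)))" if "a \<le> n" "n < b" for n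
  proof -
    have "1 - e1 (d n) \<noteq> 0"
    proof
      assume "1 - e1 (d n) = 0"
      hence "c n = 0" by (simp add: c_def)
      thus False using ceq[OF that] by (simp add: complex_eq_iff)
    qed
    moreover have "e1 (x (Suc n)) = e1 (x n) * e1 (d n)"
      by (simp add: d flip: e1_add)
    ultimately show ?thesis by (simp add: c_def field_simps)
  qed
  have abel: "k < b \<Longrightarrow> (\<Sum>n=a..k. e1 (x n)) = c a * e1 (x a) - c k * e1 (x (Suc k))
     + (\<Sum>n=a..<k. (c (Suc n) - c n) * e1 (x (Suc n)))" if "a \<le> k" for k
    using that
  proof (induction k rule: dec_induct)
    case base
    have "e1 (x a) = c a * (e1 (x a) - e1 (x (Suc a)))" by (rule step_eq) (use base in auto)
    thus ?case by (simp add: algebra_simps)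
  next
    case (step k)
    have "(\<Sum>n=a..Suc k. e1 (x n)) = (\<Sum>n=a..k. e1 (x n)) + e1 (x (Suc k))"
      using step.hyps by simp
    also have "\<dots> = (\<Sum>n=a..k. e1 (x n)) + c (Suc k) * (e1 (x (Suc k)) - e1 (x (Suc (Suc k))))"
      using step_eq[of "Suc k"] step by simp
    also have "(\<Sum>n=a..k. e1 (x n)) = c a * e1 (x a) - c k * e1 (x (Suc k))
      + (\<Sum>n=a..<k. (c (Suc n) - c n) * e1 (x (Suc n)))"
      using step by simp
    finally show ?case using step.hyps by (simp add: algebra_simps)
  qed
  \<comment> \<open>The constant real parts cancel in \<open>c (Suc n) - c n\<close>, and the
    cotangents decrease, so the moduli telescope to half the total drop of \<open>C\<close>.\<close>
  have sumC: "k < b \<Longrightarrow> (\<Sum>n=a..<k. norm ((c (Suc n) - c n) * e1 (x (Suc n)))) = (C a - C k) / 2" if "a \<le> k" for k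
    using that
  proof (induction k rule: dec_induct)
    case base thus ?case by simp
  next
    case (step k)
    have "c (Suc k) - c k = of_real ((C (Suc k) - C k) / 2) * \<i>"
      using ceq[of k] ceq[of "Suc k"] step by (simp add: field_simps)
    hence "norm (c (Suc k) - c k) = (C k - C (Suc k)) / 2"
      using Cmono[of k] step by (simp add: norm_mult del: of_real_divide of_real_diff)
    hence "norm ((c (Suc k) - c k) * e1 (x (Suc k))) = (C k - C (Suc k)) / 2"
      by (simp only: norm_mult norm_e1 mult_1_right)
    thus ?case using step by (simp add: diff_divide_distrib)
  qed
  define k where "k = b - 1"
  have k: "a \<le> k" "k < b" "b = Suc k" using True by (auto simp: k_def)
  have "norm (\<Sum>n=a..k. e1 (x n)) \<le> norm (c a * e1 (x a) - c k * e1 (x (Suc k)))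
     + norm (\<Sum>n=a..<k. (c (Suc n) - c n) * e1 (x (Suc n)))"
    unfolding abel[OF k(1,2)] by (rule norm_triangle_ineq)
  also have "norm (\<Sum>n=a..<k. (c (Suc n) - c n) * e1 (x (Suc n))) \<le> (C a - C k) / 2"
    unfolding sumC[OF k(1,2), symmetric] by (rule norm_sum)
  also have "norm (c a * e1 (x a) - c k * e1 (x (Suc k))) \<le> norm (c a) + norm (c k)"
    by (rule order.trans[OF norm_triangle_ineq4]) (simp add: norm_mult)
  also have "norm (c a) + norm (c k) + (C a - C k) / 2 \<le> 1/(4*\<theta>) + 1/(4*\<theta>) + (1 / (2*\<theta>) + 1/(2*\<theta>)) / 2"
    using cb[of a] cb[of k] cotb[of a] cotb[of k] k True by (intro add_mono) auto
  also have "\<dots> = 1 / \<theta>" using th by (simp add: field_simps)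
  finally show ?thesis using k(3) by (simp add: atLeastLessThanSuc_atLeastAtMost)
qed

text \<open>The Kusmin-Landau inequality works on blocks of consecutive indices. A window of values
  of a monotone sequence is taken on exactly such a block, possibly an empty one.\<close>

lemma mono_preimage_interval:
  fixes d :: "nat \<Rightarrow> real"
  assumes mono: "\<And>i j. i \<le> j \<Longrightarrow> j < N \<Longrightarrow> d i \<le> d j"
  obtains a b where "{n. n < N \<and> lo \<le> d n \<and> d n < hi} = {a..<b}" "b \<le> N"
proof -
  define S where "S = {n. n < N \<and> lo \<le> d n \<and> d n < hi}"
  show ?thesis
  proof (cases "S = {}")
    case True thus ?thesis using that[of 0 0] by (simp add: S_def)
  next
    case False
    have fin: "finite S" by (simp add: S_def)
    have "S = {Min S..<Suc (Max S)}"
    proof (intro equalityI subsetI)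
      fix n assume "n \<in> S"
      thus "n \<in> {Min S..<Suc (Max S)}" using fin by (auto simp: less_Suc_eq_le)
    next
      fix n assume n: "n \<in> {Min S..<Suc (Max S)}"
      have "Min S \<in> S" "Max S \<in> S" using fin False by auto
      thus "n \<in> S" using n mono[of "Min S" n] mono[of n "Max S"] by (auto simp: S_def)
    qed
    moreover have "Suc (Max S) \<le> N" using Max_in[OF fin False] by (auto simp: S_def)
    ultimately show ?thesis using that[of "Min S" "Suc (Max S)"] by (simp add: S_def)
  qed
qed

text \<open>
  Terms whose increment is within $\sqrt\mu$ of an integer are estimated trivially, the other ones
  by the Kusmin--Landau inequality.
\<close>

lemma van_der_corput_small:
  fixes x :: "nat \<Rightarrow> real" and d :: "nat \<Rightarrow> real"
  assumes d: "\<And>n. d n = x (Suc n) - x n"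
    and lam: "0 < \<mu>" "\<mu> \<le> 1" and N: "0 < N"
    and gap: "\<And>n. Suc n < N \<Longrightarrow> \<mu> \<le> d (Suc n) - d n"
  shows "norm (\<Sum>n<N. e1 (x n)) \<le> 4 * (d (N - 1) - d 0 + 2) / sqrt \<mu>"
proof -
  \<comment> \<open>This choice balances the two contributions of each integer: at most
    2\<theta>/\<mu> + 1 terms near it, and 1/\<theta> from the Kusmin-Landau inequality away from
    it.\<close>
  define \<theta> where "\<theta> = sqrt \<mu>"
  have th: "0 < \<theta>" "\<theta> \<le> 1" "\<theta> * \<theta> = \<mu>" using lam by (auto simp: \<theta>_def)
  have gaps: "real (j - i) * \<mu> \<le> d j - d i" if "i \<le> j" "j < N" for i j
    using that
  proof (induction j rule: dec_induct)
    case (step j)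
    thus ?case using gap[of j] by (simp add: Suc_diff_le algebra_simps)
  qed simp
  have mono: "d i \<le> d j" if "i \<le> j" "j < N" for i j
    using gaps[OF that] lam by (smt (verit) mult_nonneg_nonneg of_nat_0_le_iff)
  \<comment> \<open>The shift by \<theta> makes the fiber over m equal to m - \<theta> \<le> d n < m
    + 1 - \<theta>: first the increments close to m, then those that keep the distance \<theta> from
    all integers.\<close>
  define F where "F n = \<lfloor>d n + \<theta>\<rfloor>" for n
  define ms where "ms = {F 0..F (N - 1)}"
  have F: "F n \<in> ms" if "n < N" for n
    using mono[of 0 n] mono[of n "N - 1"] that by (auto simp: F_def ms_def intro!: floor_mono)
  have fiber: "norm (\<Sum>n\<in>{n\<in>{..<N}. F n = m}. e1 (x n)) \<le> 4 / \<theta>" for m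
  proof -
    define J where "J = {n. n < N \<and> of_int m - \<theta> \<le> d n \<and> d n < of_int m + \<theta>}"
    define I where "I = {n. n < N \<and> of_int m + \<theta> \<le> d n \<and> d n < of_int m + 1 - \<theta>}"
    \<comment> \<open>For \<theta> > 1/2 the window of \<open>J\<close> reaches into the next fiber,
      so \<open>J'\<close> may be a proper subset of \<open>J\<close>; then \<open>I\<close> is
      empty.\<close>
    define J' where "J' = {n. n < N \<and> F n = m \<and> d n < of_int m + \<theta>}"
    have eq: "{n\<in>{..<N}. F n = m} = J' \<union> I"
      unfolding J'_def I_def F_def using th by (auto simp: floor_eq_iff)
    have dis: "J' \<inter> I = {}" "finite J'" "finite I" unfolding J'_def I_def by auto
    have J'J: "J' \<subseteq> J" by (auto simp: J'_def J_def F_def floor_eq_iff)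
    obtain a b where ab: "J = {a..<b}" "b \<le> N"
      unfolding J_def by (rule mono_preimage_interval[OF mono])
    have "real (card J) \<le> 2 * \<theta> / \<mu> + 1"
    proof (cases "a < b")
      case True
      hence "a \<in> J" "b - 1 \<in> J" using ab by auto
      hence "d (b - 1) - d a \<le> 2 * \<theta>" by (auto simp: J_def)
      with gaps[of a "b - 1"] ab(2) True have "real (b - 1 - a) * \<mu> \<le> 2 * \<theta>" by linarith
      hence "real (b - 1 - a) \<le> 2 * \<theta> / \<mu>" using lam by (simp add: field_simps)
      moreover have "real (card J) = real (b - 1 - a) + 1" using True ab by auto
      ultimately show ?thesis by linarith
    next
      case False thus ?thesis using ab th lam by auto
    qed
    hence "real (card J') \<le> 2 * \<theta> / \<mu> + 1"
      using card_mono[OF _ J'J] by (simp add: ab(1))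
    moreover have "norm (\<Sum>n\<in>J'. e1 (x n)) \<le> real (card J')"
      by (rule order.trans[OF norm_sum]) simp
    moreover have "norm (\<Sum>n\<in>I. e1 (x n)) \<le> 1 / \<theta>"
    proof -
      obtain a b where ab: "I = {a..<b}" "b \<le> N"
        unfolding I_def by (rule mono_preimage_interval[OF mono])
      show ?thesis unfolding ab(1)
      proof (rule kusmin_landau[where d = d and m = m])
        fix n assume "a \<le> n" "n < b"
        hence "n \<in> I" using ab by auto
        thus "of_int m + \<theta> \<le> d n" "d n \<le> of_int m + 1 - \<theta>" by (auto simp: I_def)
      next
        fix n assume "a \<le> n" "Suc n < b"
        thus "d n \<le> d (Suc n)" using mono[of n "Suc n"] ab(2) by simp
      qed (use d th in auto)
    qed
    moreover have "norm (\<Sum>n\<in>{n\<in>{..<N}. F n = m}. e1 (x n)) \<le> norm (\<Sum>n\<in>J'. e1 (x n)) + norm (\<Sum>n\<in>I. e1 (x n))"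
      unfolding eq using dis by (simp add: sum.union_disjoint norm_triangle_ineq)
    ultimately have "norm (\<Sum>n\<in>{n\<in>{..<N}. F n = m}. e1 (x n)) \<le> 2 * \<theta> / \<mu> + 1 + 1 / \<theta>"
      by linarith
    also have "2 * \<theta> / \<mu> = 2 / \<theta>" using th by (simp add: field_simps flip: th(3))
    also have "2 / \<theta> + 1 + 1 / \<theta> \<le> 4 / \<theta>" using th(1,2) by (simp add: field_simps)
    finally show ?thesis .
  qed
  have "(\<Sum>n<N. e1 (x n)) = (\<Sum>m\<in>ms. \<Sum>n\<in>{n\<in>{..<N}. F n = m}. e1 (x n))"
    by (rule sum.group[symmetric]) (use F in \<open>auto simp: ms_def\<close>)
  hence "norm (\<Sum>n<N. e1 (x n)) \<le> (\<Sum>m\<in>ms. 4 / \<theta>)"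
    using fiber by (simp only: sum_norm_le)
  also have "\<dots> = real (card ms) * (4 / \<theta>)" by simp
  also have "\<dots> \<le> (d (N - 1) - d 0 + 2) * (4 / \<theta>)"
  proof (rule mult_right_mono)
    show "real (card ms) \<le> d (N - 1) - d 0 + 2"
      using mono[of 0 "N - 1"] N unfolding ms_def F_def by simp linarith
  qed (use th in auto)
  finally show ?thesis by (simp add: \<theta>_def mult.commute)
qed

lemma van_der_corput:
  fixes x :: "nat \<Rightarrow> real" and d :: "nat \<Rightarrow> real"
  assumes d: "\<And>n. d n = x (Suc n) - x n"
    and lam: "0 < \<mu>" and N: "0 < N"
    and gap: "\<And>n. Suc n < N \<Longrightarrow> \<mu> \<le> d (Suc n) - d n"
  shows "norm (\<Sum>n<N. e1 (x n)) \<le> 4 * (d (N - 1) - d 0 + 2) / sqrt \<mu> + 1"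
proof (cases "\<mu> \<le> 1")
  case True
  from van_der_corput_small[of d x, OF d lam True N gap] show ?thesis by simp
next
  case False
  have "real n * \<mu> \<le> d n - d 0" if "n < N" for n
    using that
  proof (induction n)
    case (Suc n) thus ?case using gap[of n] by (simp add: algebra_simps)
  qed simp
  from this[of "N - 1"] N have 1: "real (N - 1) * \<mu> \<le> d (N - 1) - d 0" by simp
  have D: "0 \<le> d (N - 1) - d 0" using lam by (intro order.trans[OF _ 1]) simp
  have "sqrt \<mu> \<le> \<mu>" using False by (simp add: sqrt_le_D real_le_lsqrt power2_eq_square)
  have "real (N - 1) * sqrt \<mu> \<le> real (N - 1) * \<mu>" 
    using \<open>sqrt \<mu> \<le> \<mu>\<close> by (intro mult_left_mono) auto
  also note 1
  also have "d (N - 1) - d 0 \<le> 4 * (d (N - 1) - d 0 + 2)" using D by simp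
  finally have "real (N - 1) * sqrt \<mu> \<le> 4 * (d (N - 1) - d 0 + 2)" .
  hence "real (N - 1) \<le> 4 * (d (N - 1) - d 0 + 2) / sqrt \<mu>"
    using lam by (simp add: field_simps)
  moreover have "norm (\<Sum>n<N. e1 (x n)) \<le> real N"
    by (rule order.trans[OF norm_sum]) simp
  ultimately show ?thesis using N by (simp add: of_nat_diff)
qed

section \<open>Reduction of sawtooth sums to exponential sums\<close>

definition psi :: "real \<Rightarrow> real" where "psi x = frac x - 1 / 2"

section \<open>Fourier series of the periodic antiderivative of the sawtooth\<close>

definition cos_series :: "real \<Rightarrow> real" where
  "cos_series t = (\<Sum>k. cos (real (Suc k) * t) / (real (Suc k))\<^sup>2)"

lemma summable_inverse_Suc_squares: "summable (\<lambda>k. 1 / (real (Suc k))\<^sup>2)"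
  using inverse_squares_sums by (simp add: sums_iff add.commute)

lemma cos_series_sums: "(\<lambda>k. cos (real (Suc k) * t) / (real (Suc k))\<^sup>2) sums cos_series t"
  unfolding cos_series_def
  by (rule summable_sums, rule summable_comparison_test'[OF summable_inverse_Suc_squares, where N = 0])
     (simp add: divide_right_mono del: of_nat_Suc)

lemma continuous_cos_series: "continuous_on UNIV cos_series"
proof -
  have "uniform_limit UNIV (\<lambda>n t. \<Sum>k<n. cos (real (Suc k) * t) / (real (Suc k))\<^sup>2)
          (\<lambda>t. \<Sum>k. cos (real (Suc k) * t) / (real (Suc k))\<^sup>2) sequentially"
    by (rule Weierstrass_m_test[OF _ summable_inverse_Suc_squares])
       (simp add: divide_right_mono del: of_nat_Suc)
  hence "uniform_limit UNIV (\<lambda>n t. \<Sum>k<n. cos (real (Suc k) * t) / (real (Suc k))\<^sup>2) cos_series sequentially"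
    by (simp add: cos_series_def[abs_def])
  thus ?thesis
    by (rule uniform_limit_theorem[rotated]) (auto intro!: always_eventually continuous_intros)
qed

lemma Dirichlet_kernel:
  "2 * sin (t / 2) * (\<Sum>k<n. cos (real (Suc k) * t)) = sin ((real n + 1 / 2) * t) - sin (t / 2)"
proof (induction n)
  case (Suc n)
  have "sin ((real (Suc n) + 1 / 2) * t) - sin ((real n + 1 / 2) * t)
      = sin (real (Suc n) * t + t / 2) - sin (real (Suc n) * t - t / 2)"
    by (simp add: algebra_simps)
  also have "\<dots> = 2 * sin (t / 2) * cos (real (Suc n) * t)"
    unfolding sin_add sin_diff by (simp add: algebra_simps)
  finally show ?case using Suc by (simp add: distrib_left)
qed simp

text \<open>Minus the derivative of the n-th partial sum of \<open>cos_series t\<close> after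
  subtraction of the expected limit shape \<open>(pi - t)\<^sup>2 / 4\<close>.\<close>

definition sawtooth_remainder :: "nat \<Rightarrow> real \<Rightarrow> real" where
  "sawtooth_remainder n t = (\<Sum>k<n. sin (real (Suc k) * t) / real (Suc k)) - (pi - t) / 2"

text \<open>The derivative of the remainder is a Dirichlet kernel of frequency n + 1/2. Away from
  the multiples of 2 pi, integrating it by parts gains a factor 1/(2n+1). The base point is pi,
  where the remainder vanishes because all sines and pi - t do.\<close>

lemma sawtooth_remainder_bound:
  assumes eps: "0 < \<epsilon>" "\<epsilon> < pi"
  obtains C where "\<And>n t. \<epsilon> \<le> t \<Longrightarrow> t \<le> 2 * pi - \<epsilon> \<Longrightarrow> \<bar>sawtooth_remainder n t\<bar> \<le> C / real (2 * n + 1)"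
proof -
  define \<sigma> where "\<sigma> = sin (\<epsilon> / 2)"
  have \<sigma>: "0 < \<sigma>" "\<sigma> \<le> 1" unfolding \<sigma>_def using eps by (auto intro: sin_gt_zero)
  have sin_ge: "\<sigma> \<le> sin (t / 2)" if "\<epsilon> \<le> t" "t \<le> 2 * pi - \<epsilon>" for t
  proof (cases "t \<le> pi")
    case True thus ?thesis unfolding \<sigma>_def using that eps by (intro sin_monotone_2pi_le) auto
  next
    case False
    have "\<sigma> \<le> sin (pi - t / 2)" unfolding \<sigma>_def using that eps False by (intro sin_monotone_2pi_le) auto
    thus ?thesis by simp
  qed
  define C where "C = 1 / \<sigma> + 1 + pi / (2 * \<sigma>\<^sup>2)"
  have "\<bar>sawtooth_remainder n t\<bar> \<le> C / real (2 * n + 1)" if t: "\<epsilon> \<le> t" "t \<le> 2 * pi - \<epsilon>" for n t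
  proof -
    define q where "q = real (2 * n + 1)"
    have q: "q > 0" "real n + 1 / 2 = q / 2" by (auto simp: q_def)
    \<comment> \<open>the second summand cancels the leading oscillation of the derivative of the first one\<close>
    define Q where "Q t = sawtooth_remainder n t + cos (q / 2 * t) / (q * sin (t / 2))" for t
    define Q' where "Q' t = - (cos (q / 2 * t) * cos (t / 2)) / (2 * q * (sin (t / 2))\<^sup>2)" for t
    have alg: "(- A * (p / 2) * (p * z) - B * (p * (c * (1 / 2)))) / (p * z)\<^sup>2
        = - (B * c) / (2 * p * z\<^sup>2) - A / (2 * z)" if "p > 0" "z > 0" for p z A B c :: real
      using that by (simp add: field_simps power2_eq_square)
    have D: "(Q has_field_derivative Q' u) (at u within {\<epsilon>..2 * pi - \<epsilon>})" if u: "u \<in> {\<epsilon>..2 * pi - \<epsilon>}" for u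
    proof -
      have s: "sin (u / 2) > 0" using sin_ge[of u] u \<sigma> by auto
      have h1: "(sawtooth_remainder n has_field_derivative (\<Sum>k<n. cos (real (Suc k) * u)) + 1 / 2) (at u within {\<epsilon>..2 * pi - \<epsilon>})"
        unfolding sawtooth_remainder_def[abs_def]
        by (auto intro!: derivative_eq_intros simp del: of_nat_Suc)
      have h2: "(\<Sum>k<n. cos (real (Suc k) * u)) + 1 / 2 = sin (q / 2 * u) / (2 * sin (u / 2))"
        using Dirichlet_kernel[of u n] s unfolding q(2) by (simp add: field_simps)
      have h3: "((\<lambda>t. cos (q / 2 * t) / (q * sin (t / 2))) has_field_derivative
          Q' u - sin (q / 2 * u) / (2 * sin (u / 2))) (at u within {\<epsilon>..2 * pi - \<epsilon>})"
      proof -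
        have "((\<lambda>t. cos (q / 2 * t) / (q * sin (t / 2))) has_field_derivative
          (- sin (q / 2 * u) * (q / 2) * (q * sin (u / 2)) - cos (q / 2 * u) * (q * (cos (u / 2) * (1 / 2))))
            / (q * sin (u / 2))\<^sup>2) (at u within {\<epsilon>..2 * pi - \<epsilon>})"
          using s q(1) by (auto intro!: derivative_eq_intros simp: power2_eq_square)
        moreover have "(- sin (q / 2 * u) * (q / 2) * (q * sin (u / 2)) - cos (q / 2 * u) * (q * (cos (u / 2) * (1 / 2))))
            / (q * sin (u / 2))\<^sup>2 = Q' u - sin (q / 2 * u) / (2 * sin (u / 2))"
          using alg[of q "sin (u / 2)" "sin (q / 2 * u)" "cos (q / 2 * u)" "cos (u / 2)"] s q(1)
          unfolding Q'_def by simp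
        ultimately show ?thesis by simp
      qed
      from DERIV_add[OF h1 h3] show ?thesis unfolding Q_def[abs_def] h2 by simp
    qed
    have Q'b: "norm (Q' u) \<le> 1 / (2 * q * \<sigma>\<^sup>2)" if u: "u \<in> {\<epsilon>..2 * pi - \<epsilon>}" for u
    proof -
      have "\<bar>cos (q / 2 * u) * cos (u / 2)\<bar> \<le> 1 * 1"
        unfolding abs_mult by (intro mult_mono) auto
      moreover have "2 * q * \<sigma>\<^sup>2 \<le> 2 * q * (sin (u / 2))\<^sup>2"
        using sin_ge[of u] u \<sigma> q by (auto intro!: power_mono)
      ultimately show ?thesis using \<sigma> q unfolding Q'_def
        by (auto simp: abs_mult intro!: frac_le)
    qed
    have "norm (Q t - Q pi) \<le> 1 / (2 * q * \<sigma>\<^sup>2) * norm (t - pi)"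
      by (rule field_differentiable_bound[OF _ D Q'b]) (use t eps in auto)
    also have "\<dots> \<le> 1 / (2 * q * \<sigma>\<^sup>2) * pi"
      using t eps q \<sigma> by (intro mult_left_mono) auto
    finally have 1: "\<bar>Q t - Q pi\<bar> \<le> pi / (2 * \<sigma>\<^sup>2) / q" by (simp add: field_simps)
    have cosb: "\<bar>cos (q / 2 * u) / (q * sin (u / 2))\<bar> \<le> 1 / \<tau> / q" if "\<tau> \<le> sin (u / 2)" "0 < \<tau>" for u \<tau>
    proof -
      have "\<bar>cos (q / 2 * u)\<bar> / (q * sin (u / 2)) \<le> 1 / (q * \<tau>)"
        using that q by (intro frac_le mult_left_mono) auto
      thus ?thesis using that q by (simp add: abs_mult mult.commute)
    qed
    have 2: "\<bar>cos (q / 2 * t) / (q * sin (t / 2))\<bar> \<le> 1 / \<sigma> / q"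
      using sin_ge[OF t] \<sigma> by (intro cosb) auto
    have 3: "\<bar>cos (q / 2 * pi) / (q * sin (pi / 2))\<bar> \<le> 1 / q"
      using cosb[of 1 pi] by simp
    have "sawtooth_remainder n pi = 0"
      by (simp add: sawtooth_remainder_def mult.commute del: of_nat_Suc)
    moreover have "\<bar>u\<bar> \<le> Y + Z + X" if "v = 0" "\<bar>u + y - (v + z)\<bar> \<le> X" "\<bar>y\<bar> \<le> Y" "\<bar>z\<bar> \<le> Z" for u v y z X Y Z :: real
      using that by linarith
    ultimately have "\<bar>sawtooth_remainder n t\<bar> \<le> 1 / \<sigma> / q + 1 / q + pi / (2 * \<sigma>\<^sup>2) / q"
      using 1 2 3 unfolding Q_def by blast
    also have "\<dots> = C / q" by (simp add: C_def add_divide_distrib)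
    finally show ?thesis by (simp add: q_def)
  qed
  thus ?thesis using that by blast
qed

text \<open>The partial sums minus the parabola have derivatives tending to 0 uniformly on a compact
  interval containing s and t. The mean value bound passes this to differences of values, so the
  limit itself is never differentiated.\<close>

lemma cos_series_parabola_diff:
  assumes "0 < s" "s < 2 * pi" "0 < t" "t < 2 * pi"
  shows "cos_series t - (pi - t)\<^sup>2 / 4 = cos_series s - (pi - s)\<^sup>2 / 4"
proof -
  define \<epsilon> where "\<epsilon> = Min {s, t, 2 * pi - s, 2 * pi - t, pi / 2}"
  have "0 < \<epsilon>" using assms by (auto simp: \<epsilon>_def)
  have "\<epsilon> \<le> s" "\<epsilon> \<le> t" "\<epsilon> \<le> 2 * pi - s" "\<epsilon> \<le> 2 * pi - t" "\<epsilon> \<le> pi / 2"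
    unfolding \<epsilon>_def by (rule Min_le; simp)+
  hence \<epsilon>: "0 < \<epsilon>" "\<epsilon> < pi" "s \<in> {\<epsilon>..2 * pi - \<epsilon>}" "t \<in> {\<epsilon>..2 * pi - \<epsilon>}"
    using \<open>0 < \<epsilon>\<close> by auto
  obtain C where C: "\<And>n t. \<epsilon> \<le> t \<Longrightarrow> t \<le> 2 * pi - \<epsilon> \<Longrightarrow> \<bar>sawtooth_remainder n t\<bar> \<le> C / real (2 * n + 1)"
    using sawtooth_remainder_bound[OF \<epsilon>(1,2)] by blast
  define S where "S n u = (\<Sum>k<n. cos (real (Suc k) * u) / (real (Suc k))\<^sup>2)" for n u
  define G where "G n u = S n u - (pi - u)\<^sup>2 / 4" for n u
  have "norm (G n t - G n s) \<le> C / real (2 * n + 1) * norm (t - s)" for n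
  proof (rule field_differentiable_bound[where S = "{\<epsilon>..2 * pi - \<epsilon>}" and f' = "\<lambda>u. - sawtooth_remainder n u"])
    fix u assume u: "u \<in> {\<epsilon>..2 * pi - \<epsilon>}"
    show "(G n has_field_derivative - sawtooth_remainder n u) (at u within {\<epsilon>..2 * pi - \<epsilon>})"
      unfolding G_def[abs_def] S_def[abs_def] sawtooth_remainder_def
      by (auto intro!: derivative_eq_intros simp del: of_nat_Suc
            simp: sum_negf power2_eq_square field_simps)
    show "norm (- sawtooth_remainder n u) \<le> C / real (2 * n + 1)"
      using C u by simp
  qed (use \<epsilon> in auto)
  moreover have "(\<lambda>n. C / real (2 * n + 1) * norm (t - s)) \<longlonglongrightarrow> 0"
    by real_asymp
  ultimately have "(\<lambda>n. G n t - G n s) \<longlonglongrightarrow> 0"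
    by (intro Lim_null_comparison[where f = "\<lambda>n. G n t - G n s" and g = "\<lambda>n. C / real (2 * n + 1) * norm (t - s)"]
          always_eventually allI)
  moreover have "(\<lambda>n. G n t - G n s) \<longlonglongrightarrow> (cos_series t - (pi - t)\<^sup>2 / 4) - (cos_series s - (pi - s)\<^sup>2 / 4)"
    unfolding G_def S_def using cos_series_sums unfolding sums_def by (intro tendsto_intros) auto
  ultimately show ?thesis using LIMSEQ_unique by fastforce
qed

text \<open>On the open interval the series is the parabola up to a constant. Continuity extends
  this to the endpoints, and evaluation at 0 fixes the constant.\<close>

lemma cos_series_parabola:
  assumes "t \<in> {0..2 * pi}"
  shows "cos_series t = cos_series 0 + t\<^sup>2 / 4 - pi * t / 2"
proof -
  define D where "D t = cos_series t - (pi - t)\<^sup>2 / 4" for t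
  have cont: "continuous_on (closure {0<..<2 * pi}) D"
    unfolding D_def[abs_def]
    by (intro continuous_intros continuous_on_subset[OF continuous_cos_series]) auto
  have "D u = D pi" if "u \<in> closure {0<..<2 * pi}" for u
  proof (rule continuous_constant_on_closure[OF cont _ that])
    fix v assume "v \<in> {0<..<2 * pi}"
    thus "D v = D pi" unfolding D_def by (intro cos_series_parabola_diff) auto
  qed
  from this[of t] this[of 0] assms have "D t = D 0" by simp
  thus ?thesis by (simp add: D_def power2_eq_square field_simps)
qed

text \<open>The periodic Bernoulli function B_2({x}) without its constant 1/6. Its derivative off
  the integers is \<open>2 * psi x\<close>, so
  \<open>(bern x - bern (x - \<tau>)) / (2 * \<tau>)\<close> is the mean of \<open>psi\<close> over
  a window of length \<tau>.\<close>

definition bern :: "real \<Rightarrow> real" where "bern x = (frac x)\<^sup>2 - frac x"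

lemma bern_cos_series: "bern x = (cos_series (2 * pi * x) - cos_series 0) / pi\<^sup>2"
proof -
  have "cos (real (Suc k) * (2 * pi * x)) = cos (real (Suc k) * (2 * pi * frac x))" for k
  proof -
    have "real (Suc k) * (2 * pi * x) = real (Suc k) * (2 * pi * frac x) + 2 * pi * of_int (int (Suc k) * \<lfloor>x\<rfloor>)"
      by (simp add: frac_def algebra_simps)
    thus ?thesis by (simp only: cos_add cos_int_2pin sin_int_2pin)
  qed
  hence "cos_series (2 * pi * x) = cos_series (2 * pi * frac x)"
    by (simp add: cos_series_def)
  also have "\<dots> = cos_series 0 + (2 * pi * frac x)\<^sup>2 / 4 - pi * (2 * pi * frac x) / 2"
    using frac_ge_0[of x] frac_lt_1[of x] by (intro cos_series_parabola) auto
  finally show ?thesis by (simp add: bern_def power2_eq_square field_simps)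
qed

text \<open>
  The jumps of $\psi$ are downward, so $\psi(x)$ is at most $\tau/2$ above its mean over
  $[x - \tau, x]$ and at most $\tau/2$ below its mean over $[x, x + \tau]$.
\<close>

lemma psi_le_bern_diff:
  assumes "0 < \<tau>" "\<tau> \<le> 1"
  shows "psi x \<le> (bern x - bern (x - \<tau>)) / (2 * \<tau>) + \<tau> / 2"
proof (cases "\<tau> \<le> frac x")
  case True
  have fr: "frac (x - \<tau>) = frac x - \<tau>"
    using True assms frac_ge_0[of x] frac_lt_1[of x]
    by (subst frac_unique_iff) (auto simp: frac_def)
  have "(bern x - bern (x - \<tau>)) / (2 * \<tau>) + \<tau> / 2 = psi x"
    using assms by (simp add: fr bern_def psi_def field_simps power2_eq_square)
  thus ?thesis by simp
next
  case False
  show ?thesis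
  proof (cases "\<tau> = 1 \<and> frac x = 0")
    case True
    moreover from this have "frac (x - 1) = 0" by (simp add: frac_def)
    ultimately have "bern x = 0" "bern (x - \<tau>) = 0" "psi x \<le> 0" "\<tau> = 1"
      unfolding bern_def psi_def using True by (simp_all del: frac_eq_0_iff)
    thus ?thesis by simp
  next
    case nt: False
    have fr: "frac (x - \<tau>) = frac x - \<tau> + 1"
      using False nt assms frac_ge_0[of x] frac_lt_1[of x]
      by (subst frac_unique_iff) (auto simp: frac_def, linarith+)
    \<comment> \<open>The window contains a jump. On the part before it, a fraction (\<tau> - frac
      x)/\<tau> of the window, \<open>psi\<close> is larger by 1 than the linear continuation from x
      would be; this is the whole slack.\<close>
    have "(bern x - bern (x - \<tau>)) / (2 * \<tau>) + \<tau> / 2 - psi x = (\<tau> - frac x) / \<tau>"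
      using assms by (simp add: fr bern_def psi_def field_simps power2_eq_square)
    moreover have "\<dots> \<ge> 0" using False assms by simp
    ultimately show ?thesis by linarith
  qed
qed

lemma psi_ge_bern_diff:
  assumes "0 < \<tau>" "\<tau> \<le> 1"
  shows "(bern (x + \<tau>) - bern x) / (2 * \<tau>) - \<tau> / 2 \<le> psi x"
proof (cases "frac x + \<tau> < 1")
  case True
  have fr: "frac (x + \<tau>) = frac x + \<tau>"
    using True assms frac_ge_0[of x] frac_lt_1[of x]
    by (subst frac_unique_iff) (auto simp: frac_def)
  have "(bern (x + \<tau>) - bern x) / (2 * \<tau>) - \<tau> / 2 = psi x"
    unfolding bern_def psi_def fr using assms by (simp add: field_simps power2_eq_square)
  thus ?thesis by simp
next
  case False
  have fr: "frac (x + \<tau>) = frac x + \<tau> - 1"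
    using False assms frac_ge_0[of x] frac_lt_1[of x]
    by (subst frac_unique_iff) (auto simp: frac_def)
  have "psi x - ((bern (x + \<tau>) - bern x) / (2 * \<tau>) - \<tau> / 2) = (frac x + \<tau> - 1) / \<tau>"
    unfolding bern_def psi_def fr using assms by (simp add: field_simps power2_eq_square)
  moreover have "\<dots> \<ge> 0" using False assms by simp
  ultimately show ?thesis by linarith
qed

section \<open>From exponential sums to sums of the sawtooth\<close>

lemma bern_diff_sums:
  "(\<lambda>k. (cos (2 * pi * (real (Suc k) * y)) - cos (2 * pi * (real (Suc k) * z))) / (pi * real (Suc k))\<^sup>2)
     sums (bern y - bern z)"
proof -
  have "(\<lambda>k. (cos (real (Suc k) * (2 * pi * y)) / (real (Suc k))\<^sup>2 - cos (real (Suc k) * (2 * pi * z)) / (real (Suc k))\<^sup>2) / pi\<^sup>2)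
     sums ((cos_series (2 * pi * y) - cos_series (2 * pi * z)) / pi\<^sup>2)"
    by (intro sums_divide sums_diff cos_series_sums)
  also have "(cos_series (2 * pi * y) - cos_series (2 * pi * z)) / pi\<^sup>2 = bern y - bern z"
    by (simp add: bern_cos_series flip: diff_divide_distrib)
  also have "(\<lambda>k. (cos (real (Suc k) * (2 * pi * y)) / (real (Suc k))\<^sup>2 - cos (real (Suc k) * (2 * pi * z)) / (real (Suc k))\<^sup>2) / pi\<^sup>2)
    = (\<lambda>k. (cos (2 * pi * (real (Suc k) * y)) - cos (2 * pi * (real (Suc k) * z))) / (pi * real (Suc k))\<^sup>2)"
    by (simp add: power_mult_distrib diff_divide_distrib mult_ac del: of_nat_Suc)
  finally show ?thesis .
qed

lemma norm_one_minus_e1: "norm (1 - e1 t) \<le> min 2 (2 * pi * \<bar>t\<bar>)"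
proof -
  have "norm (1 - e1 t) \<le> 2"
    using norm_triangle_ineq4[of 1 "e1 t"] by simp
  moreover have "norm (1 - e1 t) \<le> 2 * pi * \<bar>t\<bar>"
  proof -
    have "(norm (1 - e1 t))\<^sup>2 = (1 - cos (2 * (pi * t)))\<^sup>2 + (sin (2 * (pi * t)))\<^sup>2"
      by (simp add: cmod_power2 e1_def mult.assoc)
    also have "\<dots> = (2 * sin (pi * t))\<^sup>2"
      unfolding cos_double_sin sin_double using sin_cos_squared_add[of "pi * t"] by algebra
    finally have "norm (1 - e1 t) = \<bar>2 * sin (pi * t)\<bar>"
      by (metis abs_norm_cancel real_sqrt_abs)
    also have "\<dots> \<le> 2 * \<bar>pi * t\<bar>" using abs_sin_x_le_abs_x[of "pi * t"] by simp
    finally show ?thesis by (simp add: abs_mult)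
  qed
  ultimately show ?thesis by simp
qed

text \<open>A common shift t multiplies every term by the same e(kt), which therefore leaves the
  sum. The factor |1 - e(kt)| is small for low frequencies and supplies the saving from the
  smoothing step.\<close>

lemma cos_diff_sum_bound:
  assumes "finite A"
  shows "\<bar>\<Sum>n\<in>A. cos (2 * pi * (k * x n)) - cos (2 * pi * (k * (x n + t)))\<bar>
    \<le> norm (\<Sum>n\<in>A. e1 (k * x n)) * min 2 (2 * pi * \<bar>k * t\<bar>)"
proof -
  have "(\<Sum>n\<in>A. cos (2 * pi * (k * x n)) - cos (2 * pi * (k * (x n + t))))
     = Re ((\<Sum>n\<in>A. e1 (k * x n)) * (1 - e1 (k * t)))"
  proof -
    have "Re (e1 (k * x n) * (1 - e1 (k * t))) = cos (2 * pi * (k * x n)) - cos (2 * pi * (k * (x n + t)))" for n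
    proof -
      have "e1 (k * x n) * (1 - e1 (k * t)) = e1 (k * x n) - e1 (k * (x n + t))"
        by (simp add: distrib_left e1_add right_diff_distrib)
      thus ?thesis by (simp add: e1_def)
    qed
    thus ?thesis by (simp add: sum_distrib_right)
  qed
  also have "\<bar>\<dots>\<bar> \<le> norm ((\<Sum>n\<in>A. e1 (k * x n)) * (1 - e1 (k * t)))" by (rule abs_Re_le_cmod)
  also have "\<dots> \<le> norm (\<Sum>n\<in>A. e1 (k * x n)) * min 2 (2 * pi * \<bar>k * t\<bar>)"
    unfolding norm_mult by (intro mult_left_mono norm_one_minus_e1) auto
  finally show ?thesis .
qed

text \<open>Telescoping majorants for the sums of k^{-1/2} and k^{-3/2}. Both rest on (2v - 2u) v =
  1 + (v - u)^2 for u = sqrt x and v = sqrt(x + 1).\<close>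

lemma inverse_sqrt_le_diff:
  assumes "0 < x"
  shows "1 / sqrt (x + 1) \<le> 2 * sqrt (x + 1) - 2 * sqrt x"
    and "1 / ((x + 1) * sqrt (x + 1)) \<le> 2 / sqrt x - 2 / sqrt (x + 1)"
proof -
  define u v where "u = sqrt x" and "v = sqrt (x + 1)"
  have uv: "0 < u" "u \<le> v" "v * v = u * u + 1" "x + 1 = v * v" using assms by (auto simp: u_def v_def)
  have "(2 * v - 2 * u) * v - 1 = (v - u) * (v - u)" using uv(3) by (simp add: algebra_simps)
  hence 1: "1 \<le> (2 * v - 2 * u) * v" by (smt (verit) zero_le_square)
  thus "1 / sqrt (x + 1) \<le> 2 * sqrt (x + 1) - 2 * sqrt x"
    using uv unfolding u_def[symmetric] v_def[symmetric] by (subst divide_le_eq) auto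
  have "2 / u - 2 / v = (2 * v - 2 * u) / (u * v)" using uv by (simp add: field_simps)
  moreover have "1 / v / (v * v) \<le> (2 * v - 2 * u) / (u * v)"
    using 1 uv by (intro frac_le mult_right_mono) (auto simp: divide_le_eq)
  moreover have "1 / ((x + 1) * sqrt (x + 1)) = 1 / v / (v * v)"
    unfolding v_def[symmetric] uv(4) using uv(1,2) by (simp add: mult_ac)
  ultimately have "1 / ((x + 1) * sqrt (x + 1)) \<le> 2 / u - 2 / v" by simp
  thus "1 / ((x + 1) * sqrt (x + 1)) \<le> 2 / sqrt x - 2 / sqrt (x + 1)"
    by (simp only: u_def v_def)
qed

lemma sum_inverse_sqrt_cube: "(\<Sum>k<n. 1 / (real (Suc k) * sqrt (real (Suc k)))) \<le> 3"
proof -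
  have "(\<Sum>k<Suc m. 1 / (real (Suc k) * sqrt (real (Suc k)))) \<le> 3 - 2 / sqrt (real (Suc m))" for m
  proof (induction m)
    case (Suc m)
    have "1 / (real (Suc (Suc m)) * sqrt (real (Suc (Suc m)))) \<le> 2 / sqrt (real (Suc m)) - 2 / sqrt (real (Suc (Suc m)))"
      using inverse_sqrt_le_diff(2)[of "real (Suc m)"] by (simp add: add.commute)
    with Suc show ?case by simp
  qed simp
  moreover have "0 \<le> 2 / sqrt (real (Suc m))" for m by simp
  ultimately have "(\<Sum>k<Suc m. 1 / (real (Suc k) * sqrt (real (Suc k)))) \<le> 3" for m
    by (smt (verit))
  thus ?thesis by (cases n) auto
qed

text \<open>Frequencies up to K contribute k^{-1/2} each, those beyond K contribute K k^{-3/2};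
  either range sums to O(sqrt K).\<close>

lemma sum_sqrt_min:
  assumes K: "0 < K"
  shows "(\<Sum>k<n. sqrt (real (Suc k)) * min (1 / real (Suc k)) (real K / (real (Suc k))\<^sup>2)) \<le> 4 * sqrt (real K)"
proof -
  define T where "T k = sqrt (real (Suc k)) * min (1 / real (Suc k)) (real K / (real (Suc k))\<^sup>2)" for k
  have T1: "T k \<le> 1 / sqrt (real (Suc k))" for k
  proof -
    have "T k \<le> sqrt (real (Suc k)) * (1 / real (Suc k))"
      unfolding T_def by (intro mult_left_mono) auto
    also have "\<dots> = 1 / sqrt (real (Suc k))" by (simp add: real_div_sqrt field_simps del: of_nat_Suc)
    finally show ?thesis .
  qed
  have T2: "T k \<le> real K * (1 / (real (Suc k) * sqrt (real (Suc k))))" for k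
  proof -
    have "T k \<le> sqrt (real (Suc k)) * (real K / (real (Suc k))\<^sup>2)"
      unfolding T_def by (intro mult_left_mono) auto
    also have "\<dots> = real K * (1 / (real (Suc k) * sqrt (real (Suc k))))"
      by (simp add: power2_eq_square field_simps del: of_nat_Suc)
    finally show ?thesis .
  qed
  have small: "(\<Sum>k<m. T k) \<le> 2 * sqrt (real m)" for m
  proof (induction m)
    case (Suc m)
    have "1 / sqrt (real (Suc m)) \<le> 2 * sqrt (real (Suc m)) - 2 * sqrt (real m)"
      using inverse_sqrt_le_diff(1)[of "real m"] by (cases "m = 0") (auto simp: add.commute)
    with Suc T1[of m] show ?case by simp
  qed simp
  \<comment> \<open>The subtracted term makes the bound equal to 2 sqrt K at m = K, where
    \<open>small\<close> starts the induction, and its decrease pays for each further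
    summand.\<close>
  have large: "(\<Sum>k<m. T k) \<le> 4 * sqrt (real K) - 2 * real K / sqrt (real m)" if "K \<le> m" for m
    using that
  proof (induction m rule: dec_induct)
    case base
    have "real K / sqrt (real K) = sqrt (real K)" by (rule real_div_sqrt) simp
    thus ?case using small[of K] by simp
  next
    case (step m)
    have "real K * (1 / (real (Suc m) * sqrt (real (Suc m)))) \<le> real K * (2 / sqrt (real m) - 2 / sqrt (real (Suc m)))"
      using inverse_sqrt_le_diff(2)[of "real m"] step K by (intro mult_left_mono) (auto simp: add.commute)
    with T2[of m] have "T m \<le> 2 * real K / sqrt (real m) - 2 * real K / sqrt (real (Suc m))"
      by (simp add: right_diff_distrib mult.commute del: of_nat_Suc)
    moreover have "(\<Sum>k<m. T k) \<le> 4 * sqrt (real K) - 2 * real K / sqrt (real m)"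
      using step by simp
    ultimately show ?case by (simp del: of_nat_Suc)
  qed
  show ?thesis
  proof (cases "K \<le> n")
    case True
    have "0 \<le> 2 * real K / sqrt (real n)" by simp
    with large[OF True] show ?thesis unfolding T_def by linarith
  next
    case False
    hence "sqrt (real n) \<le> 2 * sqrt (real K)" by (simp add: order.trans[OF real_sqrt_le_mono[of "real n" "real K"]])
    with small[of n] show ?thesis unfolding T_def by linarith
  qed
qed

text \<open>The form a sqrt k + b / sqrt k is the one produced by van der Corput's method. With
  windows of length 1/K the smoothing costs at most 1/K per term, and the k-th coefficient is at
  most min(1/k, K/k^2): the first part then sums to 4 a sqrt K, while the second already converges
  with 1/k and sums to 3b.\<close>

lemma abs_sum_psi_le:
  fixes x :: "'a \<Rightarrow> real"
  assumes A: "finite A" and K: "0 < K" and ab: "0 \<le> a" "0 \<le> b"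
    and E: "\<And>k. norm (\<Sum>n\<in>A. e1 (real (Suc k) * x n)) \<le> a * sqrt (real (Suc k)) + b / sqrt (real (Suc k))"
  shows "\<bar>\<Sum>n\<in>A. psi (x n)\<bar> \<le> real (card A) / real K + 4 * a * sqrt (real K) + 3 * b"
proof -
  define \<tau> where "\<tau> = 1 / real K"
  have \<tau>: "0 < \<tau>" "\<tau> \<le> 1" using K by (auto simp: \<tau>_def)
  \<comment> \<open>Both signs of t occur: the backward window bounds the sum from above, the
    forward window from below.\<close>
  have shift: "\<bar>\<Sum>n\<in>A. bern (x n) - bern (x n + t)\<bar> / (2 * \<tau>) \<le> 4 * a * sqrt (real K) + 3 * b"
    if t: "\<bar>t\<bar> = \<tau>" for t
  proof -
    define c where "c k = (\<Sum>n\<in>A. (cos (2 * pi * (real (Suc k) * x n)) - cos (2 * pi * (real (Suc k) * (x n + t))))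
      / (pi * real (Suc k))\<^sup>2) / (2 * \<tau>)" for k
    have cs: "c sums ((\<Sum>n\<in>A. bern (x n) - bern (x n + t)) / (2 * \<tau>))"
      unfolding c_def[abs_def] by (intro sums_divide sums_sum bern_diff_sums)
    have cb: "\<bar>c k\<bar> \<le> a * (sqrt (real (Suc k)) * min (1 / real (Suc k)) (real K / (real (Suc k))\<^sup>2))
        + b * (1 / (real (Suc k) * sqrt (real (Suc k))))" for k
    proof -
      define q where "q = real (Suc k)"
      have q: "q > 0" by (simp add: q_def)
      define E where "E = norm (\<Sum>n\<in>A. e1 (q * x n))"
      have E0: "0 \<le> E" by (simp add: E_def)
      have "\<bar>c k\<bar> = \<bar>\<Sum>n\<in>A. cos (2 * pi * (q * x n)) - cos (2 * pi * (q * (x n + t)))\<bar> / ((pi * q)\<^sup>2 * (2 * \<tau>))"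
        unfolding c_def q_def[symmetric] using \<tau> by (simp add: abs_mult power_mult_distrib flip: sum_divide_distrib)
      also have "\<dots> \<le> E * min 2 (2 * pi * \<bar>q * t\<bar>) / ((pi * q)\<^sup>2 * (2 * \<tau>))"
        unfolding E_def using \<tau> q by (intro divide_right_mono cos_diff_sum_bound A) auto
      also have "\<dots> = E * (min 2 (2 * pi * (q * \<tau>)) / ((pi * q)\<^sup>2 * (2 * \<tau>)))"
        using q t by (simp add: abs_mult)
      also have "\<dots> \<le> E * min (1 / q) (real K / q\<^sup>2)"
      proof (rule mult_left_mono[OF min.boundedI E0])
        have "min 2 (2 * pi * (q * \<tau>)) / ((pi * q)\<^sup>2 * (2 * \<tau>)) \<le> 2 * pi * (q * \<tau>) / ((pi * q)\<^sup>2 * (2 * \<tau>))"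
          using q \<tau> by (intro divide_right_mono) auto
        also have "\<dots> = (1 / q) / pi" using q \<tau> by (simp add: field_simps power2_eq_square)
        also have "\<dots> \<le> (1 / q) / 1" using pi_gt3 q by (intro divide_left_mono) auto
        finally show "min 2 (2 * pi * (q * \<tau>)) / ((pi * q)\<^sup>2 * (2 * \<tau>)) \<le> 1 / q" by simp
        have "min 2 (2 * pi * (q * \<tau>)) / ((pi * q)\<^sup>2 * (2 * \<tau>)) \<le> 2 / ((pi * q)\<^sup>2 * (2 * \<tau>))"
          using q \<tau> by (intro divide_right_mono) auto
        also have "\<dots> = (real K / q\<^sup>2) / pi\<^sup>2" using q K by (simp add: \<tau>_def field_simps power2_eq_square)
        also have "\<dots> \<le> (real K / q\<^sup>2) / 1"
          using pi_gt3 q by (intro divide_left_mono) (auto simp: power2_eq_square intro: order.trans[OF _ mult_mono[of 1 pi 1 pi]])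
        finally show "min 2 (2 * pi * (q * \<tau>)) / ((pi * q)\<^sup>2 * (2 * \<tau>)) \<le> real K / q\<^sup>2" by simp
      qed
      also have "\<dots> \<le> (a * sqrt q + b / sqrt q) * min (1 / q) (real K / q\<^sup>2)"
        using assms(5)[of k] q unfolding E_def q_def by (intro mult_right_mono) auto
      also have "\<dots> = a * (sqrt q * min (1 / q) (real K / q\<^sup>2)) + b * (1 / sqrt q * min (1 / q) (real K / q\<^sup>2))"
        by (simp add: algebra_simps)
      also have "b * (1 / sqrt q * min (1 / q) (real K / q\<^sup>2)) \<le> b * (1 / sqrt q * (1 / q))"
        using q ab by (intro mult_left_mono) auto
      finally show ?thesis by (simp add: q_def mult.commute)
    qed
    have "(\<lambda>n. \<bar>\<Sum>k<n. c k\<bar>) \<longlonglongrightarrow> \<bar>(\<Sum>n\<in>A. bern (x n) - bern (x n + t)) / (2 * \<tau>)\<bar>"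
      using cs unfolding sums_def by (rule tendsto_rabs)
    moreover have "\<bar>\<Sum>k<n. c k\<bar> \<le> 4 * a * sqrt (real K) + 3 * b" for n
    proof -
      have "\<bar>\<Sum>k<n. c k\<bar> \<le> (\<Sum>k<n. a * (sqrt (real (Suc k)) * min (1 / real (Suc k)) (real K / (real (Suc k))\<^sup>2))
        + b * (1 / (real (Suc k) * sqrt (real (Suc k)))))"
        by (rule order.trans[OF sum_abs]) (intro sum_mono cb)
      also have "\<dots> = a * (\<Sum>k<n. sqrt (real (Suc k)) * min (1 / real (Suc k)) (real K / (real (Suc k))\<^sup>2))
        + b * (\<Sum>k<n. 1 / (real (Suc k) * sqrt (real (Suc k))))"
        by (simp only: sum.distrib sum_distrib_left)
      also have "\<dots> \<le> a * (4 * sqrt (real K)) + b * 3"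
        by (intro add_mono mult_left_mono sum_sqrt_min sum_inverse_sqrt_cube K ab)
      finally show ?thesis by (simp add: mult_ac)
    qed
    ultimately have "\<bar>(\<Sum>n\<in>A. bern (x n) - bern (x n + t)) / (2 * \<tau>)\<bar> \<le> 4 * a * sqrt (real K) + 3 * b"
      by (intro LIMSEQ_le_const2[of "\<lambda>n. \<bar>\<Sum>k<n. c k\<bar>"] exI[of _ 0]) auto
    thus ?thesis using \<tau> by simp
  qed
  have card: "real (card A) * (\<tau> / 2) \<le> real (card A) / real K"
    unfolding \<tau>_def using K by (simp add: divide_left_mono)
  have "(\<Sum>n\<in>A. psi (x n)) \<le> (\<Sum>n\<in>A. (bern (x n) - bern (x n - \<tau>)) / (2 * \<tau>) + \<tau> / 2)"
    by (intro sum_mono psi_le_bern_diff \<tau>)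
  also have "\<dots> = (\<Sum>n\<in>A. bern (x n) - bern (x n + - \<tau>)) / (2 * \<tau>) + real (card A) * (\<tau> / 2)"
    by (simp add: sum.distrib sum_divide_distrib)
  also have "(\<Sum>n\<in>A. bern (x n) - bern (x n + - \<tau>)) / (2 * \<tau>) \<le> \<bar>\<Sum>n\<in>A. bern (x n) - bern (x n + - \<tau>)\<bar> / (2 * \<tau>)"
    using \<tau> by (intro divide_right_mono) auto
  also have "\<dots> \<le> 4 * a * sqrt (real K) + 3 * b"
    by (rule shift) (use \<tau> in auto)
  finally have up: "(\<Sum>n\<in>A. psi (x n)) \<le> real (card A) / real K + 4 * a * sqrt (real K) + 3 * b"
    using card by linarith
  have "- (4 * a * sqrt (real K) + 3 * b) \<le> - (\<bar>\<Sum>n\<in>A. bern (x n) - bern (x n + \<tau>)\<bar> / (2 * \<tau>))"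
    using shift[of \<tau>] \<tau> by simp
  also have "\<dots> \<le> - ((\<Sum>n\<in>A. bern (x n) - bern (x n + \<tau>)) / (2 * \<tau>))"
    unfolding neg_le_iff_le using \<tau> by (intro divide_right_mono) auto
  also have "\<dots> = (\<Sum>n\<in>A. (bern (x n + \<tau>) - bern (x n)) / (2 * \<tau>) - \<tau> / 2) + real (card A) * (\<tau> / 2)"
    by (simp add: sum_subtractf sum_divide_distrib diff_divide_distrib)
  also have "(\<Sum>n\<in>A. (bern (x n + \<tau>) - bern (x n)) / (2 * \<tau>) - \<tau> / 2) \<le> (\<Sum>n\<in>A. psi (x n))"
    by (intro sum_mono psi_ge_bern_diff \<tau>)
  finally show ?thesis using up card by linarith
qed

section \<open>Sawtooth sums along a convex function\<close>

lemma abs_psi_le: "\<bar>psi x\<bar> \<le> 1 / 2"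
  using frac_ge_0[of x] frac_lt_1[of x] by (auto simp: psi_def abs_if)

text \<open>Multiplying the sequence by k scales its increments and their gaps alike. The estimate
  becomes 4D sqrt k / sqrt \<mu> + 8 / sqrt(\<mu> k) + 1, and the 1 is absorbed into the coefficient
  of sqrt k.\<close>

lemma sum_psi_convex_sequence:
  fixes x :: "nat \<Rightarrow> real" and d :: "nat \<Rightarrow> real"
  assumes d: "\<And>n. d n = x (Suc n) - x n"
    and mu: "0 < \<mu>" and N: "0 < N" and K: "0 < K"
    and gap: "\<And>n. Suc n < N \<Longrightarrow> \<mu> \<le> d (Suc n) - d n"
  shows "\<bar>\<Sum>n<N. psi (x n)\<bar> \<le> real N / real K
    + 4 * (4 * (d (N - 1) - d 0) / sqrt \<mu> + 1) * sqrt (real K) + 3 * (8 / sqrt \<mu>)"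
proof -
  define D where "D = d (N - 1) - d 0"
  have D: "0 \<le> D"
  proof -
    have "d 0 \<le> d n" if "n < N" for n
      using that
    proof (induction n)
      case (Suc n) thus ?case using gap[of n] mu by simp
    qed simp
    thus ?thesis using N by (simp add: D_def)
  qed
  have "\<bar>\<Sum>n\<in>{..<N}. psi (x n)\<bar> \<le> real (card {..<N}) / real K
    + 4 * (4 * D / sqrt \<mu> + 1) * sqrt (real K) + 3 * (8 / sqrt \<mu>)"
  proof (rule abs_sum_psi_le)
    fix k :: nat
    define q where "q = real (Suc k)"
    have q: "1 \<le> q" by (simp add: q_def)
    have "norm (\<Sum>n<N. e1 (q * x n)) \<le> 4 * ((q * d (N - 1) - q * d 0) + 2) / sqrt (q * \<mu>) + 1"
    proof (rule van_der_corput)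
      fix n assume "Suc n < N"
      thus "q * \<mu> \<le> q * d (Suc n) - q * d n"
        using gap[of n] q by (simp flip: right_diff_distrib)
    qed (use q mu N in \<open>auto simp: d right_diff_distrib\<close>)
    also have "q * d (N - 1) - q * d 0 = q * D" by (simp add: D_def right_diff_distrib)
    also have "4 * (q * D + 2) / sqrt (q * \<mu>) = 4 * D / sqrt \<mu> * (q / sqrt q) + 8 / sqrt \<mu> / sqrt q"
      using q mu by (simp add: real_sqrt_mult field_simps)
    also have "q / sqrt q = sqrt q" using q by (simp add: real_div_sqrt)
    also have "4 * D / sqrt \<mu> * sqrt q + 8 / sqrt \<mu> / sqrt q + 1 \<le> (4 * D / sqrt \<mu> + 1) * sqrt q + 8 / sqrt \<mu> / sqrt q"
      using q by (simp add: distrib_right)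
    finally show "norm (\<Sum>n<N. e1 (real (Suc k) * x n)) \<le> (4 * D / sqrt \<mu> + 1) * sqrt (real (Suc k)) + 8 / sqrt \<mu> / sqrt (real (Suc k))"
      unfolding q_def .
  qed (use D mu K in auto)
  thus ?thesis by (simp add: D_def)
qed

lemma finite_nat_multiples:
  fixes h :: real
  assumes "0 < h" shows "finite {j::nat. u < real j * h \<and> real j * h \<le> v}"
proof (rule finite_subset)
  show "{j::nat. u < real j * h \<and> real j * h \<le> v} \<subseteq> {..nat \<lfloor>v / h\<rfloor>}"
    using assms by (auto simp: le_nat_floor field_simps)
qed simp

lemma nat_multiples_interval:
  fixes h :: real
  assumes "0 < h" "{j::nat. u < real j * h \<and> real j * h \<le> v} \<noteq> {}"
  obtains a b where "{j::nat. u < real j * h \<and> real j * h \<le> v} = {a..b}" "a \<le> b"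
proof -
  define S where "S = {j::nat. u < real j * h \<and> real j * h \<le> v}"
  have fin: "finite S" unfolding S_def by (rule finite_nat_multiples) fact
  have ne: "S \<noteq> {}" using assms by (simp add: S_def)
  have "S = {Min S..Max S}"
  proof (intro equalityI subsetI)
    fix n assume "n \<in> S" thus "n \<in> {Min S..Max S}" using fin by auto
  next
    fix n assume n: "n \<in> {Min S..Max S}"
    have "Min S \<in> S" "Max S \<in> S" using fin ne by auto
    moreover have "real (Min S) * h \<le> real n * h" "real n * h \<le> real (Max S) * h"
      using n assms(1) by auto
    ultimately show "n \<in> S" by (auto simp: S_def)
  qed
  moreover have "Min S \<le> Max S" using fin ne by simp
  ultimately show ?thesis using that by (simp add: S_def)
qed

lemma card_nat_multiples:
  fixes h :: real
  assumes "0 < h" "u \<le> v"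
  shows "real (card {j::nat. u < real j * h \<and> real j * h \<le> v}) \<le> (v - u) / h + 1"
proof (cases "{j::nat. u < real j * h \<and> real j * h \<le> v} = {}")
  case True thus ?thesis using assms by (simp only:) simp
next
  case False
  obtain a b where ab: "{j::nat. u < real j * h \<and> real j * h \<le> v} = {a..b}" "a \<le> b"
    using nat_multiples_interval[OF assms(1) False] by blast
  hence "a \<in> {j::nat. u < real j * h \<and> real j * h \<le> v}" "b \<in> {j::nat. u < real j * h \<and> real j * h \<le> v}" by auto
  hence "(real b - real a) * h \<le> v - u" by (simp add: left_diff_distrib)
  hence "real b - real a \<le> (v - u) / h" using assms by (simp add: field_simps)
  thus ?thesis unfolding ab(1) using ab(2) by (simp add: of_nat_diff)
qed

text \<open>The range is half-open so that sums over adjacent intervals add up exactly.\<close>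

definition psi_sum :: "(real \<Rightarrow> real) \<Rightarrow> real \<Rightarrow> real \<Rightarrow> real \<Rightarrow> real \<Rightarrow> real" where
  "psi_sum f c h u v = (\<Sum>j\<in>{j::nat. u < real j * h \<and> real j * h \<le> v}. psi (c * f (real j * h)))"

lemma abs_psi_sum_trivial:
  assumes "0 < h" "u \<le> v"
  shows "\<bar>psi_sum f c h u v\<bar> \<le> (v - u) / h + 1"
proof -
  have "\<bar>psi_sum f c h u v\<bar> \<le> (\<Sum>j\<in>{j::nat. u < real j * h \<and> real j * h \<le> v}. 1)"
    unfolding psi_sum_def
    by (rule order.trans[OF sum_abs], rule sum_mono, rule order.trans[OF abs_psi_le]) simp
  also have "\<dots> \<le> (v - u) / h + 1" using card_nat_multiples[OF assms] by simp
  finally show ?thesis .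
qed

lemma psi_sum_split:
  assumes "0 < h" "u \<le> v" "v \<le> w"
  shows "psi_sum f c h u w = psi_sum f c h u v + psi_sum f c h v w"
proof -
  have "{j::nat. u < real j * h \<and> real j * h \<le> w} = {j. u < real j * h \<and> real j * h \<le> v} \<union> {j. v < real j * h \<and> real j * h \<le> w}"
    using assms by auto
  thus ?thesis unfolding psi_sum_def
    by (simp only:) (rule sum.union_disjoint, use finite_nat_multiples[OF assms(1)] in auto)
qed

lemma MVT_interior:
  fixes f f' :: "real \<Rightarrow> real"
  assumes "a < b" "continuous_on {a..b} f"
    and D: "\<And>x. a < x \<Longrightarrow> x < b \<Longrightarrow> (f has_real_derivative f' x) (at x)"
  shows "\<exists>z. a < z \<and> z < b \<and> f b - f a = (b - a) * f' z"
proof -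
  obtain l z where "a < z" "z < b" "(f has_real_derivative l) (at z)" "f b - f a = (b - a) * l"
    using MVT[OF assms(1,2)] D by (metis real_differentiable_def)
  with D[of z] show ?thesis by (metis DERIV_unique)
qed

text \<open>The second differences of c f(jh) are at least c h^2 \<mu>, and its increments vary by
  at most c h (f' v - f' u); these are the two inputs of the bound for convex sequences. Hypothesis
  \<open>inc\<close> expresses the lower bound on curvature through \<open>f'\<close> alone.\<close>

lemma psi_sum_interval:
  fixes f f' :: "real \<Rightarrow> real"
  assumes pos: "0 < h" "0 < c" "0 < K" "0 < \<mu>" and uv: "u \<le> v"
    and D: "\<And>x. x \<in> {u..v} \<Longrightarrow> (f has_real_derivative f' x) (at x within {u..v})"
    and inc: "\<And>x y. u \<le> x \<Longrightarrow> x \<le> y \<Longrightarrow> y \<le> v \<Longrightarrow> \<mu> * (y - x) \<le> f' y - f' x"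
  shows "\<bar>psi_sum f c h u v\<bar> \<le> (v - u) / h / real K
    + 4 * (4 * (c * h * (f' v - f' u)) / sqrt (c * h\<^sup>2 * \<mu>) + 1) * sqrt (real K) + 24 / sqrt (c * h\<^sup>2 * \<mu>) + 1"
    (is "_ \<le> ?B")
proof -
  have f'uv: "0 \<le> f' v - f' u" using inc[of u v] uv pos by (smt (verit) mult_nonneg_nonneg)
  have B1: "0 \<le> (v - u) / h / real K" "0 \<le> 4 * (4 * (c * h * (f' v - f' u)) / sqrt (c * h\<^sup>2 * \<mu>) + 1) * sqrt (real K)"
    "0 \<le> 24 / sqrt (c * h\<^sup>2 * \<mu>)"
    using f'uv uv pos by auto
  show ?thesis
  proof (cases "{j::nat. u < real j * h \<and> real j * h \<le> v} = {}")
    case True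
    thus ?thesis using B1 unfolding psi_sum_def True by simp
  next
    case False
    obtain a b where ab: "{j::nat. u < real j * h \<and> real j * h \<le> v} = {a..b}" "a \<le> b"
      using nat_multiples_interval[OF pos(1) False] by blast
    have "a \<in> {a..b}" "b \<in> {a..b}" using ab by auto
    hence ua: "u < real a * h" "real b * h \<le> v" unfolding ab(1)[symmetric] by auto
    define N where "N = b - a"
    define y where "y n = real (a + n) * h" for n
    have ySuc: "y (Suc n) = y n + h" for n by (simp add: y_def algebra_simps)
    have y: "u \<le> y n" "y n \<le> v" if "n \<le> N" for n
    proof -
      have "real a * h \<le> y n" "y n \<le> real b * h"
        unfolding y_def using pos that ab(2) by (auto simp: N_def intro!: mult_right_mono)
      thus "u \<le> y n" "y n \<le> v" using ua by auto
    qed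
    define x where "x n = c * f (y n)" for n
    define d where "d n = x (Suc n) - x n" for n
    have cont: "continuous_on {u..v} f"
      using D by (meson DERIV_continuous continuous_on_eq_continuous_within)
    have D': "(f has_real_derivative f' x) (at x)" if "u < x" "x < v" for x
      using D[of x] that by (simp add: at_within_Icc_at)
    have mvt: "\<exists>z. p < z \<and> z < q \<and> f q - f p = (q - p) * f' z" if "u \<le> p" "p < q" "q \<le> v" for p q
      using that D' by (intro MVT_interior continuous_on_subset[OF cont]) auto
    \<comment> \<open>There are N + 1 sample points but only N increments between them. The last
      term is split off; it is bounded by 1/2 and covered by the final + 1.\<close>
    have sumeq: "psi_sum f c h u v = (\<Sum>n<N. psi (x n)) + psi (x N)"
    proof -
      have "(\<Sum>j\<in>{a..b}. psi (c * f (real j * h))) = (\<Sum>n\<in>{..N}. psi (x n))"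
        by (rule sum.reindex_bij_witness[of _ "\<lambda>n. a + n" "\<lambda>j. j - a"])
           (use ab(2) in \<open>auto simp: N_def x_def y_def\<close>)
      thus ?thesis unfolding psi_sum_def ab(1) by (simp add: lessThan_Suc_atMost[symmetric])
    qed
    show ?thesis
    proof (cases "N = 0")
      case True
      hence "psi_sum f c h u v = psi (x 0)" using sumeq by simp
      thus ?thesis using B1 abs_psi_le[of "x 0"] by linarith
    next
      case False
      have gap: "c * h\<^sup>2 * \<mu> \<le> d (Suc n) - d n" if n: "Suc n < N" for n
      proof -
        \<comment> \<open>Applying the mean value theorem to this difference, instead of twice to f,
          yields f'(z + h) - f'(z) with both arguments exactly h apart.\<close>
        define G where "G t = f (t + h) - f t" for t
        have G: "(G has_real_derivative f' (t + h) - f' t) (at t)" if "y n < t" "t < y n + h" for t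
        proof -
          have "y n + h + h \<le> v" "u \<le> y n" using y[of "Suc (Suc n)"] y[of n] n by (auto simp: ySuc)
          hence "u < t" "t + h < v" using that by auto
          hence "((\<lambda>t. f (t + h)) has_real_derivative f' (t + h)) (at t)" "(f has_real_derivative f' t) (at t)"
            using pos(1) by (auto simp flip: DERIV_shift intro!: D')
          thus ?thesis unfolding G_def[abs_def] by (rule DERIV_diff)
        qed
        have "continuous_on {y n..y n + h} G"
        proof -
          have "y n + h + h \<le> v" "u \<le> y n" using y[of "Suc (Suc n)"] y[of n] n by (auto simp: ySuc)
          thus ?thesis unfolding G_def[abs_def] using pos(1)
            by (intro continuous_intros continuous_on_compose2[OF cont]) auto
        qed
        then obtain z where z: "y n < z" "z < y n + h" "G (y n + h) - G (y n) = h * (f' (z + h) - f' z)"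
          using MVT_interior[of "y n" "y n + h" G "\<lambda>t. f' (t + h) - f' t"] G pos by auto
        have "\<mu> * ((z + h) - z) \<le> f' (z + h) - f' z"
          by (rule inc) (use z y[of n] y[of "Suc (Suc n)"] n pos in \<open>auto simp: ySuc\<close>)
        hence "c * (h * (\<mu> * h)) \<le> c * (h * (f' (z + h) - f' z))"
          using pos by (intro mult_left_mono) auto
        also have "\<dots> = d (Suc n) - d n"
          unfolding z(3)[symmetric] G_def d_def x_def ySuc by (simp add: algebra_simps)
        finally show ?thesis by (simp add: power2_eq_square mult_ac)
      qed
      have dif: "d (N - 1) - d 0 \<le> c * h * (f' v - f' u)"
      proof -
        obtain p where p: "y 0 < p" "p < y 0 + h" "f (y 0 + h) - f (y 0) = h * f' p"
          using mvt[of "y 0" "y 0 + h"] y[of 0] y[of "Suc 0"] pos False by (auto simp: ySuc)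
        obtain q where q: "y (N - 1) < q" "q < y N" "f (y N) - f (y (N - 1)) = h * f' q"
          using mvt[of "y (N - 1)" "y N"] y[of "N - 1"] y[of N] ySuc[of "N - 1"] pos False by auto
        have f'mono: "f' x1 \<le> f' x2" if "u \<le> x1" "x1 \<le> x2" "x2 \<le> v" for x1 x2
        proof -
          have "0 \<le> \<mu> * (x2 - x1)" using that pos by simp
          with inc[OF that] show ?thesis by linarith
        qed
        have "f' u \<le> f' p"
          by (rule f'mono) (use p y[of 0] y[of "Suc 0"] False uv in \<open>auto simp: ySuc\<close>)
        moreover have "f' q \<le> f' v"
          by (rule f'mono) (use q y[of "N - 1"] y[of N] in auto)
        ultimately have "f' q - f' p \<le> f' v - f' u" by linarith
        hence "c * (h * (f' q - f' p)) \<le> c * (h * (f' v - f' u))"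
          using pos by (intro mult_left_mono) auto
        moreover have "d (N - 1) - d 0 = c * (h * (f' q - f' p))"
        proof -
          have "d (N - 1) = c * (f (y N) - f (y (N - 1)))" "d 0 = c * (f (y 0 + h) - f (y 0))"
            using False unfolding d_def x_def ySuc[of 0] by (simp_all add: right_diff_distrib)
          thus ?thesis unfolding p(3) q(3) by (simp add: right_diff_distrib)
        qed
        ultimately show ?thesis by (simp add: mult.assoc)
      qed
      have Nle: "real N / real K \<le> (v - u) / h / real K"
      proof -
        have "real N * h = real b * h - real a * h" using ab by (simp add: N_def of_nat_diff left_diff_distrib)
        hence "real N * h \<le> v - u" using ua by simp
        hence "real N \<le> (v - u) / h" using pos by (simp add: field_simps)
        thus ?thesis by (intro divide_right_mono) auto
      qed
      have main: "\<bar>\<Sum>n<N. psi (x n)\<bar> \<le> real N / real K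
          + 4 * (4 * (d (N - 1) - d 0) / sqrt (c * h\<^sup>2 * \<mu>) + 1) * sqrt (real K) + 3 * (8 / sqrt (c * h\<^sup>2 * \<mu>))"
        by (rule sum_psi_convex_sequence) (use pos False gap in \<open>auto simp: d_def\<close>)
      have mono: "4 * (4 * (d (N - 1) - d 0) / sqrt (c * h\<^sup>2 * \<mu>) + 1) * sqrt (real K)
         \<le> 4 * (4 * (c * h * (f' v - f' u)) / sqrt (c * h\<^sup>2 * \<mu>) + 1) * sqrt (real K)"
        using dif pos by (intro mult_right_mono mult_left_mono add_mono divide_right_mono) auto
      have "\<bar>A + B\<bar> \<le> p' + q' + 24 / r + 1"
        if "\<bar>A\<bar> \<le> p + q + 3 * (8 / r)" "q \<le> q'" "p \<le> p'" "\<bar>B\<bar> \<le> 1 / 2" for A B p q r p' q' :: real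
        using that by simp
      from this[OF main mono Nle abs_psi_le] show ?thesis unfolding sumeq .
    qed
  qed
qed

section \<open>Twice differentiable functions whose curvature may degenerate at the
  intercept\<close>

lemma C2_on_increment_bounds:
  assumes C2: "C2_on A f f' f''" and sub: "{u..v} \<subseteq> A" and xy: "u \<le> x" "x \<le> y" "y \<le> v"
  shows "(\<And>t. t \<in> {u..v} \<Longrightarrow> \<mu> \<le> f'' t) \<Longrightarrow> \<mu> * (y - x) \<le> f' y - f' x"
    and "(\<And>t. t \<in> {u..v} \<Longrightarrow> f'' t \<le> \<nu>) \<Longrightarrow> f' y - f' x \<le> \<nu> * (y - x)"
proof -
  have D: "(f' has_real_derivative f'' t) (at t within {u..v})" if "t \<in> {u..v}" for t
    using C2 sub that unfolding C2_on_def by (blast intro: DERIV_subset)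
  have "\<exists>z. u \<le> z \<and> z \<le> v \<and> f' y - f' x = (y - x) * f'' z"
  proof (cases "x = y")
    case True thus ?thesis using xy by (intro exI[of _ u]) auto
  next
    case False
    have "continuous_on {u..v} f'"
      using D by (meson DERIV_continuous continuous_on_eq_continuous_within)
    hence cont: "continuous_on {x..y} f'" by (rule continuous_on_subset) (use xy in auto)
    have "(f' has_real_derivative f'' t) (at t)" if "x < t" "t < y" for t
      using D[of t] that xy by (simp add: at_within_Icc_at)
    from MVT_interior[OF _ cont this] False xy obtain z where "x < z" "z < y" "f' y - f' x = (y - x) * f'' z"
      by auto
    thus ?thesis using xy by (intro exI[of _ z]) auto
  qed
  then obtain z where z: "z \<in> {u..v}" "f' y - f' x = (y - x) * f'' z" by auto
  show "\<mu> * (y - x) \<le> f' y - f' x" if "\<And>t. t \<in> {u..v} \<Longrightarrow> \<mu> \<le> f'' t"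
    unfolding z(2) using that[OF z(1)] xy by (simp add: mult.commute[of "y - x"] mult_right_mono)
  show "f' y - f' x \<le> \<nu> * (y - x)" if "\<And>t. t \<in> {u..v} \<Longrightarrow> f'' t \<le> \<nu>"
    unfolding z(2) using that[OF z(1)] xy by (simp add: mult.commute[of "y - x"] mult_right_mono)
qed

text \<open>
  Here $q = r^{1/6}$, and the smoothing step is $1/K$ with $K$ about $q^2 = r^{1/3}$.
\<close>

lemma psi_sum_C2:
  fixes f f' f'' :: "real \<Rightarrow> real"
  assumes C2: "C2_on A f f' f''" and sub: "{u..v} \<subseteq> A" and uv: "u \<le> v"
    and mu: "0 < \<mu>" "\<And>t. t \<in> {u..v} \<Longrightarrow> \<mu> \<le> f'' t"
    and q: "1 \<le> q" and s: "0 < s0" "s0 \<le> s" "s \<le> s1"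
  shows "\<bar>psi_sum f (q ^ 6 * s) (s / q ^ 6) u v\<bar> \<le>
    (1 / s0 + 8 + (32 * s1\<^sup>2 + 24) / (s0 * sqrt s0)) *
     (q ^ 4 * (v - u + (f' v - f' u) / sqrt \<mu>) + q ^ 3 / sqrt \<mu> + 2 * q)"
proof -
  define K where "K = nat \<lceil>q\<^sup>2\<rceil>"
  have q0: "0 < q" using q by simp
  have q2: "1 \<le> q\<^sup>2" using q by simp
  have q6: "q ^ 6 = q ^ 3 * q ^ 3" "q ^ 6 = q ^ 4 * q\<^sup>2" by (simp_all flip: power_add)
  have Kq: "q\<^sup>2 \<le> real K" "real K \<le> 2 * q\<^sup>2"
    unfolding K_def using q2 by linarith+
  have K: "0 < K" using Kq q2 by (cases K) auto
  have sK: "sqrt (real K) \<le> 2 * q"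
  proof -
    have "sqrt (real K) \<le> sqrt ((2 * q)\<^sup>2)"
      using Kq by (intro real_sqrt_le_mono) (simp add: power_mult_distrib)
    also have "\<dots> = 2 * q" using q by (intro real_sqrt_unique) auto
    finally show ?thesis .
  qed
  define \<Delta> where "\<Delta> = f' v - f' u"
  have \<Delta>: "0 \<le> \<Delta>"
    using C2_on_increment_bounds(1)[OF C2 sub order.refl uv order.refl mu(2)] mu uv
    unfolding \<Delta>_def by (smt (verit) mult_nonneg_nonneg)
  define w where "w = sqrt (q ^ 6 * s * (s / q ^ 6)\<^sup>2 * \<mu>)"
  have w: "w = s * sqrt s * sqrt \<mu> / q ^ 3"
  proof -
    have "q ^ 6 * s * (s / q ^ 6)\<^sup>2 * \<mu> = (s / q ^ 3)\<^sup>2 * s * \<mu>"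
    proof -
      have "p * p * s * (s / (p * p))\<^sup>2 * \<mu> = (s / p)\<^sup>2 * s * \<mu>" if "0 < p" for p
        using that by (simp add: field_simps power2_eq_square)
      from this[of "q ^ 3"] show ?thesis unfolding q6(1) using zero_less_power[OF q0] by blast
    qed
    hence "w = sqrt ((s / q ^ 3)\<^sup>2 * s * \<mu>)" unfolding w_def by simp
    also have "\<dots> = s / q ^ 3 * sqrt s * sqrt \<mu>"
      using q0 s by (simp add: real_sqrt_mult)
    finally show ?thesis by simp
  qed
  \<comment> \<open>A lower bound for s sqrt s on the whole range of s; with it the estimates become
    uniform in s.\<close>
  define z where "z = s0 * sqrt s0"
  have z: "0 < z" "z \<le> s * sqrt s"
    unfolding z_def using s by (auto intro!: mult_mono)
  have w0: "0 < w" unfolding w using s q0 mu by simp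
  have wz: "1 / w \<le> q ^ 3 / sqrt \<mu> / z"
  proof -
    have "1 / w = q ^ 3 / sqrt \<mu> / (s * sqrt s)" using s q0 mu by (simp add: w mult_ac)
    also have "\<dots> \<le> q ^ 3 / sqrt \<mu> / z" using z q0 mu by (intro divide_left_mono) auto
    finally show ?thesis .
  qed
  have D: "(f has_real_derivative f' t) (at t within {u..v})" if "t \<in> {u..v}" for t
    using C2 sub that unfolding C2_on_def by (blast intro: DERIV_subset)
  have "\<bar>psi_sum f (q ^ 6 * s) (s / q ^ 6) u v\<bar> \<le> (v - u) / (s / q ^ 6) / real K
    + 4 * (4 * (q ^ 6 * s * (s / q ^ 6) * (f' v - f' u)) / sqrt (q ^ 6 * s * (s / q ^ 6)\<^sup>2 * \<mu>) + 1) * sqrt (real K)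
    + 24 / sqrt (q ^ 6 * s * (s / q ^ 6)\<^sup>2 * \<mu>) + 1"
    by (rule psi_sum_interval[OF _ _ K mu(1) uv D])
       (use q0 s C2_on_increment_bounds(1)[OF C2 sub _ _ _ mu(2)] in auto)
  also have "q ^ 6 * s * (s / q ^ 6) * (f' v - f' u) = s\<^sup>2 * \<Delta>"
    using q0 by (simp add: \<Delta>_def power2_eq_square)
  finally have main: "\<bar>psi_sum f (q ^ 6 * s) (s / q ^ 6) u v\<bar> \<le> (v - u) / (s / q ^ 6) / real K
    + 4 * (4 * (s\<^sup>2 * \<Delta>) / w + 1) * sqrt (real K) + 24 / w + 1"
    by (simp only: w_def)
  have t1: "(v - u) / (s / q ^ 6) / real K \<le> 1 / s0 * (q ^ 4 * (v - u))"
  proof -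
    have "(v - u) / (s / q ^ 6) / real K = (v - u) * q ^ 6 / (s * real K)" by simp
    also have "\<dots> \<le> (v - u) * q ^ 6 / (s0 * q\<^sup>2)"
      using uv q0 s Kq K by (intro divide_left_mono mult_mono mult_pos_pos) auto
    also have "\<dots> = 1 / s0 * (q ^ 4 * (v - u))" 
    proof -
      have "(v - u) * (q ^ 4 * x) / (s0 * x) = 1 / s0 * (q ^ 4 * (v - u))" if "0 < x" for x
        using that s by simp
      from this[of "q\<^sup>2"] show ?thesis unfolding q6(2) using q0 by simp
    qed
    finally show ?thesis .
  qed
  have t2: "4 * (4 * (s\<^sup>2 * \<Delta>) / w + 1) * sqrt (real K) \<le> 32 * s1\<^sup>2 / z * (q ^ 4 * (\<Delta> / sqrt \<mu>)) + 8 * q"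
  proof -
    have "s\<^sup>2 * \<Delta> * (1 / w) \<le> s1\<^sup>2 * \<Delta> * (q ^ 3 / sqrt \<mu> / z)"
      using s \<Delta> wz w q0 mu by (intro mult_mono power_mono) auto
    hence "4 * (4 * (s\<^sup>2 * \<Delta> * (1 / w)) + 1) * sqrt (real K) \<le> 4 * (4 * (s1\<^sup>2 * \<Delta> * (q ^ 3 / sqrt \<mu> / z)) + 1) * (2 * q)"
      using sK \<Delta> q0 z mu s w0 by (intro mult_mono) auto
    also have "\<dots> = 32 * (s1\<^sup>2 / z * (q ^ 4 * (\<Delta> / sqrt \<mu>))) + 8 * q"
    proof -
      have "q ^ 4 = q ^ 3 * q" using power_add[of q 3 1] by simp
      hence 1: "s1\<^sup>2 * \<Delta> * (q ^ 3 / sqrt \<mu> / z) * q = s1\<^sup>2 / z * (q ^ 4 * (\<Delta> / sqrt \<mu>))"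
        by (simp add: mult_ac)
      have "4 * (4 * W + 1) * (2 * q) = 32 * (W * q) + 8 * q" for W :: real
        by (simp add: algebra_simps)
      thus ?thesis by (simp only: 1)
    qed
    finally have t2': "4 * (4 * (s\<^sup>2 * \<Delta> * (1 / w)) + 1) * sqrt (real K) \<le> 32 * (s1\<^sup>2 / z * (q ^ 4 * (\<Delta> / sqrt \<mu>))) + 8 * q" .
    have "4 * (s\<^sup>2 * \<Delta> * (1 / w)) = 4 * (s\<^sup>2 * \<Delta>) / w"
      "32 * (s1\<^sup>2 / z * (q ^ 4 * (\<Delta> / sqrt \<mu>))) = 32 * s1\<^sup>2 / z * (q ^ 4 * (\<Delta> / sqrt \<mu>))"
      by simp_all
    thus ?thesis using t2' by (simp only:)
  qed
  have t3: "24 / w \<le> 24 / z * (q ^ 3 / sqrt \<mu>)" using mult_left_mono[OF wz, of 24] by (simp add: mult.commute[of z])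
  define a b d where "a = 1 / s0" and "b = 32 * s1\<^sup>2 / z" and "d = 24 / z"
  define X Y Z where "X = q ^ 4 * (v - u)" and "Y = q ^ 4 * (\<Delta> / sqrt \<mu>)" and "Z = q ^ 3 / sqrt \<mu>"
  have nn: "0 \<le> a" "0 \<le> b" "0 \<le> d" "0 \<le> X" "0 \<le> Y" "0 \<le> Z"
    unfolding a_def b_def d_def X_def Y_def Z_def using s z q0 uv \<Delta> mu(1) by auto
  have "\<bar>psi_sum f (q ^ 6 * s) (s / q ^ 6) u v\<bar> \<le> a * X + (b * Y + 8 * q) + d * Z + 1"
    unfolding a_def b_def d_def X_def Y_def Z_def
    by (rule order.trans[OF main]) (intro add_mono t1 t2 t3 order.refl)
  \<comment> \<open>All quantities are nonnegative, so the product of the sums dominates the sum of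
    the products. This is wasteful but gives one constant that depends on s0 and s1 only.\<close>
  also have "\<dots> \<le> (a + 8 + (b + d)) * (X + Y + Z + 2 * q)"
  proof -
    have "(a + 8 + (b + d)) * (X + Y + Z + 2 * q) - (a * X + (b * Y + 8 * q) + d * Z + 8 * q)
      = a * (Y + Z + 2 * q) + 8 * (X + Y + Z) + b * (X + Z + 2 * q) + d * (X + Y + 2 * q)"
      by (simp add: algebra_simps)
    also have "\<dots> \<ge> 0" using nn q0 by (intro add_nonneg_nonneg mult_nonneg_nonneg) auto
    finally show ?thesis using q by linarith
  qed
  also have "(a + 8 + (b + d)) = 1 / s0 + 8 + (32 * s1\<^sup>2 + 24) / (s0 * sqrt s0)"
    by (simp add: a_def b_def d_def z_def add_divide_distrib)
  also have "X + Y + Z + 2 * q = q ^ 4 * (v - u + (f' v - f' u) / sqrt \<mu>) + q ^ 3 / sqrt \<mu> + 2 * q"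
    by (simp add: X_def Y_def Z_def \<Delta>_def distrib_left)
  finally show ?thesis .
qed

text \<open>On a piece where f'' stays within a factor 4 of its minimum \<mu>, the term (f' v - f'
  u) / sqrt \<mu> is at most 4 sqrt \<mu> (v - u), hence at most a constant times the length, and
  lengths add up. The other term q^3 / sqrt \<mu> doubles from one piece to the next, so all of them
  together cost at most twice the last one.\<close>

lemma psi_sum_dyadic:
  fixes f f' f'' :: "real \<Rightarrow> real"
  assumes C2: "C2_on {v0..<L} f f' f''" and b: "v0 \<le> b" "b < L"
    and anti: "antimono_on {v0..<L} f''" and f''pos: "\<And>t. t \<in> {v0..<L} \<Longrightarrow> 0 < f'' t"
    and q: "1 \<le> q" and s: "0 < s0" "s0 \<le> s" "s \<le> s1"
  shows "\<bar>psi_sum f (q ^ 6 * s) (s / q ^ 6) v0 b\<bar> \<le>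
    (1 / s0 + 8 + (32 * s1\<^sup>2 + 24) / (s0 * sqrt s0)) *
     (q ^ 4 * (1 + 4 * sqrt (f'' v0)) * (b - v0) + 2 * q ^ 3 * (1 + 2 * sqrt (f'' v0)) / sqrt (f'' b))"
proof -
  define A where "A = 1 / s0 + 8 + (32 * s1\<^sup>2 + 24) / (s0 * sqrt s0)"
  define P where "P = f'' v0"
  have A: "0 < A" unfolding A_def using s by (intro add_pos_nonneg) auto
  have P: "0 < P" unfolding P_def using f''pos b by auto
  define T where "T u v = \<bar>psi_sum f (q ^ 6 * s) (s / q ^ 6) u v\<bar>" for u v
  have ant: "f'' y \<le> f'' x" if "v0 \<le> x" "x \<le> y" "y < L" for x y
    using anti that by (auto simp: monotone_on_def)
  have piece: "T u v \<le> A * (q ^ 4 * (1 + 4 * sqrt P) * (v - u) + q ^ 3 * (1 + 2 * sqrt P) / sqrt (f'' v))"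
    if uv: "v0 \<le> u" "u \<le> v" "v < L" "f'' u \<le> 4 * f'' v" for u v
  proof -
    define \<mu> where "\<mu> = f'' v"
    have mu: "0 < \<mu>" "\<mu> \<le> P" unfolding \<mu>_def P_def using uv by (auto intro: f''pos ant)
    have sub: "{u..v} \<subseteq> {v0..<L}" using uv by auto
    have "T u v \<le> A * (q ^ 4 * (v - u + (f' v - f' u) / sqrt \<mu>) + q ^ 3 / sqrt \<mu> + 2 * q)"
      unfolding T_def A_def
      by (rule psi_sum_C2[OF C2 sub uv(2) mu(1) _ q s]) (use ant uv in \<open>auto simp: \<mu>_def\<close>)
    also have "\<dots> \<le> A * (q ^ 4 * (v - u + 4 * sqrt P * (v - u)) + q ^ 3 / sqrt \<mu> + 2 * (q ^ 3 * sqrt P / sqrt \<mu>))"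
    proof (intro mult_left_mono add_mono order.refl)
      have "f' v - f' u \<le> f'' u * (v - u)"
        by (rule C2_on_increment_bounds(2)[OF C2 sub]) (use uv ant in auto)
      also have "\<dots> \<le> (4 * \<mu>) * (v - u)" using uv by (intro mult_right_mono) (auto simp: \<mu>_def)
      finally have "(f' v - f' u) / sqrt \<mu> \<le> (4 * \<mu>) * (v - u) / sqrt \<mu>"
        using mu by (intro divide_right_mono) auto
      also have "\<dots> = 4 * (\<mu> / sqrt \<mu>) * (v - u)" by simp
      also have "\<mu> / sqrt \<mu> = sqrt \<mu>" using mu by (simp add: real_div_sqrt)
      also have "4 * sqrt \<mu> * (v - u) \<le> 4 * sqrt P * (v - u)"
        using mu uv by (intro mult_right_mono) auto
      finally show "(f' v - f' u) / sqrt \<mu> \<le> 4 * sqrt P * (v - u)" .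
      \<comment> \<open>As \<mu> \<le> P, the additive 2q is hidden in the term with 1 / sqrt \<mu>.
        Left alone, it would be counted once per piece.\<close>
      have "q * 1 \<le> q ^ 3 * (sqrt P / sqrt \<mu>)"
        using q mu power_increasing[of 1 3 q] by (intro mult_mono) auto
      thus "q \<le> q ^ 3 * sqrt P / sqrt \<mu>" by simp
    qed (use q A in auto)
    also have "\<dots> = A * (q ^ 4 * (1 + 4 * sqrt P) * (v - u) + q ^ 3 * (1 + 2 * sqrt P) / sqrt \<mu>)"
      by (simp add: algebra_simps add_divide_distrib)
    finally show ?thesis by (simp add: \<mu>_def)
  qed
  have ind: "P \<le> 4 ^ m * f'' b \<Longrightarrow> v0 \<le> b \<Longrightarrow> b < L \<Longrightarrow> T v0 b \<le> A * (q ^ 4 * (1 + 4 * sqrt P) * (b - v0) + 2 * q ^ 3 * (1 + 2 * sqrt P) / sqrt (f'' b))" for m b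
  proof (induction m arbitrary: b)
    case (0 b)
    have "0 < f'' b" using f''pos 0 by auto
    have "T v0 b \<le> A * (q ^ 4 * (1 + 4 * sqrt P) * (b - v0) + q ^ 3 * (1 + 2 * sqrt P) / sqrt (f'' b))"
      using 0 \<open>0 < f'' b\<close> by (intro piece) (auto simp: P_def)
    also have "\<dots> \<le> A * (q ^ 4 * (1 + 4 * sqrt P) * (b - v0) + 2 * q ^ 3 * (1 + 2 * sqrt P) / sqrt (f'' b))"
      using A q P \<open>0 < f'' b\<close> by (intro mult_left_mono add_left_mono divide_right_mono mult_right_mono) auto
    finally show ?case .
  next
    case (Suc m b)
    have fb: "0 < f'' b" using f''pos Suc.prems by auto
    show ?case
    proof (cases "P \<le> 4 * f'' b")
      case True
      have "T v0 b \<le> A * (q ^ 4 * (1 + 4 * sqrt P) * (b - v0) + q ^ 3 * (1 + 2 * sqrt P) / sqrt (f'' b))"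
        using Suc.prems True by (intro piece) (auto simp: P_def)
      also have "\<dots> \<le> A * (q ^ 4 * (1 + 4 * sqrt P) * (b - v0) + 2 * q ^ 3 * (1 + 2 * sqrt P) / sqrt (f'' b))"
        using A q P fb by (intro mult_left_mono add_left_mono divide_right_mono mult_right_mono) auto
      finally show ?thesis .
    next
      case False
      have "continuous_on {v0..b} f''"
        using C2 Suc.prems unfolding C2_on_def by (auto elim: continuous_on_subset)
      then obtain c where c: "v0 \<le> c" "c \<le> b" "f'' c = 4 * f'' b"
        using IVT2'[of f'' b "4 * f'' b" v0] False fb Suc.prems by (auto simp: P_def)
      have IH: "T v0 c \<le> A * (q ^ 4 * (1 + 4 * sqrt P) * (c - v0) + 2 * q ^ 3 * (1 + 2 * sqrt P) / sqrt (f'' c))"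
        using Suc c by (intro Suc.IH) auto
      have "T c b \<le> A * (q ^ 4 * (1 + 4 * sqrt P) * (b - c) + q ^ 3 * (1 + 2 * sqrt P) / sqrt (f'' b))"
        using Suc.prems c by (intro piece) auto
      moreover have "T v0 b \<le> T v0 c + T c b"
        using psi_sum_split[of "s / q ^ 6" v0 c b] c s q unfolding T_def by simp
      \<comment> \<open>Between b and c the root of f'' doubles, so the doubled term at c is the
        single term at b. The other half of the doubled term at b remains for the piece from c to
        b.\<close>
      moreover have "2 * q ^ 3 * (1 + 2 * sqrt P) / sqrt (f'' c) = q ^ 3 * (1 + 2 * sqrt P) / sqrt (f'' b)"
        unfolding c(3) by (simp add: real_sqrt_mult)
      ultimately have "T v0 b \<le> A * (q ^ 4 * (1 + 4 * sqrt P) * (c - v0) + q ^ 3 * (1 + 2 * sqrt P) / sqrt (f'' b))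
        + A * (q ^ 4 * (1 + 4 * sqrt P) * (b - c) + q ^ 3 * (1 + 2 * sqrt P) / sqrt (f'' b))"
        using IH by simp
      also have "\<dots> = A * (q ^ 4 * (1 + 4 * sqrt P) * (b - v0) + 2 * q ^ 3 * (1 + 2 * sqrt P) / sqrt (f'' b))"
        by (simp add: algebra_simps)
      finally show ?thesis .
    qed
  qed
  \<comment> \<open>Any number m of cuts is allowed, since the bound does not depend on it; finitely
    many suffice because f'' b is positive.\<close>
  obtain m where "P / f'' b < 4 ^ m" using real_arch_pow[of 4 "P / f'' b"] by auto
  moreover have "0 < f'' b" using f''pos b by auto
  ultimately have "T v0 b \<le> A * (q ^ 4 * (1 + 4 * sqrt P) * (b - v0) + 2 * q ^ 3 * (1 + 2 * sqrt P) / sqrt (f'' b))"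
    using b by (intro ind[of m]) (auto simp: divide_less_eq less_imp_le)
  thus ?thesis unfolding T_def A_def P_def .
qed

lemma piecewise_monotonic_tail:
  assumes pm: "piecewise_monotonic a b h" and ab: "a < b"
  obtains v where "a < v" "v < b" "mono_on {v..<b} h \<or> antimono_on {v..<b} h"
proof -
  obtain m :: nat and p where p: "p 0 = a" "p m = b"
    "\<And>i. i < m \<Longrightarrow> p i < p (Suc i)"
    "\<And>i. i < m \<Longrightarrow> mono_on {p i<..<p (Suc i)} h \<or> antimono_on {p i<..<p (Suc i)} h"
    using pm unfolding piecewise_monotonic_def by blast
  have "m \<noteq> 0" using p(1,2) ab by (intro notI) simp
  then obtain k where k: "m = Suc k" by (cases m) auto
  have "a \<le> p i" if "i \<le> m" for i
    using that by (induction i) (use p in \<open>auto simp: Suc_le_eq dest!: p(3)\<close>)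
  hence pk: "a \<le> p k" "p k < b" using p(2) p(3)[of k] k by auto
  \<comment> \<open>The midpoint of the last piece: monotonicity is given on the open piece, whereas
    the tail is to include its left end.\<close>
  define v where "v = (p k + b) / 2"
  have v: "p k < v" "v < b" using pk by (auto simp: v_def)
  have "mono_on {p k<..<b} h \<or> antimono_on {p k<..<b} h" using p(2) p(4)[of k] k by auto
  hence "mono_on {v..<b} h \<or> antimono_on {v..<b} h"
    using v by (auto simp: monotone_on_def)
  with v pk show ?thesis by (intro that[of v]) auto
qed

lemma C2_on_subset:
  assumes "C2_on A f f' f''" "B \<subseteq> A"
  shows "C2_on B f f' f''"
  using assms unfolding C2_on_def by (meson DERIV_subset continuous_on_subset subsetD)

text \<open>On a compact initial part f'' has a positive minimum. Beyond it f'' is monotone: if it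
  increases, the same minimum serves up to L and one application of the interval bound suffices; if
  it decreases, the dyadic bound takes over.\<close>

lemma psi_sum_upto:
  fixes f f' f'' :: "real \<Rightarrow> real"
  assumes C2: "C2_on {\<alpha>..<L} f f' f''" and \<alpha>: "\<alpha> < L"
    and signs: "\<And>x. x \<in> {\<alpha>..<L} \<Longrightarrow> f' x < 0 \<and> f'' x > 0"
    and pm: "piecewise_monotonic \<alpha> L f''" and s: "0 < s0" "s0 \<le> s1"
  shows "\<exists>C\<ge>0. \<forall>q\<ge>1. \<forall>s\<in>{s0..s1}. \<forall>b\<in>{\<alpha>..<L}.
    \<bar>psi_sum f (q ^ 6 * s) (s / q ^ 6) \<alpha> b\<bar> \<le> C * (q ^ 4 + q ^ 3 / sqrt (f'' b))"
proof -
  define A where "A = 1 / s0 + 8 + (32 * s1\<^sup>2 + 24) / (s0 * sqrt s0)"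
  have A: "0 < A" unfolding A_def using s by (intro add_pos_nonneg) auto
  obtain v where v: "\<alpha> < v" "v < L" "mono_on {v..<L} f'' \<or> antimono_on {v..<L} f''"
    using piecewise_monotonic_tail[OF pm \<alpha>] by blast
  have "continuous_on {\<alpha>..v} f''"
    using C2 v unfolding C2_on_def by (auto elim: continuous_on_subset)
  then obtain z where z: "z \<in> {\<alpha>..v}" "\<And>x. x \<in> {\<alpha>..v} \<Longrightarrow> f'' z \<le> f'' x"
    using continuous_attains_inf[of "{\<alpha>..v}" f''] v by auto
  define c where "c = f'' z"
  have c: "0 < c" using signs[of z] z v by (auto simp: c_def)
  define B where "B = A * (L - \<alpha> - f' \<alpha> / sqrt c + 1 / sqrt c + 2)"
  have B: "0 \<le> B"
  proof -
    have "f' \<alpha> / sqrt c \<le> 0" using signs[of \<alpha>] \<alpha> c by (simp add: divide_nonpos_pos less_imp_le)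
    thus ?thesis unfolding B_def using A \<alpha> c by (intro mult_nonneg_nonneg add_nonneg_nonneg) auto
  qed
  have lower: "\<bar>psi_sum f (q ^ 6 * s) (s / q ^ 6) \<alpha> b\<bar> \<le> B * q ^ 4"
    if q: "1 \<le> q" and s: "s \<in> {s0..s1}" and b: "b \<in> {\<alpha>..<L}" and fb: "\<And>x. x \<in> {\<alpha>..b} \<Longrightarrow> c \<le> f'' x" for q s b
  proof -
    have sub: "{\<alpha>..b} \<subseteq> {\<alpha>..<L}" using b by auto
    have "\<bar>psi_sum f (q ^ 6 * s) (s / q ^ 6) \<alpha> b\<bar> \<le> A * (q ^ 4 * (b - \<alpha> + (f' b - f' \<alpha>) / sqrt c) + q ^ 3 / sqrt c + 2 * q)"
      unfolding A_def by (rule psi_sum_C2[OF C2 sub _ c fb q]) (use b s \<open>0 < s0\<close> in auto)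
    \<comment> \<open>Since f' b < 0, the variation of f' is at most - f' \<alpha>, uniformly in
      b.\<close>
    also have "\<dots> \<le> A * (q ^ 4 * (L - \<alpha> + (0 - f' \<alpha>) / sqrt c) + q ^ 4 / sqrt c + 2 * q ^ 4)"
      using b signs[of b] q c A power_increasing[of 3 4 q] power_increasing[of 1 4 q]
      by (intro mult_left_mono add_mono divide_right_mono diff_mono) auto
    also have "\<dots> = B * q ^ 4" unfolding B_def by (simp add: algebra_simps)
    finally show ?thesis .
  qed
  from v(3) show ?thesis
  proof
    assume mono: "mono_on {v..<L} f''"
    have ge: "c \<le> f'' x" if "x \<in> {\<alpha>..<L}" for x
    proof (cases "x \<le> v")
      case True thus ?thesis using z that by (auto simp: c_def)
    next
      case False
      have "c \<le> f'' v" using z(2)[of v] v by (auto simp: c_def)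
      also have "\<dots> \<le> f'' x" using mono False that v by (auto simp: monotone_on_def)
      finally show ?thesis .
    qed
    show ?thesis
    proof (intro exI[of _ B] conjI ballI allI impI B)
      fix q s b :: real assume *: "1 \<le> q" "s \<in> {s0..s1}" "b \<in> {\<alpha>..<L}"
      have "\<bar>psi_sum f (q ^ 6 * s) (s / q ^ 6) \<alpha> b\<bar> \<le> B * q ^ 4"
        by (rule lower[OF *]) (use ge * in auto)
      also have "\<dots> \<le> B * (q ^ 4 + q ^ 3 / sqrt (f'' b))"
        using B * signs[of b] by (intro mult_left_mono) auto
      finally show "\<bar>psi_sum f (q ^ 6 * s) (s / q ^ 6) \<alpha> b\<bar> \<le> B * (q ^ 4 + q ^ 3 / sqrt (f'' b))" .
    qed
  next
    assume anti: "antimono_on {v..<L} f''"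
    define E F where "E = A * (1 + 4 * sqrt (f'' v)) * (L - v)" and "F = 2 * A * (1 + 2 * sqrt (f'' v))"
    have EF: "0 \<le> E" "0 \<le> F" unfolding E_def F_def using A v signs[of v] by auto
    have C2': "C2_on {v..<L} f f' f''"
      by (rule C2_on_subset[OF C2]) (use v in auto)
    show ?thesis
    proof (intro exI[of _ "B + E + F"] conjI ballI allI impI)
      fix q s b :: real assume *: "1 \<le> q" "s \<in> {s0..s1}" "b \<in> {\<alpha>..<L}"
      define W where "W = q ^ 3 / sqrt (f'' b)"
      have W: "0 \<le> W" unfolding W_def using * signs[of b] by auto
      have "\<bar>psi_sum f (q ^ 6 * s) (s / q ^ 6) \<alpha> b\<bar> \<le> B * q ^ 4 + (E * q ^ 4 + F * W)"
      proof (cases "b \<le> v")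
        case True
        have "\<bar>psi_sum f (q ^ 6 * s) (s / q ^ 6) \<alpha> b\<bar> \<le> B * q ^ 4"
          by (rule lower[OF *]) (use z(2) * True in \<open>auto simp: c_def\<close>)
        moreover have "0 \<le> E * q ^ 4 + F * W" using EF W * by auto
        ultimately show ?thesis by linarith
      next
        case False
        have 1: "\<bar>psi_sum f (q ^ 6 * s) (s / q ^ 6) \<alpha> v\<bar> \<le> B * q ^ 4"
          by (rule lower) (use z(2) * v in \<open>auto simp: c_def\<close>)
        have "\<bar>psi_sum f (q ^ 6 * s) (s / q ^ 6) v b\<bar> \<le>
          A * (q ^ 4 * (1 + 4 * sqrt (f'' v)) * (b - v) + 2 * q ^ 3 * (1 + 2 * sqrt (f'' v)) / sqrt (f'' b))"
          unfolding A_def by (rule psi_sum_dyadic[OF C2' _ _ anti]) (use False * v signs s in auto)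
        also have "\<dots> \<le> A * (q ^ 4 * (1 + 4 * sqrt (f'' v)) * (L - v) + 2 * q ^ 3 * (1 + 2 * sqrt (f'' v)) / sqrt (f'' b))"
          using A * v signs[of v] by (intro mult_left_mono add_mono) auto
        also have "\<dots> = E * q ^ 4 + F * W" by (simp add: E_def F_def W_def algebra_simps add_divide_distrib)
        finally have 2: "\<bar>psi_sum f (q ^ 6 * s) (s / q ^ 6) v b\<bar> \<le> E * q ^ 4 + F * W" .
        have "psi_sum f (q ^ 6 * s) (s / q ^ 6) \<alpha> b = psi_sum f (q ^ 6 * s) (s / q ^ 6) \<alpha> v + psi_sum f (q ^ 6 * s) (s / q ^ 6) v b"
          by (rule psi_sum_split) (use * s v False in auto)
        with 1 2 show ?thesis by linarith
      qed
      also have "\<dots> \<le> (B + E + F) * (q ^ 4 + W)"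
      proof -
        have "(B + E + F) * (q ^ 4 + W) - (B * q ^ 4 + (E * q ^ 4 + F * W)) = F * q ^ 4 + (B + E) * W"
          by (simp add: algebra_simps)
        moreover have "0 \<le> F * q ^ 4 + (B + E) * W" using B EF W * by auto
        ultimately show ?thesis by linarith
      qed
      finally show "\<bar>psi_sum f (q ^ 6 * s) (s / q ^ 6) \<alpha> b\<bar> \<le> (B + E + F) * (q ^ 4 + q ^ 3 / sqrt (f'' b))"
        by (simp only: W_def)
    qed (use B EF in auto)
  qed
qed

lemma bigo_at_topE:
  fixes f :: "real \<Rightarrow> real"
  assumes "f \<in> O[at_top](\<lambda>r. r powr p)"
  obtains C where "0 < C" "\<forall>\<^sub>F r in at_top. \<bar>f r\<bar> \<le> C * r powr p"
  using landau_o.bigE[OF assms] by auto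

text \<open>The sum is cut at L - \<delta>(r). Before the cut the dyadic bound gives r^{2/3} +
  r^{1/2} / sqrt(f''(L - \<delta>(r))), where the second term is O(r^{1 - 2 a2}). After the cut the
  number of sample points, O(r \<delta>(r) + 1) = O(r^{1 - 2 a1} + 1), is the bound. The three
  powers explain the minimum of 1/6, a1 and a2.\<close>

lemma psi_sum_tail:
  fixes f f' f'' \<delta> :: "real \<Rightarrow> real"
  assumes C2: "C2_on {\<alpha>..<L} f f' f''" and \<alpha>: "\<alpha> < L"
    and signs: "\<And>x. x \<in> {\<alpha>..<L} \<Longrightarrow> f' x < 0 \<and> f'' x > 0"
    and pm: "piecewise_monotonic \<alpha> L f''"
    and \<delta>: "\<And>r. 0 < r \<Longrightarrow> 0 < \<delta> r \<and> \<delta> r \<le> L - \<alpha>"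
    and decay: "\<delta> \<in> O[at_top](\<lambda>r. r powr (- 2 * a1))"
    and growth: "(\<lambda>r. 1 / f'' (L - \<delta> r)) \<in> O[at_top](\<lambda>r. r powr (1 - 4 * a2))"
    and e: "e \<le> 1 / 6" "e \<le> a1" "e \<le> a2" and s: "0 < s0" "s0 \<le> s1"
  shows "\<exists>C. \<forall>\<^sub>F r in at_top. \<forall>s\<in>{s0..s1}. \<bar>psi_sum f (r * s) (s / r) \<alpha> L\<bar> \<le> C * r powr (1 - 2 * e)"
proof -
  obtain C where C: "0 \<le> C" "\<And>q s b. 1 \<le> q \<Longrightarrow> s \<in> {s0..s1} \<Longrightarrow> b \<in> {\<alpha>..<L} \<Longrightarrow>
    \<bar>psi_sum f (q ^ 6 * s) (s / q ^ 6) \<alpha> b\<bar> \<le> C * (q ^ 4 + q ^ 3 / sqrt (f'' b))"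
    using psi_sum_upto[OF C2 \<alpha> signs pm s] by blast
  obtain C1 where C1: "0 < C1" "\<forall>\<^sub>F r in at_top. \<bar>\<delta> r\<bar> \<le> C1 * r powr (- 2 * a1)"
    using bigo_at_topE[OF decay] .
  obtain C2 where C2: "0 < C2" "\<forall>\<^sub>F r in at_top. \<bar>1 / f'' (L - \<delta> r)\<bar> \<le> C2 * r powr (1 - 4 * a2)"
    using bigo_at_topE[OF growth] .
  define D where "D = C * (1 + sqrt C2) + C1 / s0 + 1"
  have "\<forall>\<^sub>F r in at_top. \<forall>s\<in>{s0..s1}. \<bar>psi_sum f (r * s) (s / r) \<alpha> L\<bar> \<le> D * r powr (1 - 2 * e)"
    using C1(2) C2(2) eventually_ge_at_top[of 1]
  proof eventually_elim
    case (elim r)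
    define b where "b = L - \<delta> r"
    define q where "q = r powr (1 / 6)"
    have r: "1 \<le> r" using elim by simp
    have q: "1 \<le> q" unfolding q_def using r by (simp add: ge_one_powr_ge_zero)
    have qp: "q ^ n = r powr (real n / 6)" for n
      using r by (simp add: q_def powr_power)
    have q6: "q ^ 6 = r" using qp[of 6] r by simp
    have b: "b \<in> {\<alpha>..<L}" using \<delta>[of r] r by (auto simp: b_def)
    have fb: "0 < f'' b" using signs b by auto
    define T where "T = r powr (1 - 2 * e)"
    have T: "r powr p \<le> T" if "p \<le> 1 - 2 * e" for p
      unfolding T_def using that r by (intro powr_mono) auto
    have 1: "q ^ 4 \<le> T" unfolding qp using e by (intro T) auto
    have 2: "q ^ 3 / sqrt (f'' b) \<le> sqrt C2 * T"
    proof -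
      have "1 / sqrt (f'' b) = sqrt (1 / f'' b)" by (simp add: real_sqrt_divide)
      also have "\<dots> \<le> sqrt (C2 * r powr (1 - 4 * a2))"
        using elim(2) fb by (intro real_sqrt_le_mono) (simp add: b_def)
      also have "\<dots> = sqrt C2 * r powr ((1 - 4 * a2) / 2)"
        using powr_half_sqrt[of "r powr (1 - 4 * a2)"] by (simp only: real_sqrt_mult powr_powr powr_ge_zero) simp
      finally have "q ^ 3 * (1 / sqrt (f'' b)) \<le> q ^ 3 * (sqrt C2 * r powr ((1 - 4 * a2) / 2))"
        using q by (intro mult_left_mono) auto
      also have "\<dots> = sqrt C2 * r powr (1 - 2 * a2)"
      proof -
        have "real 3 / 6 + (1 - 4 * a2) / 2 = 1 - 2 * a2" by (simp add: field_simps)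
        hence "q ^ 3 * r powr ((1 - 4 * a2) / 2) = r powr (1 - 2 * a2)"
          unfolding qp powr_add[symmetric] by (simp only:)
        thus ?thesis by (simp add: mult.left_commute)
      qed
      also have "\<dots> \<le> sqrt C2 * T" using e C2(1) by (intro mult_left_mono T) auto
      finally show ?thesis by simp
    qed
    have 3: "1 \<le> T" using T[of 0] r e by simp
    show ?case
    proof
      fix s assume s': "s \<in> {s0..s1}"
      have sr: "0 < s / r" using s' s r by auto
      have "\<bar>psi_sum f (r * s) (s / r) \<alpha> b\<bar> \<le> C * (q ^ 4 + q ^ 3 / sqrt (f'' b))"
        using C(2)[OF q s' b] by (simp only: q6)
      also have "\<dots> \<le> C * (T + sqrt C2 * T)" using 1 2 C(1) by (intro mult_left_mono add_mono)
      finally have P: "\<bar>psi_sum f (r * s) (s / r) \<alpha> b\<bar> \<le> C * (1 + sqrt C2) * T" by (simp add: algebra_simps)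
      have "\<bar>psi_sum f (r * s) (s / r) b L\<bar> \<le> (L - b) / (s / r) + 1"
        using b by (intro abs_psi_sum_trivial sr) auto
      also have "(L - b) / (s / r) = \<delta> r * r / s" by (simp add: b_def)
      also have "\<dots> \<le> C1 * r powr (- 2 * a1) * r / s0"
        using elim(1) r s s' \<delta>[of r] C1(1) by (intro frac_le mult_mono mult_nonneg_nonneg) auto
      also have "\<dots> = C1 / s0 * r powr (1 - 2 * a1)"
        using r by (simp add: powr_diff powr_minus field_simps)
      also have "\<dots> \<le> C1 / s0 * T" using e C1(1) s by (intro mult_left_mono T) auto
      finally have Q: "\<bar>psi_sum f (r * s) (s / r) b L\<bar> \<le> C1 / s0 * T + T" using 3 by linarith
      have "psi_sum f (r * s) (s / r) \<alpha> L = psi_sum f (r * s) (s / r) \<alpha> b + psi_sum f (r * s) (s / r) b L"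
        using b by (intro psi_sum_split sr) auto
      with P Q have "\<bar>psi_sum f (r * s) (s / r) \<alpha> L\<bar> \<le> C * (1 + sqrt C2) * T + (C1 / s0 * T + T)" by linarith
      also have "\<dots> = D * T" by (simp add: D_def algebra_simps)
      finally show "\<bar>psi_sum f (r * s) (s / r) \<alpha> L\<bar> \<le> D * r powr (1 - 2 * e)" by (simp only: T_def)
    qed
  qed
  thus ?thesis by blast
qed

section \<open>Riemann sums of convex functions\<close>

lemma has_integral_affine:
  fixes u v c m :: real
  assumes "u \<le> v"
  shows "((\<lambda>x. c + m * (x - u)) has_integral (c * (v - u) + m * (v - u)\<^sup>2 / 2)) {u..v}"
proof -
  have "((\<lambda>x. c + m * (x - u)) has_integral
      (c * (v - u) + m * (v - u)\<^sup>2 / 2) - (c * (u - u) + m * (u - u)\<^sup>2 / 2)) {u..v}"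
    using assms by (intro fundamental_theorem_of_calculus)
      (auto intro!: derivative_eq_intros simp flip: has_real_derivative_iff_has_vector_derivative)
  thus ?thesis by simp
qed

lemma integral_ge_affine:
  fixes f :: "real \<Rightarrow> real"
  assumes "u \<le> v" "f integrable_on {u..v}" "\<And>x. x \<in> {u..v} \<Longrightarrow> c + m * (x - u) \<le> f x"
  shows "c * (v - u) + m * (v - u)\<^sup>2 / 2 \<le> integral {u..v} f"
  using has_integral_le[OF has_integral_affine[OF assms(1)] integrable_integral[OF assms(2)] assms(3)] .

lemma integral_le_affine:
  fixes f :: "real \<Rightarrow> real"
  assumes "u \<le> v" "f integrable_on {u..v}" "\<And>x. x \<in> {u..v} \<Longrightarrow> f x \<le> c + m * (x - u)"
  shows "integral {u..v} f \<le> c * (v - u) + m * (v - u)\<^sup>2 / 2"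
  using has_integral_le[OF integrable_integral[OF assms(2)] has_integral_affine[OF assms(1)] assms(3)] .

lemma convex_on_extrapolate:
  fixes f :: "real \<Rightarrow> real"
  assumes "convex_on I f" "x \<in> I" "z \<in> I" "x < y" "y \<le> z"
  shows "f y + (f y - f x) / (y - x) * (z - y) \<le> f z"
proof (cases "y = z")
  case False
  hence "(f x - f y) / (x - y) \<le> (f y - f z) / (y - z)"
    using convex_on_slope_le(1)[OF assms(1), of x z y] convex_on_slope_le(2)[OF assms(1), of x z y] assms by auto
  hence "(f y - f x) / (y - x) \<le> (f z - f y) / (z - y)"
    by (metis minus_diff_eq minus_divide_divide)
  hence "(f y - f x) / (y - x) * (z - y) \<le> f z - f y"
    using False assms by (subst (asm) pos_le_divide_eq) auto
  thus ?thesis by simp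
qed auto

lemma integral_le_trapezoid:
  fixes f :: "real \<Rightarrow> real"
  assumes "u < v" "f integrable_on {u..v}" "convex_on {u..v} f"
  shows "integral {u..v} f \<le> (v - u) * (f u + f v) / 2"
proof -
  have "integral {u..v} f \<le> f u * (v - u) + (f v - f u) / (v - u) * (v - u)\<^sup>2 / 2"
  proof (rule integral_le_affine)
    fix x assume "x \<in> {u..v}"
    thus "f x \<le> f u + (f v - f u) / (v - u) * (x - u)"
      using convex_onD_Icc'[OF assms(3), of x] by simp
  qed (use assms in auto)
  also have "\<dots> = (v - u) * (f u + f v) / 2"
    using assms(1) by (simp add: power2_eq_square field_simps)
  finally show ?thesis .
qed

text \<open>By convexity the trapezoid exceeds the integral on each cell, and the chord of the
  preceding cell, extended to the right, bounds the excess by h/2 times the difference of successive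
  chord increments. These telescope, so the error is O(\<Lambda> h^2) whatever the number of
  cells.\<close>

lemma trapezoid_error:
  fixes f :: "real \<Rightarrow> real" and p q :: nat and h \<Lambda> :: real
  assumes h: "0 < h" and pq: "p \<le> q" and cont: "continuous_on {p * h..q * h} f"
    and convex: "convex_on {p * h..q * h} f" 
    and Lip: "\<And>x y. x \<in> {p * h..q * h} \<Longrightarrow> y \<in> {p * h..q * h} \<Longrightarrow> x \<le> y \<Longrightarrow> \<bar>f y - f x\<bar> \<le> \<Lambda> * (y - x)"
    and \<Lambda>: "0 \<le> \<Lambda>"
  shows "\<bar>h * (\<Sum>j=p..<q. (f (j * h) + f (Suc j * h)) / 2) - integral {p * h..q * h} f\<bar> \<le> \<Lambda> * h\<^sup>2"
proof (cases "p = q")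
  case True thus ?thesis using \<Lambda> by simp
next
  case False
  define E where "E n = h * (\<Sum>j=p..<n. (f (j * h) + f (Suc j * h)) / 2) - integral {p * h..n * h} f" for n :: nat
  have int: "f integrable_on {x..y}" if "p * h \<le> x" "y \<le> q * h" for x y :: real
    by (rule integrable_continuous_interval, rule continuous_on_subset[OF cont]) (use that in auto)
  have mono: "real i * h \<le> real j * h" if "i \<le> j" for i j :: nat using that h by simp
  have Suc: "E (Suc n) = E n + (h * ((f (n * h) + f (Suc n * h)) / 2) - integral {n * h..Suc n * h} f)"
    if "p \<le> n" "Suc n \<le> q" for n
  proof -
    have "integral {p * h..n * h} f + integral {n * h..Suc n * h} f = integral {p * h..Suc n * h} f"
      using mono[OF that(1)] mono[of n "Suc n"] mono[OF that(2)]
      by (intro Henstock_Kurzweil_Integration.integral_combine int) (auto simp del: of_nat_Suc)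
    thus ?thesis using that(1) by (simp add: E_def algebra_simps del: of_nat_Suc)
  qed
  have len: "Suc n * h - n * h = h" for n by (simp add: algebra_simps)
  \<comment> \<open>The upper bound is the telescoped sum. In the first cell, which has no
    predecessor, the line of slope - \<Lambda> replaces the preceding chord and produces the term
    \<Lambda> h.\<close>
  have "0 \<le> E n \<and> E n \<le> h * (f (n * h) - f ((n - 1) * h) + \<Lambda> * h) / 2" if "Suc p \<le> n" "n \<le> q" for n
    using that
  proof (induction n rule: dec_induct)
    case base
    have "f (p * h) * (Suc p * h - p * h) + (- \<Lambda>) * (Suc p * h - p * h)\<^sup>2 / 2 \<le> integral {p * h..Suc p * h} f"
    proof (rule integral_ge_affine)
      fix x assume x: "x \<in> {p * h..Suc p * h}"
      thus "f (p * h) + - \<Lambda> * (x - p * h) \<le> f x"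
        using Lip[of "p * h" x] mono[OF base] mono[of p "Suc p"] by auto
    qed (use mono[OF base] mono[of p "Suc p"] in \<open>auto intro!: int simp del: of_nat_Suc\<close>)
    moreover have "integral {p * h..Suc p * h} f \<le> (Suc p * h - p * h) * (f (p * h) + f (Suc p * h)) / 2"
      using h base mono[OF base] by (intro integral_le_trapezoid int convex_on_subset[OF convex]) auto
    moreover have "E p = 0" by (simp add: E_def)
    ultimately show ?case unfolding Suc[OF order.refl base] len
      by (simp add: field_simps power2_eq_square)
  next
    case (step n)
    have n: "Suc n \<le> q" "p \<le> n" "p \<le> n - 1" "n \<le> q" "0 < n" using step by auto
    have n1: "real n * h - real (n - 1) * h = h" using n by (simp add: of_nat_diff algebra_simps)
    have "f (n * h) * (Suc n * h - n * h) + (f (n * h) - f ((n - 1) * h)) / h * (Suc n * h - n * h)\<^sup>2 / 2 \<le> integral {n * h..Suc n * h} f"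
    proof (rule integral_ge_affine)
      fix x assume x: "x \<in> {n * h..Suc n * h}"
      have "f (n * h) + (f (n * h) - f (real (n - 1) * h)) / (n * h - real (n - 1) * h) * (x - n * h) \<le> f x"
      proof (rule convex_on_extrapolate[OF convex])
        have b: "real p * h \<le> real (n - 1) * h" "real (Suc n) * h \<le> real q * h"
          using n mono by blast+
        have x': "real n * h \<le> x" "x \<le> real (Suc n) * h" using x by auto
        show "real (n - 1) * h \<in> {p * h..q * h}" "x \<in> {p * h..q * h}"
          "real (n - 1) * h < n * h" "n * h \<le> x"
          using b x' n1 h unfolding atLeastAtMost_iff by linarith+
      qed
      thus "f (n * h) + (f (n * h) - f ((n - 1) * h)) / h * (x - n * h) \<le> f x"
        unfolding n1 using n by (simp add: of_nat_diff)
    qed (use mono[OF n(1)] mono[OF n(2)] mono[of n "Suc n"] in \<open>auto intro!: int simp del: of_nat_Suc\<close>)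
    moreover have "integral {n * h..Suc n * h} f \<le> (Suc n * h - n * h) * (f (n * h) + f (Suc n * h)) / 2"
      using h n mono[OF n(1)] mono[OF n(2)] by (intro integral_le_trapezoid int convex_on_subset[OF convex]) auto
    moreover have "0 \<le> E n" "E n \<le> h * (f (n * h) - f ((n - 1) * h) + \<Lambda> * h) / 2" using step n by auto
    moreover have "0 \<le> E n + (h * ((u + v) / 2) - J) \<and>
        E n + (h * ((u + v) / 2) - J) \<le> h * (v - u + \<Lambda> * h) / 2"
      if "u * h + (u - w) / h * h\<^sup>2 / 2 \<le> J" "J \<le> h * (u + v) / 2" "0 \<le> E n" "E n \<le> h * (u - w + \<Lambda> * h) / 2"
      for u v w J :: real
    proof -
      have "(u - w) / h * h\<^sup>2 / 2 = h * u / 2 - h * w / 2"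
        using h by (simp add: power2_eq_square field_simps)
      moreover have "h * (u + v) / 2 = h * u / 2 + h * v / 2" "h * (v - u + \<Lambda> * h) / 2 = h * v / 2 - h * u / 2 + h * (\<Lambda> * h) / 2"
        "h * (u - w + \<Lambda> * h) / 2 = h * u / 2 - h * w / 2 + h * (\<Lambda> * h) / 2" "h * ((u + v) / 2) = h * u / 2 + h * v / 2" "u * h = 2 * (h * u / 2)"
        by (simp_all add: algebra_simps add_divide_distrib diff_divide_distrib)
      ultimately show ?thesis using that by linarith
    qed
    moreover have "real (Suc n) - 1 = real n" by simp
    ultimately show ?case unfolding Suc[OF n(2,1)] len by (simp only:)
  qed
  from this[of q] False pq have E: "0 \<le> E q" "E q \<le> h * (f (q * h) - f ((q - 1) * h) + \<Lambda> * h) / 2" by auto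
  have q1: "real q - 1 = real (q - 1)" using False pq by (simp add: of_nat_diff)
  have "\<bar>f (q * h) - f (real (q - 1) * h)\<bar> \<le> \<Lambda> * (q * h - real (q - 1) * h)"
    using mono[of p "q - 1"] mono[of "q - 1" q] mono[of p q] False pq by (intro Lip) auto
  also have "q * h - real (q - 1) * h = h" using False pq by (simp add: of_nat_diff algebra_simps)
  finally have "h * (f (q * h) - f ((q - 1) * h) + \<Lambda> * h) / 2 \<le> h * (\<Lambda> * h + \<Lambda> * h) / 2"
    using h \<Lambda> unfolding q1 by (intro divide_right_mono mult_left_mono add_mono) auto
  with E have "\<bar>E q\<bar> \<le> \<Lambda> * h\<^sup>2" by (simp add: power2_eq_square mult_ac)
  thus ?thesis by (simp only: E_def)
qed

lemma abs_integral_le: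
  fixes f :: "real \<Rightarrow> real"
  assumes "u \<le> v" "continuous_on {u..v} f" "\<And>x. x \<in> {u..v} \<Longrightarrow> \<bar>f x - c\<bar> \<le> B"
  shows "\<bar>integral {u..v} f - c * (v - u)\<bar> \<le> B * (v - u)"
proof -
  have int: "f integrable_on {u..v}" by (rule integrable_continuous_interval) fact
  have "integral {u..v} f \<le> (c + B) * (v - u) + 0 * (v - u)\<^sup>2 / 2"
    by (rule integral_le_affine[OF assms(1) int]) (use assms(3) in \<open>force simp: abs_le_iff\<close>)
  moreover have "(c - B) * (v - u) + 0 * (v - u)\<^sup>2 / 2 \<le> integral {u..v} f"
    by (rule integral_ge_affine[OF assms(1) int]) (use assms(3) in \<open>force simp: abs_le_iff\<close>)
  ultimately show ?thesis by (simp add: algebra_simps abs_le_iff)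
qed

text \<open>Euler-Maclaurin summation to first order for a convex function. The trapezoid rule
  covers the range between the first and the last multiple of h; the fragment between a and the
  first multiple, with the half weight of that endpoint, makes up the \<open>psi\<close> term, and
  at b nothing remains because f vanishes there.\<close>

lemma convex_riemann_sum:
  fixes f :: "real \<Rightarrow> real" and h \<Lambda> :: real
  assumes h: "0 < h" and ab: "0 \<le> a" "a < b" and cont: "continuous_on {a..b} f"
    and convex: "convex_on {a..b} f" and fb: "f b = 0"
    and Lip: "\<And>x y. x \<in> {a..b} \<Longrightarrow> y \<in> {a..b} \<Longrightarrow> x \<le> y \<Longrightarrow> \<bar>f y - f x\<bar> \<le> \<Lambda> * (y - x)"
    and \<Lambda>: "0 \<le> \<Lambda>"
  shows "\<bar>h * (\<Sum>j\<in>{j::nat. a < real j * h \<and> real j * h \<le> b}. f (real j * h)) - integral {a..b} f - h * psi (a / h) * f a\<bar> \<le> 4 * \<Lambda> * h\<^sup>2"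
proof -
  define S where "S = {j::nat. a < real j * h \<and> real j * h \<le> b}"
  have psi: "\<bar>h * psi (a / h) * f a\<bar> \<le> h / 2 * \<bar>f a\<bar>"
    unfolding abs_mult using abs_psi_le[of "a / h"] h by (intro mult_right_mono) auto
  have Lh: "\<Lambda> * d \<le> \<Lambda> * h" if "d \<le> h" for d using that \<Lambda> by (rule mult_left_mono)
  define p where "p = nat \<lfloor>a / h\<rfloor> + 1"
  have p': "real p = \<lfloor>a / h\<rfloor> + 1" using ab h by (simp add: p_def)
  have ph: "a < real p * h" "real p * h \<le> a + h"
  proof -
    have "a / h < real p" "real p \<le> a / h + 1" unfolding p' by linarith+
    thus "a < real p * h" "real p * h \<le> a + h" using h by (auto simp: field_simps)
  qed
  have pmin: "p \<le> j" if "j \<in> S" for j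
  proof (rule ccontr)
    assume "\<not> p \<le> j"
    hence "real j \<le> real_of_int \<lfloor>a / h\<rfloor>" using p' by linarith
    hence "real j \<le> a / h" by linarith
    thus False using that h by (auto simp: S_def field_simps)
  qed
  show ?thesis
  proof (cases "real p * h \<le> b")
    \<comment> \<open>No multiple of h lies in (a, b], so b - a < h and f is at most \<Lambda> h
      throughout; every term is then small by itself.\<close>
    case False
    have "S = {}"
    proof (rule ccontr)
      assume "S \<noteq> {}"
      then obtain j where j: "j \<in> S" by auto
      have "real p * h \<le> real j * h" using pmin[OF j] h by simp
      thus False using j False by (auto simp: S_def)
    qed
    have small: "\<bar>f x\<bar> \<le> \<Lambda> * h" if "x \<in> {a..b}" for x
      using Lip[of x b] that fb Lh[of "b - x"] ph False by auto
    have "\<bar>integral {a..b} f - 0 * (b - a)\<bar> \<le> \<Lambda> * h * (b - a)"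
      using small ab by (intro abs_integral_le cont) auto
    also have "\<dots> \<le> \<Lambda> * h * h" using ph False \<Lambda> h by (intro mult_left_mono) auto
    finally have "\<bar>integral {a..b} f\<bar> \<le> \<Lambda> * h\<^sup>2" by (simp add: power2_eq_square mult_ac)
    moreover have "h / 2 * \<bar>f a\<bar> \<le> h / 2 * (\<Lambda> * h)" using small[of a] ab h by (intro mult_left_mono) auto
    ultimately show ?thesis using psi \<open>S = {}\<close> \<Lambda> unfolding S_def[symmetric]
      by (simp add: power2_eq_square mult_ac)
  next
    case True
    have "p \<in> S" using True ph by (auto simp: S_def)
    then obtain p2 q where S: "S = {p2..q}" "p2 \<le> q"
      using nat_multiples_interval[OF h, of a b] unfolding S_def by blast
    have "p2 = p" using S \<open>p \<in> S\<close> pmin[of p2] by auto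
    hence S: "S = {p..q}" "p \<le> q" using S by auto
    have "q \<in> S" "Suc q \<notin> S" using S by auto
    hence qh: "a < real q * h" "real q * h \<le> b" "b < real q * h + h" using h by (auto simp: S_def algebra_simps)
    have pq: "real p * h \<le> real q * h" using S(2) h by simp
    define T where "T = h * (\<Sum>j=p..<q. (f (j * h) + f (Suc j * h)) / 2)"
    have T: "\<bar>T - integral {p * h..q * h} f\<bar> \<le> \<Lambda> * h\<^sup>2"
      unfolding T_def by (rule trapezoid_error[OF h S(2) continuous_on_subset[OF cont] convex_on_subset[OF convex] Lip \<Lambda>])
        (use ph qh in auto)
    have sumT: "h * (\<Sum>j=p..q. f (real j * h)) = T + h * (f (p * h) + f (q * h)) / 2"
      using S(2) unfolding T_def
      by (induction q rule: dec_induct) (simp_all add: field_simps del: of_nat_Suc)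
    have I: "integral {a..b} f = integral {a..p * h} f + integral {p * h..q * h} f + integral {q * h..b} f"
    proof -
      have int: "f integrable_on {x..y}" if "a \<le> x" "y \<le> b" for x y :: real
        by (rule integrable_continuous_interval, rule continuous_on_subset[OF cont]) (use that in auto)
      have "integral {a..p * h} f + integral {p * h..q * h} f = integral {a..q * h} f"
        using ph qh(2) pq by (intro Henstock_Kurzweil_Integration.integral_combine int) linarith+
      moreover have "integral {a..q * h} f + integral {q * h..b} f = integral {a..b} f"
        using qh by (intro Henstock_Kurzweil_Integration.integral_combine int) linarith+
      ultimately show ?thesis by simp
    qed
    have I1: "\<bar>integral {a..p * h} f - f a * (p * h - a)\<bar> \<le> \<Lambda> * h\<^sup>2"
    proof -
      have "\<bar>integral {a..p * h} f - f a * (p * h - a)\<bar> \<le> \<Lambda> * h * (p * h - a)"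
      proof (rule abs_integral_le)
        fix x assume x: "x \<in> {a..p * h}"
        thus "\<bar>f x - f a\<bar> \<le> \<Lambda> * h"
          using Lip[of a x] Lh[of "x - a"] ph True by auto
      qed (use ph True in \<open>auto intro: continuous_on_subset[OF cont]\<close>)
      also have "\<dots> \<le> \<Lambda> * h * h" using ph \<Lambda> h by (intro mult_left_mono) auto
      finally show ?thesis by (simp add: power2_eq_square mult_ac)
    qed
    have I2: "\<bar>integral {q * h..b} f\<bar> \<le> \<Lambda> * h\<^sup>2"
    proof -
      have "\<bar>integral {q * h..b} f - 0 * (b - q * h)\<bar> \<le> \<Lambda> * h * (b - q * h)"
      proof (rule abs_integral_le)
        fix x assume x: "x \<in> {q * h..b}"
        thus "\<bar>f x - 0\<bar> \<le> \<Lambda> * h"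
          using Lip[of x b] Lh[of "b - x"] qh fb by auto
      qed (use qh in \<open>auto intro: continuous_on_subset[OF cont]\<close>)
      also have "\<dots> \<le> \<Lambda> * h * h" using qh \<Lambda> h by (intro mult_left_mono) auto
      finally show ?thesis by (simp add: power2_eq_square mult_ac)
    qed
    have fp: "\<bar>f (p * h) - f a\<bar> \<le> \<Lambda> * h" using Lip[of a "p * h"] Lh[of "p * h - a"] ph True by auto
    have fq: "\<bar>f (q * h)\<bar> \<le> \<Lambda> * h" using Lip[of "q * h" b] Lh[of "b - q * h"] qh fb by auto
    have hp: "h * \<bar>f (p * h) - f a\<bar> \<le> \<Lambda> * h\<^sup>2" "h * \<bar>f (q * h)\<bar> \<le> \<Lambda> * h\<^sup>2"
      using mult_left_mono[OF fp, of h] mult_left_mono[OF fq, of h] h by (auto simp: power2_eq_square mult_ac)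
    \<comment> \<open>With p = floor(a/h) + 1 this is h psi(a/h) = h/2 - (ph - a): half an endpoint
      weight minus the length of the first fragment.\<close>
    have "psi (a / h) = a / h - real p + 1 / 2" unfolding p' by (simp add: psi_def frac_def)
    hence "h * psi (a / h) = a - real p * h + h / 2" using h by (simp add: field_simps)
    hence psi_eq: "h * psi (a / h) * f a = h * f a / 2 - f a * (p * h - a)"
      by (simp only:) (simp add: algebra_simps)
    have "h * (\<Sum>j=p..q. f (real j * h)) - integral {a..b} f - h * psi (a / h) * f a =
      (T - integral {p * h..q * h} f) - (integral {a..p * h} f - f a * (p * h - a)) - integral {q * h..b} f
      + h * (f (p * h) - f a) / 2 + h * f (q * h) / 2"
      unfolding sumT I psi_eq by (simp add: algebra_simps add_divide_distrib diff_divide_distrib)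
    moreover have "\<bar>h * (f (p * h) - f a) / 2\<bar> \<le> \<Lambda> * h\<^sup>2 / 2" "\<bar>h * f (q * h) / 2\<bar> \<le> \<Lambda> * h\<^sup>2 / 2"
      using hp h by (auto simp: abs_mult)
    \<comment> \<open>The constant 4 counts the trapezoid error and the two fragments with weight 1
      and the two endpoint corrections with weight 1/2.\<close>
    moreover have "\<bar>A - B - C + D + E\<bar> \<le> 4 * W" if "\<bar>A\<bar> \<le> W" "\<bar>B\<bar> \<le> W" "\<bar>C\<bar> \<le> W" "\<bar>D\<bar> \<le> W / 2" "\<bar>E\<bar> \<le> W / 2"
      for A B C D E W :: real using that by linarith
    ultimately have "\<bar>h * (\<Sum>j=p..q. f (real j * h)) - integral {a..b} f - h * psi (a / h) * f a\<bar> \<le> 4 * (\<Lambda> * h\<^sup>2)"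
      using T I1 I2 by (simp only:)
    thus ?thesis unfolding S_def[symmetric] S(1) by (simp add: mult.assoc)
  qed
qed

section \<open>The inverse curve\<close>

lemma convex_decreasing_facts:
  assumes "convex_decreasing L M f"
  shows "0 < L" "0 < M" "continuous_on {0..L} f" "convex_on {0..L} f" "f 0 = M" "f L = 0"
    and "\<And>x y. 0 \<le> x \<Longrightarrow> x < y \<Longrightarrow> y \<le> L \<Longrightarrow> f y < f x"
    and "\<And>x y. 0 \<le> x \<Longrightarrow> x \<le> y \<Longrightarrow> y \<le> L \<Longrightarrow> f y \<le> f x"
    and "\<And>x. 0 \<le> x \<Longrightarrow> x \<le> L \<Longrightarrow> 0 \<le> f x \<and> f x \<le> M"
proof -
  note * = assms[unfolded convex_decreasing_def monotone_on_def]
  show "0 < L" "0 < M" "continuous_on {0..L} f" "convex_on {0..L} f" "f 0 = M" "f L = 0"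
    using * by auto
  show lt: "f y < f x" if "0 \<le> x" "x < y" "y \<le> L" for x y using * that by auto
  show le: "f y \<le> f x" if "0 \<le> x" "x \<le> y" "y \<le> L" for x y
    using lt[of x y] that by (cases "x = y") auto
  show "0 \<le> f x \<and> f x \<le> M" if "0 \<le> x" "x \<le> L" for x
    using le[of 0 x] le[of x L] that * by auto
qed

text \<open>The inverse is a curve of the same kind with L and M exchanged, so each statement about
  columns is also one about rows.\<close>

lemma inverse_curve:
  assumes f: "convex_decreasing L M f" and g: "\<forall>y\<in>{0..M}. g y = the_inv_into {0..L} f y"
  shows "\<And>x. x \<in> {0..L} \<Longrightarrow> g (f x) = x"
    and "\<And>y. y \<in> {0..M} \<Longrightarrow> f (g y) = y"
    and "\<And>y. y \<in> {0..M} \<Longrightarrow> g y \<in> {0..L}"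
    and "convex_decreasing M L g"
proof -
  note F = convex_decreasing_facts[OF f]
  have inj: "inj_on f {0..L}"
  proof (rule inj_onI)
    fix x y assume xy: "x \<in> {0..L}" "y \<in> {0..L}" "f x = f y"
    consider "x < y" | "x = y" | "y < x" by linarith
    thus "x = y" using F(7)[of x y] F(7)[of y x] xy by cases auto
  qed
  have img: "f ` {0..L} = {0..M}"
  proof (intro equalityI subsetI)
    fix y assume "y \<in> {0..M}"
    then obtain x where "0 \<le> x" "x \<le> L" "f x = y"
      using IVT2'[of f L y 0] F by auto
    thus "y \<in> f ` {0..L}" by auto
  qed (use F(9) in auto)
  show gf: "g (f x) = x" if "x \<in> {0..L}" for x
  proof -
    have "f x \<in> {0..M}" using that img by blast
    thus ?thesis using g the_inv_into_f_f[OF inj that] by simp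
  qed
  show fg: "f (g y) = y" if "y \<in> {0..M}" for y
  proof -
    have "y \<in> f ` {0..L}" using that img by blast
    thus ?thesis using bspec[OF g that] f_the_inv_into_f[OF inj] by simp
  qed
  show gr: "g y \<in> {0..L}" if y: "y \<in> {0..M}" for y
  proof -
    obtain x where "x \<in> {0..L}" "y = f x" using y img by blast
    thus ?thesis using gf by auto
  qed
  have lt: "g y < g x" if "0 \<le> x" "x < y" "y \<le> M" for x y
  proof (rule ccontr)
    assume "\<not> g y < g x"
    hence "f (g y) \<le> f (g x)" using gr[of x] gr[of y] that F(8) by auto
    thus False using fg[of x] fg[of y] that by auto
  qed
  have cont: "continuous_on {0..M} g"
    using continuous_on_inv[of "{0..L}" f g] F(3) gf img by auto
  have conv: "convex_on {0..M} g"
  proof (rule convex_onI)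
    fix t x y :: real assume t: "0 < t" "t < 1" and xy: "x \<in> {0..M}" "y \<in> {0..M}"
    define u where "u = (1 - t) * g x + t * g y"
    define w where "w = (1 - t) * x + t * y"
    have u: "u \<in> {0..L}"
      using convexD_alt[OF convex_real_interval(5)[of 0 L] gr[OF xy(1)] gr[OF xy(2)], of t] t by (simp add: u_def)
    have w: "w \<in> {0..M}"
      using convexD_alt[OF convex_real_interval(5)[of 0 M] xy, of t] t by (simp add: w_def)
    have "f u \<le> (1 - t) * f (g x) + t * f (g y)"
      using convex_onD[OF F(4), of t "g x" "g y"] gr xy t by (simp add: u_def)
    also have "\<dots> = w" using fg xy by (simp add: w_def)
    finally have "f u \<le> f (g w)" using fg w by simp
    hence "g w \<le> u" using F(7)[of u "g w"] u gr[OF w] by (auto simp: not_le[symmetric])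
    thus "g ((1 - t) *\<^sub>R x + t *\<^sub>R y) \<le> (1 - t) * g x + t * g y" by (simp add: u_def w_def)
  qed simp
  have "g 0 = L" "g M = 0" using gf[of L] gf[of 0] F by auto
  thus "convex_decreasing M L g"
    using F(1,2) cont conv lt unfolding convex_decreasing_def monotone_on_def by auto
qed

text \<open>The equality case of Young's inequality. The derivatives of the three terms of
  \<open>D\<close> cancel wherever g is differentiable, that is, inside the interval; continuity
  reaches the endpoints.\<close>

lemma area_by_inverse:
  assumes f: "convex_decreasing L M f" and g: "\<forall>y\<in>{0..M}. g y = the_inv_into {0..L} f y"
    and \<beta>: "0 \<le> \<beta>" "\<beta> \<le> M" and C2: "C2_on {\<beta>..<M} g g' g''"
  shows "integral {0..g \<beta>} f = g \<beta> * \<beta> + integral {\<beta>..M} g"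
proof (cases "\<beta> = M")
  case True
  thus ?thesis using convex_decreasing_facts(6)[OF inverse_curve(4)[OF f g]] by simp
next
  case False
  hence \<beta>M: "\<beta> < M" using \<beta> by simp
  note F = convex_decreasing_facts[OF f] and G = convex_decreasing_facts[OF inverse_curve(4)[OF f g]]
  note inv = inverse_curve[OF f g]
  \<comment> \<open>constant in \<open>t\<close>; the endpoints give the claim\<close>
  define D where "D t = integral {\<beta>..t} g + integral {0..g t} f - t * g t" for t
  have contg: "continuous_on {\<beta>..M} g" by (rule continuous_on_subset[OF G(3)]) (use \<beta> in auto)
  have contD: "continuous_on {\<beta>..M} D"
  proof -
    have "continuous_on {\<beta>..M} (\<lambda>t. integral {\<beta>..t} g)"
      by (intro indefinite_integral_continuous_1 integrable_continuous_interval contg)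
    moreover have "continuous_on {0..L} (\<lambda>x. integral {0..x} f)"
      by (intro indefinite_integral_continuous_1 integrable_continuous_interval F(3))
    hence "continuous_on {\<beta>..M} (\<lambda>t. integral {0..g t} f)"
      by (rule continuous_on_compose2[OF _ contg]) (use inv(3) \<beta> in auto)
    ultimately show ?thesis unfolding D_def[abs_def] by (intro continuous_intros contg)
  qed
  have D0: "(D has_real_derivative 0) (at t)" if t: "\<beta> < t" "t < M" for t
  proof -
    have "(g has_real_derivative g' t) (at t within {\<beta>..<M})"
      using C2 t unfolding C2_on_def by auto
    moreover have "at t within {\<beta>..<M} = at t"
      using t by (intro at_within_interior) (auto simp: interior_atLeastLessThan)
    ultimately have g't: "(g has_real_derivative g' t) (at t)" by simp
    have gt: "g t \<in> {0<..<L}" using G(7)[of t M] G(7)[of 0 t] G(5,6) t \<beta> by auto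
    have "((\<lambda>t. integral {\<beta>..t} g) has_real_derivative g t) (at t within {\<beta>..M})"
      using integral_has_real_derivative[OF contg, of t] t by auto
    hence 1: "((\<lambda>t. integral {\<beta>..t} g) has_real_derivative g t) (at t)"
      using t by (simp add: at_within_Icc_at)
    have "((\<lambda>x. integral {0..x} f) has_real_derivative f (g t)) (at (g t) within {0..L})"
      using integral_has_real_derivative[OF F(3), of "g t"] gt by auto
    hence "((\<lambda>x. integral {0..x} f) has_real_derivative t) (at (g t))"
      using gt inv(2)[of t] t \<beta> by (simp add: at_within_Icc_at)
    from DERIV_chain2[OF this g't] have 2: "((\<lambda>t. integral {0..g t} f) has_real_derivative t * g' t) (at t)" .
    show ?thesis unfolding D_def[abs_def]
      by (auto intro!: derivative_eq_intros 1 2 g't)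
  qed
  have "D M = D \<beta>"
    by (rule DERIV_isconst_end[OF \<beta>M contD D0])
  thus ?thesis using G(6) by (simp add: D_def algebra_simps)
qed

text \<open>The region under the curve read by columns and by rows. It serves both the splitting at
  the corner and the reflection in the diagonal.\<close>

lemma lattice_count_swap:
  assumes f: "convex_decreasing L M f" and g: "\<forall>y\<in>{0..M}. g y = the_inv_into {0..L} f y"
    and c: "0 < c" and x: "0 \<le> x" and k: "0 \<le> k"
  shows "x \<le> L \<and> k \<le> c * f x \<longleftrightarrow> k / c \<le> M \<and> x \<le> g (k / c)"
proof -
  note F = convex_decreasing_facts[OF f] and G = convex_decreasing_facts[OF inverse_curve(4)[OF f g]]
  note inv = inverse_curve[OF f g]
  define y where "y = k / c"
  have y: "0 \<le> y" "k \<le> c * f x \<longleftrightarrow> y \<le> f x" using c k by (auto simp: y_def field_simps)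
  show ?thesis unfolding y(2) y_def[symmetric]
  proof safe
    assume *: "x \<le> L" "y \<le> f x"
    show "y \<le> M" using F(9)[of x] x * by linarith
    thus "x \<le> g y" using G(8)[of y "f x"] inv(1)[of x] y * x F(9)[of x] by auto
  next
    assume *: "y \<le> M" "x \<le> g y"
    show "x \<le> L" using inv(3)[of y] y * by auto
    thus "y \<le> f x" using F(8)[of x "g y"] inv(2)[of y] inv(3)[of y] y * x by auto
  qed
qed

text \<open>Reflection in the diagonal. It turns small stretch factors into large ones, so an upper
  bound on optimal s for both curves also gives a lower bound.\<close>

lemma lattice_count_inverse:
  assumes f: "convex_decreasing L M f" and g: "\<forall>y\<in>{0..M}. g y = the_inv_into {0..L} f y"
    and rs: "0 < r" "0 < s"
  shows "lattice_count L f r s = lattice_count M g r (1 / s)"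
proof -
  have *: "real j * s / r \<le> L \<and> real k \<le> r * s * f (real j * s / r) \<longleftrightarrow>
     real k * (1 / s) / r \<le> M \<and> real j \<le> r * (1 / s) * g (real k * (1 / s) / r)" for j k :: nat
  proof -
    have "real j * s / r \<le> L \<and> real k \<le> r * s * f (real j * s / r) \<longleftrightarrow>
       real k / (r * s) \<le> M \<and> real j * s / r \<le> g (real k / (r * s))"
      by (rule lattice_count_swap[OF f g]) (use rs in auto)
    thus ?thesis using rs by (simp add: field_simps)
  qed
  have "bij_betw prod.swap {(j :: nat, k :: nat). 1 \<le> j \<and> 1 \<le> k \<and> real j * s / r \<le> L \<and> real k \<le> r * s * f (real j * s / r)}
    {(j :: nat, k :: nat). 1 \<le> j \<and> 1 \<le> k \<and> real j * (1 / s) / r \<le> M \<and> real k \<le> r * (1 / s) * g (real j * (1 / s) / r)}"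
    by (rule bij_betwI[where g = prod.swap]) (use * in auto)
  thus ?thesis unfolding lattice_count_def by (rule bij_betw_same_card)
qed

section \<open>Expansion of the lattice count\<close>

text \<open>A convex function is at least as steep to the left: from \<alpha> on, slopes are not
  below that of the chord from 0, which is at least - M / \<alpha>. Nothing of the kind holds near
  0, hence the restriction of columns to jh > \<alpha>.\<close>

lemma curve_Lipschitz:
  assumes f: "convex_decreasing L M f" and "0 < \<alpha>" "\<alpha> \<le> x" "x \<le> y" "y \<le> L"
  shows "\<bar>f y - f x\<bar> \<le> M / \<alpha> * (y - x)"
proof -
  note F = convex_decreasing_facts[OF f]
  have "f x + (f x - f 0) / (x - 0) * (y - x) \<le> f y"
    by (rule convex_on_extrapolate[OF F(4)]) (use assms in auto)
  moreover have "- (M / \<alpha>) \<le> (f x - f 0) / (x - 0)"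
  proof -
    have "(f 0 - f x) / (x - 0) \<le> M / \<alpha>"
      using F(9)[of x] F(2,5) assms by (intro frac_le) auto
    thus ?thesis by (metis minus_diff_eq minus_divide_left neg_le_iff_le)
  qed
  hence "- (M / \<alpha>) * (y - x) \<le> (f x - f 0) / (x - 0) * (y - x)"
    using assms by (intro mult_right_mono) auto
  moreover have "f y \<le> f x" using F(8) assms by auto
  ultimately show ?thesis by simp
qed

text \<open>A column of height y holds floor(y) = y - 1/2 - psi(y) points. The y form a Riemann sum,
  the halves count the (L - \<alpha>)/h + O(1) columns, and the rest is
  \<open>psi_sum\<close>.\<close>

lemma column_count:
  fixes f :: "real \<Rightarrow> real"
  assumes f: "convex_decreasing L M f" and h: "0 < h" and c: "0 < c" and \<alpha>: "0 < \<alpha>" "\<alpha> < L"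
  shows "finite {(j :: nat, k :: nat). 1 \<le> j \<and> 1 \<le> k \<and> \<alpha> < real j * h \<and> real j * h \<le> L \<and> real k \<le> c * f (real j * h)}" (is "finite ?P")
    and "\<bar>real (card {(j :: nat, k :: nat). 1 \<le> j \<and> 1 \<le> k \<and> \<alpha> < real j * h \<and> real j * h \<le> L \<and> real k \<le> c * f (real j * h)})
      - (c / h * integral {\<alpha>..L} f + psi (\<alpha> / h) * (c * f \<alpha>) - (L - \<alpha>) / (2 * h))\<bar>
      \<le> \<bar>psi_sum f c h \<alpha> L\<bar> + 1 / 2 + 4 * (M / \<alpha>) * (c * h)"
proof -
  note F = convex_decreasing_facts[OF f]
  define J where "J = {j::nat. \<alpha> < real j * h \<and> real j * h \<le> L}"
  have finJ: "finite J" unfolding J_def by (rule finite_nat_multiples[OF h])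
  have fpos: "0 \<le> c * f (real j * h)" if "j \<in> J" for j
    using that F(9)[of "real j * h"] c h by (simp add: J_def)
  have P: "?P = Sigma J (\<lambda>j. {1..nat \<lfloor>c * f (real j * h)\<rfloor>})"
  proof (intro equalityI subsetI)
    fix p assume "p \<in> Sigma J (\<lambda>j. {1..nat \<lfloor>c * f (real j * h)\<rfloor>})"
    then obtain j k where p: "p = (j, k)" "j \<in> J" "1 \<le> k" "k \<le> nat \<lfloor>c * f (real j * h)\<rfloor>" by auto
    have "j \<noteq> 0" using p(2) \<alpha> by (intro notI) (simp add: J_def)
    moreover have "real k \<le> c * f (real j * h)" using p(3,4) by linarith
    ultimately show "p \<in> ?P" using p by (auto simp: J_def)
  qed (auto simp: J_def le_nat_floor)
  show "finite ?P" unfolding P using finJ by auto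
  have cJ: "\<bar>real (card J) - (L - \<alpha>) / h\<bar> \<le> 1"
  proof -
    have "J = {nat \<lfloor>\<alpha> / h\<rfloor><..nat \<lfloor>L / h\<rfloor>}"
    proof (intro set_eqI)
      fix j :: nat
      have "j \<in> J \<longleftrightarrow> \<alpha> / h < real j \<and> real j \<le> L / h" using h by (auto simp: J_def field_simps)
      also have "\<dots> \<longleftrightarrow> \<lfloor>\<alpha> / h\<rfloor> < int j \<and> int j \<le> \<lfloor>L / h\<rfloor>" by (simp add: floor_less_iff le_floor_iff)
      also have "\<dots> \<longleftrightarrow> j \<in> {nat \<lfloor>\<alpha> / h\<rfloor><..nat \<lfloor>L / h\<rfloor>}"
        using \<alpha> h by (auto simp: nat_less_iff nat_le_iff le_nat_iff)
      finally show "j \<in> J \<longleftrightarrow> j \<in> {nat \<lfloor>\<alpha> / h\<rfloor><..nat \<lfloor>L / h\<rfloor>}" .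
    qed
    moreover have "0 \<le> \<lfloor>\<alpha> / h\<rfloor>" "\<lfloor>\<alpha> / h\<rfloor> \<le> \<lfloor>L / h\<rfloor>"
      using \<alpha> h by (auto intro!: floor_mono divide_right_mono)
    moreover from this have "0 \<le> \<lfloor>L / h\<rfloor>" by linarith
    ultimately have "real (card J) = of_int \<lfloor>L / h\<rfloor> - of_int \<lfloor>\<alpha> / h\<rfloor>"
      by (simp add: of_nat_diff nat_mono)
    thus ?thesis by (simp add: diff_divide_distrib) linarith
  qed
  have "real (card ?P) = (\<Sum>j\<in>J. real (nat \<lfloor>c * f (real j * h)\<rfloor>))"
    unfolding P using finJ by (simp add: card_SigmaI)
  also have "\<dots> = (\<Sum>j\<in>J. c * f (real j * h) - 1 / 2 - psi (c * f (real j * h)))"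
    using fpos by (intro sum.cong) (auto simp: psi_def frac_def)
  also have "\<dots> = c * (\<Sum>j\<in>J. f (real j * h)) - real (card J) / 2 - psi_sum f c h \<alpha> L"
    by (simp add: psi_sum_def J_def[symmetric] sum_subtractf sum_distrib_left)
  finally have card: "real (card ?P) = c * (\<Sum>j\<in>J. f (real j * h)) - real (card J) / 2 - psi_sum f c h \<alpha> L" .
  have R: "\<bar>h * (\<Sum>j\<in>J. f (real j * h)) - integral {\<alpha>..L} f - h * psi (\<alpha> / h) * f \<alpha>\<bar> \<le> 4 * (M / \<alpha>) * h\<^sup>2"
    unfolding J_def
  proof (rule convex_riemann_sum[OF h _ \<alpha>(2)])
    show "\<And>x y. x \<in> {\<alpha>..L} \<Longrightarrow> y \<in> {\<alpha>..L} \<Longrightarrow> x \<le> y \<Longrightarrow> \<bar>f y - f x\<bar> \<le> M / \<alpha> * (y - x)"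
      using curve_Lipschitz[OF f \<alpha>(1)] by auto
  qed (use F \<alpha> in \<open>auto intro: continuous_on_subset convex_on_subset\<close>)
  define W where "W = (\<Sum>j\<in>J. f (real j * h))"
  define I where "I = integral {\<alpha>..L} f"
  have "c / h * (h * W - I - h * psi (\<alpha> / h) * f \<alpha>) = c * W - c / h * I - psi (\<alpha> / h) * (c * f \<alpha>)"
    using h by (simp add: field_simps)
  moreover have "\<bar>c / h * (h * W - I - h * psi (\<alpha> / h) * f \<alpha>)\<bar> \<le> c / h * (4 * (M / \<alpha>) * h\<^sup>2)"
    unfolding abs_mult W_def I_def using R c h by (intro mult_mono) auto
  moreover have "c / h * (4 * (M / \<alpha>) * h\<^sup>2) = 4 * (M / \<alpha>) * (c * h)"
    using h by (simp add: power2_eq_square)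
  ultimately have "\<bar>c * W - c / h * I - psi (\<alpha> / h) * (c * f \<alpha>)\<bar> \<le> 4 * (M / \<alpha>) * (c * h)" by simp
  moreover have "(L - \<alpha>) / (2 * h) = (L - \<alpha>) / h / 2" by simp
  moreover have "\<bar>x - d / 2 - p - (i + q - l / 2)\<bar> \<le> \<bar>p\<bar> + 1 / 2 + t"
    if "\<bar>x - i - q\<bar> \<le> t" "\<bar>d - l\<bar> \<le> 1" for x d p i q l t :: real
    using that by (auto simp: abs_if split: if_splits)
  ultimately show "\<bar>real (card ?P)
      - (c / h * integral {\<alpha>..L} f + psi (\<alpha> / h) * (c * f \<alpha>) - (L - \<alpha>) / (2 * h))\<bar>
      \<le> \<bar>psi_sum f c h \<alpha> L\<bar> + 1 / 2 + 4 * (M / \<alpha>) * (c * h)"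
    using cJ unfolding card W_def I_def by (simp only:)
qed

text \<open>Rows are columns of the inverse curve with h' = 1/c and c' = 1/h. The constant 2
  collects 1/2 from the columns, 1/2 from the rows and 1 from the rectangle.\<close>

lemma lattice_count_expansion:
  assumes f: "convex_decreasing L M f" and g: "\<forall>y\<in>{0..M}. g y = the_inv_into {0..L} f y"
    and \<alpha>: "0 < \<alpha>" "\<alpha> < L" and \<beta>: "\<beta> = f \<alpha>" and C2: "C2_on {\<beta>..<M} g g' g''"
    and rs: "0 < r" "0 < s"
  shows "\<bar>real (lattice_count L f r s) - (r\<^sup>2 * curve_area L f - r * (L / s + s * M) / 2)\<bar>
    \<le> \<bar>psi_sum f (r * s) (s / r) \<alpha> L\<bar> + \<bar>psi_sum g (r * (1 / s)) (1 / s / r) \<beta> M\<bar>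
      + 2 + 4 * (M / \<alpha>) * s\<^sup>2 + 4 * (L / \<beta>) * (1 / s\<^sup>2)"
proof -
  note F = convex_decreasing_facts[OF f] and G = convex_decreasing_facts[OF inverse_curve(4)[OF f g]]
  note inv = inverse_curve[OF f g]
  have \<beta>': "0 < \<beta>" "\<beta> < M" "g \<beta> = \<alpha>"
    using F(7)[of 0 \<alpha>] F(7)[of \<alpha> L] F(5,6) \<alpha> inv(1)[of \<alpha>] by (auto simp: \<beta>)
  define h c where "h = s / r" and "c = r * s"
  have hc: "0 < h" "0 < c" using rs by (auto simp: h_def c_def)
  define h' c' where "h' = 1 / s / r" and "c' = r * (1 / s)"
  have h'c': "0 < h'" "0 < c'" "h' = 1 / c" "c' = 1 / h" using rs by (auto simp: h_def c_def h'_def c'_def)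
  define P where "P = {(j :: nat, k :: nat). 1 \<le> j \<and> 1 \<le> k \<and> real j * h \<le> L \<and> real k \<le> c * f (real j * h)}"
  define P1 where "P1 = {(j :: nat, k :: nat). 1 \<le> j \<and> 1 \<le> k \<and> \<alpha> < real j * h \<and> real j * h \<le> L \<and> real k \<le> c * f (real j * h)}"
  define Q where "Q = {(k :: nat, j :: nat). 1 \<le> k \<and> 1 \<le> j \<and> \<beta> < real k * h' \<and> real k * h' \<le> M \<and> real j \<le> c' * g (real k * h')}"
  define P2 where "P2 = prod.swap ` Q"
  define P3 where "P3 = {1..nat \<lfloor>\<alpha> / h\<rfloor>} \<times> {1..nat \<lfloor>\<beta> / h'\<rfloor>}"
  have sw: "real j * h \<le> L \<and> real k \<le> c * f (real j * h) \<longleftrightarrow> real k * h' \<le> M \<and> real j \<le> c' * g (real k * h')" for j k :: nat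
    using lattice_count_swap[OF f g hc(2), of "real j * h" "real k"] hc
    by (simp add: h'c'(3,4) pos_le_divide_eq)
  have P3_iff: "(j, k) \<in> P3 \<longleftrightarrow> 1 \<le> j \<and> 1 \<le> k \<and> real j * h \<le> \<alpha> \<and> real k * h' \<le> \<beta>" for j k
  proof -
    have "j \<le> nat \<lfloor>\<alpha> / h\<rfloor> \<longleftrightarrow> real j * h \<le> \<alpha>" if "1 \<le> j"
      using that hc \<alpha> by (simp add: le_nat_iff le_floor_iff pos_le_divide_eq)
    moreover have "k \<le> nat \<lfloor>\<beta> / h'\<rfloor> \<longleftrightarrow> real k * h' \<le> \<beta>" if "1 \<le> k"
      using that h'c'(1) \<beta>' by (simp add: le_nat_iff le_floor_iff pos_le_divide_eq)
    ultimately show ?thesis by (auto simp: P3_def)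
  qed
  \<comment> \<open>A point of the region to the right of \<alpha> is no higher than \<beta>, so no
    point is counted both by columns and by rows.\<close>
  have corner: "real k * h' \<le> \<beta>" if "(j, k) \<in> P1" for j k
  proof -
    have "real k / c \<le> f (real j * h)" using that hc by (auto simp: P1_def pos_divide_le_eq mult.commute)
    also have "\<dots> \<le> \<beta>" using F(8)[of \<alpha> "real j * h"] that \<alpha> by (auto simp: P1_def \<beta>)
    finally show ?thesis by (simp add: h'c'(3))
  qed
  have P_eq: "P = P1 \<union> P2 \<union> P3"
  proof (intro equalityI subsetI)
    fix p assume "p \<in> P"
    then obtain j k where p: "p = (j, k)" "1 \<le> j" "1 \<le> k" "real j * h \<le> L" "real k \<le> c * f (real j * h)"
      by (auto simp: P_def)
    show "p \<in> P1 \<union> P2 \<union> P3"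
    proof (cases "\<alpha> < real j * h")
      case True thus ?thesis using p by (auto simp: P1_def)
    next
      case False
      show ?thesis
      proof (cases "\<beta> < real k * h'")
        case True
        hence "(k, j) \<in> Q" using p sw[of j k] by (auto simp: Q_def)
        thus ?thesis unfolding P2_def p(1) by force
      next
        case False thus ?thesis using \<open>\<not> \<alpha> < real j * h\<close> p P3_iff by auto
      qed
    qed
  next
    fix p assume "p \<in> P1 \<union> P2 \<union> P3"
    thus "p \<in> P"
    proof (elim UnE)
      assume "p \<in> P2" thus ?thesis using sw by (auto simp: P2_def Q_def P_def)
    next
      assume "p \<in> P3"
      then obtain j k where p: "p = (j, k)" "1 \<le> j" "1 \<le> k" "real j * h \<le> \<alpha>" "real k * h' \<le> \<beta>"
        using P3_iff by (cases p) auto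
      have "real k / c \<le> f \<alpha>" using p by (simp add: h'c' \<beta>)
      also have "\<dots> \<le> f (real j * h)" using F(8)[of "real j * h" \<alpha>] p \<alpha> hc by auto
      finally have "real k \<le> c * f (real j * h)" using hc by (simp add: pos_divide_le_eq mult.commute)
      thus ?thesis using p \<alpha> by (auto simp: P_def)
    qed (auto simp: P1_def P_def)
  qed
  note col1 = column_count[OF f hc \<alpha>] and col2 = column_count[OF inv(4) h'c'(1,2) \<beta>'(1,2)]
  have fin: "finite P1" "finite Q" "finite P2" "finite P3"
    using col1(1) col2(1) unfolding P1_def Q_def P2_def P3_def by auto
  have dis: "P1 \<inter> P2 = {}" "(P1 \<union> P2) \<inter> P3 = {}"
  proof -
    show "P1 \<inter> P2 = {}" using corner by (auto simp: P2_def Q_def) (meson leD)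
    have "p \<notin> P3" if "p \<in> P1 \<union> P2" for p
      using that P3_iff by (cases p) (auto simp: P1_def P2_def Q_def)
    thus "(P1 \<union> P2) \<inter> P3 = {}" by auto
  qed
  define X Y where "X = \<alpha> / h" and "Y = \<beta> / h'"
  have XY: "0 \<le> X" "0 \<le> Y" using \<alpha> \<beta>' hc h'c' by (auto simp: X_def Y_def)
  have "lattice_count L f r s = card P" unfolding lattice_count_def P_def h_def c_def by simp
  also have "\<dots> = card P1 + card Q + card P3"
    unfolding P_eq using fin dis by (simp add: card_Un_disjoint P2_def card_image)
  also have "real \<dots> = real (card P1) + real (card Q) + of_int \<lfloor>X\<rfloor> * of_int \<lfloor>Y\<rfloor>"
    using XY by (simp add: P3_def X_def[symmetric] Y_def[symmetric])
  finally have N: "real (lattice_count L f r s) = real (card P1) + real (card Q) + of_int \<lfloor>X\<rfloor> * of_int \<lfloor>Y\<rfloor>" .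
  define I1 I2 where "I1 = integral {\<alpha>..L} f" and "I2 = integral {\<beta>..M} g"
  have r2: "c / h = r\<^sup>2" "c' / h' = r\<^sup>2" "c * \<beta> = Y" "c' * \<alpha> = X" "c * h = s\<^sup>2" "c' * h' = 1 / s\<^sup>2"
    "\<alpha> * \<beta> * r\<^sup>2 = X * Y"
    using rs by (auto simp: h_def c_def h'_def c'_def X_def Y_def power2_eq_square)
  have T1: "\<bar>real (card P1) - (r\<^sup>2 * I1 + psi X * Y - (L - \<alpha>) / (2 * h))\<bar>
      \<le> \<bar>psi_sum f c h \<alpha> L\<bar> + 1 / 2 + 4 * (M / \<alpha>) * s\<^sup>2"
    using col1(2) unfolding P1_def[symmetric] I1_def[symmetric] X_def[symmetric] \<beta>[symmetric] r2 .
  have T2: "\<bar>real (card Q) - (r\<^sup>2 * I2 + psi Y * X - (M - \<beta>) / (2 * h'))\<bar>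
      \<le> \<bar>psi_sum g c' h' \<beta> M\<bar> + 1 / 2 + 4 * (L / \<beta>) * (1 / s\<^sup>2)"
    using col2(2) unfolding Q_def[symmetric] I2_def[symmetric] Y_def[symmetric] \<beta>'(3) r2 .
  have area: "curve_area L f = \<alpha> * \<beta> + I2 + I1"
  proof -
    have "integral {0..\<alpha>} f + integral {\<alpha>..L} f = integral {0..L} f"
      using \<alpha> by (intro Henstock_Kurzweil_Integration.integral_combine integrable_continuous_interval F(3)) auto
    moreover have "integral {0..\<alpha>} f = \<alpha> * \<beta> + I2"
      using area_by_inverse[OF f g _ _ C2] \<beta>' by (simp add: I2_def)
    ultimately show ?thesis by (simp add: curve_area_def I1_def)
  qed
  \<comment> \<open>The corner terms psi(X) Y and psi(Y) X, of order r, occur here with the sign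
    opposite to that in \<open>T1\<close> and \<open>T2\<close>. After the cancellation only frac X
    * frac Y is left.\<close>
  have floorXY: "\<bar>of_int \<lfloor>X\<rfloor> * of_int \<lfloor>Y\<rfloor> - (X * Y - X / 2 - Y / 2 - psi X * Y - psi Y * X)\<bar> \<le> 1"
  proof -
    have "of_int \<lfloor>X\<rfloor> * of_int \<lfloor>Y\<rfloor> - (X * Y - X / 2 - Y / 2 - psi X * Y - psi Y * X) = frac X * frac Y"
      by (simp add: psi_def frac_def algebra_simps)
    moreover have "\<bar>frac X * frac Y\<bar> \<le> 1 * 1"
      unfolding abs_mult using frac_ge_0 frac_lt_1 by (intro mult_mono) (auto intro: less_imp_le)
    ultimately show ?thesis by simp
  qed
  have A: "r\<^sup>2 * curve_area L f = X * Y + r\<^sup>2 * I2 + r\<^sup>2 * I1" unfolding area by (simp add: algebra_simps flip: r2(7))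
  have B: "r * (L / s + s * M) / 2 = (L - \<alpha>) / (2 * h) + (M - \<beta>) / (2 * h') + X / 2 + Y / 2"
    using rs by (simp add: h_def h'_def X_def Y_def field_simps)
  have "\<bar>p1 + q + w - (xy + i2 + i1 - (la + mb + x2 + y2))\<bar> \<le> \<bar>s1\<bar> + \<bar>s2\<bar> + 2 + t1 + t2"
    if "\<bar>p1 - (i1 + u - la)\<bar> \<le> \<bar>s1\<bar> + 1 / 2 + t1" "\<bar>q - (i2 + v - mb)\<bar> \<le> \<bar>s2\<bar> + 1 / 2 + t2"
      "\<bar>w - (xy - x2 - y2 - u - v)\<bar> \<le> 1" for p1 q w xy i1 i2 la mb x2 y2 u v s1 s2 t1 t2 :: real
    using that by linarith
  from this[OF T1 T2 floorXY] show ?thesis unfolding N A B c_def h_def c'_def h'_def .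
qed

text \<open>The sawtooth bound is used twice: for f with s in [s0, s1], and for g with 1/s in
  [1/s1, 1/s0].\<close>

lemma lattice_count_asymptotic:
  fixes f f' f'' g g' g'' \<delta> \<epsilon> :: "real \<Rightarrow> real"
  assumes f: "convex_decreasing L M f" and g: "\<forall>y\<in>{0..M}. g y = the_inv_into {0..L} f y"
    and \<alpha>: "0 < \<alpha>" "\<alpha> < L" and \<beta>: "\<beta> = f \<alpha>"
    and fC2: "C2_on {\<alpha>..<L} f f' f''" "\<And>x. x \<in> {\<alpha>..<L} \<Longrightarrow> f' x < 0 \<and> f'' x > 0"
      "piecewise_monotonic \<alpha> L f''"
    and gC2: "C2_on {\<beta>..<M} g g' g''" "\<And>y. y \<in> {\<beta>..<M} \<Longrightarrow> g' y < 0 \<and> g'' y > 0"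
      "piecewise_monotonic \<beta> M g''"
    and \<delta>: "\<And>r. 0 < r \<Longrightarrow> 0 < \<delta> r \<and> \<delta> r \<le> L - \<alpha>"
      "\<delta> \<in> O[at_top](\<lambda>r. r powr (- 2 * a1))"
      "(\<lambda>r. 1 / f'' (L - \<delta> r)) \<in> O[at_top](\<lambda>r. r powr (1 - 4 * a2))"
    and \<epsilon>: "\<And>r. 0 < r \<Longrightarrow> 0 < \<epsilon> r \<and> \<epsilon> r \<le> M - \<beta>"
      "\<epsilon> \<in> O[at_top](\<lambda>r. r powr (- 2 * b1))"
      "(\<lambda>r. 1 / g'' (M - \<epsilon> r)) \<in> O[at_top](\<lambda>r. r powr (1 - 4 * b2))"
    and e: "e \<le> 1 / 6" "e \<le> a1" "e \<le> a2" "e \<le> b1" "e \<le> b2" and s: "0 < s0" "s0 \<le> s1"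
  shows "\<exists>C>0. \<forall>\<^sub>F r in at_top. \<forall>s\<in>{s0..s1}.
    \<bar>real (lattice_count L f r s) - (r\<^sup>2 * curve_area L f - r * (L / s + s * M) / 2)\<bar> \<le> C * r powr (1 - 2 * e)"
proof -
  note F = convex_decreasing_facts[OF f]
  have \<beta>': "0 < \<beta>" "\<beta> < M"
    using F(7)[of 0 \<alpha>] F(7)[of \<alpha> L] F(5,6) \<alpha> by (auto simp: \<beta>)
  obtain C1 where C1: "\<forall>\<^sub>F r in at_top. \<forall>s\<in>{s0..s1}. \<bar>psi_sum f (r * s) (s / r) \<alpha> L\<bar> \<le> C1 * r powr (1 - 2 * e)"
    using psi_sum_tail[OF fC2(1) \<alpha>(2) fC2(2,3) \<delta> e(1,2,3) s] by blast
  have s': "0 < 1 / s1" "1 / s1 \<le> 1 / s0" using s by (auto simp: frac_le)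
  obtain C2 where C2: "\<forall>\<^sub>F r in at_top. \<forall>s\<in>{1 / s1..1 / s0}. \<bar>psi_sum g (r * s) (s / r) \<beta> M\<bar> \<le> C2 * r powr (1 - 2 * e)"
    using psi_sum_tail[OF gC2(1) \<beta>'(2) gC2(2,3) \<epsilon> e(1,4,5) s'] by blast
  define D where "D = 2 + 4 * (M / \<alpha>) * s1\<^sup>2 + 4 * (L / \<beta>) * (1 / s0\<^sup>2)"
  have D: "0 < D" unfolding D_def using F(1,2) \<alpha> \<beta>' by (intro add_pos_nonneg) auto
  define C where "C = \<bar>C1\<bar> + \<bar>C2\<bar> + D"
  have "\<forall>\<^sub>F r in at_top. \<forall>s\<in>{s0..s1}.
    \<bar>real (lattice_count L f r s) - (r\<^sup>2 * curve_area L f - r * (L / s + s * M) / 2)\<bar> \<le> C * r powr (1 - 2 * e)"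
    using C1 C2 eventually_ge_at_top[of 1]
  proof eventually_elim
    case (elim r)
    define T where "T = r powr (1 - 2 * e)"
    have T: "1 \<le> T" unfolding T_def using elim e by (intro ge_one_powr_ge_zero) auto
    show ?case
    proof
      fix s assume s'': "s \<in> {s0..s1}"
      have "1 / s \<in> {1 / s1..1 / s0}" using s'' s by (auto intro!: frac_le)
      hence b2: "\<bar>psi_sum g (r * (1 / s)) (1 / s / r) \<beta> M\<bar> \<le> C2 * T" using elim unfolding T_def by blast
      have b1: "\<bar>psi_sum f (r * s) (s / r) \<alpha> L\<bar> \<le> C1 * T" using elim s'' unfolding T_def by blast
      have c: "C1 * T \<le> \<bar>C1\<bar> * T" "C2 * T \<le> \<bar>C2\<bar> * T" "D \<le> D * T"
        using T D by (auto intro!: mult_right_mono)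
      have d1: "4 * (M / \<alpha>) * s\<^sup>2 \<le> 4 * (M / \<alpha>) * s1\<^sup>2"
        using s'' s F(2) \<alpha> by (intro mult_left_mono power_mono) auto
      have d2: "4 * (L / \<beta>) * (1 / s\<^sup>2) \<le> 4 * (L / \<beta>) * (1 / s0\<^sup>2)"
        using s'' s F(1) \<beta>' by (intro mult_left_mono frac_le power_mono) auto
      have main: "\<bar>real (lattice_count L f r s) - (r\<^sup>2 * curve_area L f - r * (L / s + s * M) / 2)\<bar>
        \<le> \<bar>psi_sum f (r * s) (s / r) \<alpha> L\<bar> + \<bar>psi_sum g (r * (1 / s)) (1 / s / r) \<beta> M\<bar>
          + 2 + 4 * (M / \<alpha>) * s\<^sup>2 + 4 * (L / \<beta>) * (1 / s\<^sup>2)"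
        using s'' s elim by (intro lattice_count_expansion[OF f g \<alpha> \<beta> gC2(1)]) auto
      have "X \<le> p + q + z"
        if "X \<le> p1 + q1 + 2 + y1 + y2" "p1 \<le> p'" "p' \<le> p" "q1 \<le> q'" "q' \<le> q" "y1 \<le> y1'" "y2 \<le> y2'"
          "2 + y1' + y2' \<le> z" for X p q z p1 q1 y1 y2 p' q' y1' y2' :: real
      proof -
        have "X \<le> p + q + 2 + y1' + y2'" using that(1-7) by argo
        thus ?thesis using that(8) by argo
      qed
      from this[OF main b1 c(1) b2 c(2) d1 d2 c(3)[unfolded D_def]]
      have "\<bar>real (lattice_count L f r s) - (r\<^sup>2 * curve_area L f - r * (L / s + s * M) / 2)\<bar>
        \<le> \<bar>C1\<bar> * T + \<bar>C2\<bar> * T + D * T" unfolding D_def .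
      also have "\<dots> = C * T" by (simp add: C_def algebra_simps)
      finally show "\<bar>real (lattice_count L f r s) - (r\<^sup>2 * curve_area L f - r * (L / s + s * M) / 2)\<bar> \<le> C * r powr (1 - 2 * e)"
        by (simp only: T_def)
    qed
  qed
  moreover have "0 < C" using D by (simp add: C_def)
  ultimately show ?thesis by blast
qed

section \<open>A bound for all stretch factors\<close>

text \<open>Here \<open>l j\<close> is a guaranteed excess of the integral over the lower rectangle
  in the j-th cell; the regimes of s/r differ in which cells supply it.\<close>

lemma sum_plus_loss_le_integral:
  fixes f l :: "nat \<Rightarrow> real" and F :: "real \<Rightarrow> real" and x :: real
  assumes x: "0 < x" and int: "F integrable_on {0..real n * x}"
    and cell: "\<And>j. j < n \<Longrightarrow> f j + l j \<le> integral {real j * x..real (Suc j) * x} F"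
  shows "(\<Sum>j<n. f j) + (\<Sum>j<n. l j) \<le> integral {0..real n * x} F"
proof -
  have "m \<le> n \<Longrightarrow> (\<Sum>j<m. f j) + (\<Sum>j<m. l j) \<le> integral {0..real m * x} F" for m
  proof (induction m)
    case (Suc m)
    have "real (Suc m) * x \<le> real n * x" using Suc.prems x by (intro mult_right_mono) auto
    hence "integral {0..real m * x} F + integral {real m * x..real (Suc m) * x} F = integral {0..real (Suc m) * x} F"
      using x by (intro Henstock_Kurzweil_Integration.integral_combine integrable_on_subinterval[OF int])
        (auto simp del: of_nat_Suc intro!: mult_right_mono)
    thus ?case using Suc cell[of m] by simp
  qed simp
  thus ?thesis by simp
qed

lemma integral_ge_const:
  fixes f :: "real \<Rightarrow> real"
  assumes "u \<le> v" "f integrable_on {u..v}" "\<And>x. x \<in> {u..v} \<Longrightarrow> c \<le> f x"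
  shows "c * (v - u) \<le> integral {u..v} f"
  using integral_ge_affine[of u v f c 0] assms by simp

text \<open>The chord of the next cell, extended to the left, stays below f, so a triangle above the
  lower rectangle is lost. Its height is the drop of f over the next cell, which telescopes when
  cells are added.\<close>

lemma convex_cell_loss:
  fixes f :: "real \<Rightarrow> real"
  assumes f: "convex_decreasing L M f" and ab: "0 \<le> a" "0 < x" "a + x + x \<le> L"
  shows "x * f (a + x) + x / 2 * (f (a + x) - f (a + x + x)) \<le> integral {a..a + x} f"
proof -
  note F = convex_decreasing_facts[OF f]
  define b where "b = a + x"
  define m where "m = (f b - f (b + x)) / x"
  have "(f b + m * x) * (a + x - a) + (- m) * (a + x - a)\<^sup>2 / 2 \<le> integral {a..a + x} f"
  proof (rule integral_ge_affine)
    fix u assume u: "u \<in> {a..a + x}"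
    have "f b + m * (b - u) \<le> f u"
    proof (cases "u = b")
      case False
      hence ub: "u < b" using u by (simp add: b_def)
      have "(f u - f b) / (u - b) \<le> (f b - f (b + x)) / (b - (b + x))"
        using convex_on_slope_le[OF F(4), of u "b + x" b] u ub ab by (auto simp: b_def)
      also have "\<dots> = - m" by (simp add: m_def)
      finally have "- m * (u - b) \<le> f u - f b" using ub by (simp add: neg_divide_le_eq)
      thus ?thesis by (simp add: algebra_simps)
    qed simp
    thus "f b + m * x + - m * (u - a) \<le> f u" by (simp add: b_def algebra_simps)
  qed (use ab in \<open>auto intro!: integrable_continuous_interval continuous_on_subset[OF F(3)]\<close>)
  moreover have "m * x = f b - f (b + x)" using ab by (simp add: m_def)
  moreover have "(f b + m * x) * (a + x - a) + (- m) * (a + x - a)\<^sup>2 / 2 = x * f b + x / 2 * (m * x)"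
    by (simp add: power2_eq_square algebra_simps)
  ultimately show ?thesis by (simp add: b_def)
qed

text \<open>Dropping the floors leaves a right-endpoint Riemann sum, which for decreasing f is at
  most the area.\<close>

lemma lattice_count_le_sum:
  assumes f: "convex_decreasing L M f" and rs: "0 < r" "0 < s"
  defines "x \<equiv> s / r"
  shows "real (lattice_count L f r s) \<le> r\<^sup>2 * (\<Sum>j<nat \<lfloor>L / x\<rfloor>. x * f (real (Suc j) * x))"
proof -
  note F = convex_decreasing_facts[OF f]
  have x: "0 < x" using rs by (simp add: x_def)
  define n where "n = nat \<lfloor>L / x\<rfloor>"
  have n: "j \<le> n \<longleftrightarrow> real j * x \<le> L" for j
    using x F(1) by (auto simp: n_def le_nat_iff le_floor_iff field_simps)
  define P where "P = {(j :: nat, k :: nat). 1 \<le> j \<and> 1 \<le> k \<and> real j * s / r \<le> L \<and> real k \<le> r * s * f (real j * s / r)}"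
  have sub: "P \<subseteq> Sigma {1..n} (\<lambda>j. {1..nat \<lfloor>r * s * f (real j * x)\<rfloor>})"
    using n by (auto simp: P_def x_def le_nat_floor)
  have "real (card P) \<le> (\<Sum>j=1..n. real (nat \<lfloor>r * s * f (real j * x)\<rfloor>))"
    using card_mono[OF _ sub] by (simp add: card_SigmaI flip: of_nat_sum)
  also have "\<dots> \<le> (\<Sum>j=1..n. r * s * f (real j * x))"
    using F(9) n rs x by (intro sum_mono) auto
  also have "\<dots> = (\<Sum>j<n. r * s * f (real (Suc j) * x))"
    by (rule sum.reindex_bij_witness[of _ Suc "\<lambda>j. j - 1"]) auto
  also have "\<dots> = r\<^sup>2 * (\<Sum>j<n. x * f (real (Suc j) * x))"
    unfolding sum_distrib_left using rs by (intro sum.cong) (auto simp: x_def power2_eq_square)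
  finally show ?thesis by (simp add: lattice_count_def P_def n_def)
qed

text \<open>For s \<le> r the deficit is c r s, comparable with the true linear term; this strength
  is what later bounds the optimal s independently of r.\<close>

lemma lattice_count_upper:
  assumes f: "convex_decreasing L M f"
  shows "\<exists>c>0. \<forall>r>0. \<forall>s>0. real (lattice_count L f r s) \<le> r\<^sup>2 * (curve_area L f - c * min 1 (s / r))"
proof -
  note F = convex_decreasing_facts[OF f]
  have int: "f integrable_on {u..v}" if "0 \<le> u" "v \<le> L" for u v
    by (rule integrable_continuous_interval, rule continuous_on_subset[OF F(3)]) (use that in auto)
  have sub: "integral {0..v} f \<le> curve_area L f" if "0 \<le> v" "v \<le> L" for v
  proof -
    have "integral {0..v} f + integral {v..L} f = integral {0..L} f"
      using that by (intro Henstock_Kurzweil_Integration.integral_combine int) auto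
    moreover have "0 * (L - v) \<le> integral {v..L} f"
      using that F(9) by (intro integral_ge_const int) auto
    ultimately show ?thesis by (simp add: curve_area_def)
  qed
  \<comment> \<open>One constant per regime of x = s/r. For x \<le> L/4 the triangles add up to x (f
    x - f(nx))/2 with nx \<ge> 3L/4. For L/4 < x \<le> L the first cell contains [0, L/8], where f
    is at least f(L/8), above its rectangle of height at most f(L/4). For x > L there are no columns
    and the whole area is lost.\<close>
  define c1 c2 c3 where "c1 = (f (L / 4) - f (3 * L / 4)) / 2" and "c2 = L / 8 * (f (L / 8) - f (L / 4))"
    and "c3 = curve_area L f"
  have c: "0 < c1" "0 < c2" "0 < c3"
  proof -
    show "0 < c1" using F(1) F(7)[of "L / 4" "3 * L / 4"] by (simp add: c1_def)
    show "0 < c2" using F(1) F(7)[of "L / 8" "L / 4"] by (simp add: c2_def)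
    have "f (L / 2) * (L / 2 - 0) \<le> integral {0..L / 2} f"
      using F(1,8) by (intro integral_ge_const int) auto
    moreover have "0 < f (L / 2) * (L / 2 - 0)" using F(7)[of "L / 2" L] F(1,6) by simp
    moreover have "integral {0..L / 2} f \<le> c3" using sub[of "L / 2"] F(1) by (simp add: c3_def)
    ultimately show "0 < c3" by linarith
  qed
  define C where "C = Min {c1, c2, c3}"
  have C: "0 < C" "C \<le> c1" "C \<le> c2" "C \<le> c3" using c by (auto simp: C_def)
  show ?thesis
  proof (intro exI[of _ C] conjI allI impI C(1))
    fix r s :: real assume rs: "0 < r" "0 < s"
    define x where "x = s / r"
    have x: "0 < x" using rs by (simp add: x_def)
    define n where "n = nat \<lfloor>L / x\<rfloor>"
    have n: "real n * x \<le> L" "L < real (Suc n) * x"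
    proof -
      have "real n = \<lfloor>L / x\<rfloor>" using F(1) x by (simp add: n_def)
      hence "real n \<le> L / x" "L / x < real n + 1" by linarith+
      thus "real n * x \<le> L" "L < real (Suc n) * x" using x by (auto simp: field_simps)
    qed
    have mono: "real i * x \<le> real j * x" if "i \<le> j" for i j using that x by simp
    have cell0: "x * f (real (Suc j) * x) \<le> integral {real j * x..real (Suc j) * x} f" if "j < n" for j
    proof -
      have j: "real (Suc j) * x \<le> L" using mono[of "Suc j" n] that n by simp
      have "f (real (Suc j) * x) * (real (Suc j) * x - real j * x) \<le> integral {real j * x..real (Suc j) * x} f"
        using j x by (intro integral_ge_const int F(8))
          (auto simp: mono simp del: of_nat_Suc intro: order.trans[of 0 "real j * x"])
      thus ?thesis by (simp add: algebra_simps)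
    qed
    have "(\<Sum>j<n. x * f (real (Suc j) * x)) \<le> curve_area L f - C * min 1 x"
    proof -
      consider "x \<le> L / 4" | "L / 4 < x" "x \<le> L" | "L < x" by linarith
      thus ?thesis
      proof cases
        case 1
        \<comment> \<open>The last cell gets no loss: its triangle would use the drop of f over the
          next cell, which is not contained in [0, L].\<close>
        define l where "l j = (if Suc j < n then x / 2 * (f (real (Suc j) * x) - f (real (Suc (Suc j)) * x)) else 0)" for j
        have "1 < real n" 
        proof -
          have "4 * x \<le> L" using 1 by simp
          hence "4 * x < real (Suc n) * x" using n by linarith
          thus ?thesis using x by simp
        qed
        hence n1: "1 < n" by simp
        have "(\<Sum>j<n. x * f (real (Suc j) * x)) + (\<Sum>j<n. l j) \<le> integral {0..real n * x} f"
        proof (rule sum_plus_loss_le_integral[OF x int])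
          fix j assume j: "j < n"
          show "x * f (real (Suc j) * x) + l j \<le> integral {real j * x..real (Suc j) * x} f"
          proof (cases "Suc j < n")
            case True
            have e: "real j * x + x = real (Suc j) * x" "real (Suc j) * x + x = real (Suc (Suc j)) * x"
              by (simp_all add: algebra_simps)
            have "real (Suc (Suc j)) * x \<le> L" using mono[of "Suc (Suc j)" n] True n by simp
            thus ?thesis using convex_cell_loss[OF f, of "real j * x" x] x True
              unfolding l_def e by simp
          next
            case False thus ?thesis using cell0[OF j] by (simp add: l_def)
          qed
        qed (use n in auto)
        also have "(\<Sum>j<n. l j) = x / 2 * (f x - f (real n * x))"
        proof -
          have "(\<Sum>j<n. l j) = (\<Sum>j<n - 1. l j)"
            using n1 by (intro sum.mono_neutral_right) (auto simp: l_def)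
          also have "\<dots> = (\<Sum>j<n - 1. x / 2 * (f (real (Suc j) * x) - f (real (Suc (Suc j)) * x)))"
            by (intro sum.cong) (auto simp: l_def)
          also have "\<dots> = x / 2 * (f x - f (real n * x))"
            unfolding sum_distrib_left[symmetric]
            using sum_lessThan_telescope'[of "\<lambda>j. f (real (Suc j) * x)" "n - 1"] n1 by simp
          finally show ?thesis .
        qed
        finally have "(\<Sum>j<n. x * f (real (Suc j) * x)) + x / 2 * (f x - f (real n * x)) \<le> curve_area L f"
          using sub[of "real n * x"] n x by simp
        moreover have "x / 2 * (2 * c1) \<le> x / 2 * (f x - f (real n * x))"
        proof (rule mult_left_mono)
          have "3 * L / 4 \<le> real n * x" using n 1 by (simp add: algebra_simps)
          hence "f (real n * x) \<le> f (3 * L / 4)" using n F(1) by (intro F(8)) auto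
          moreover have "f (L / 4) \<le> f x" using x 1 F(1) by (intro F(8)) auto
          ultimately show "2 * c1 \<le> f x - f (real n * x)" by (simp add: c1_def)
        qed (use x in simp)
        moreover have "C * min 1 x \<le> x * c1" using C x by (subst mult.commute) (intro mult_mono, auto)
        ultimately show ?thesis by simp
      next
        case 2
        define l where "l j = (if j = 0 then c2 else 0)" for j :: nat
        have n0: "0 < n"
        proof (rule ccontr)
          assume "\<not> 0 < n" thus False using n 2 by simp
        qed
        have "(\<Sum>j<n. x * f (real (Suc j) * x)) + (\<Sum>j<n. l j) \<le> integral {0..real n * x} f"
        proof (rule sum_plus_loss_le_integral[OF x int])
          fix j assume j: "j < n"
          show "x * f (real (Suc j) * x) + l j \<le> integral {real j * x..real (Suc j) * x} f"
          proof (cases "j = 0")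
            case True
            have "integral {0..L / 8} f + integral {L / 8..x} f = integral {0..x} f"
              using 2 F(1) by (intro Henstock_Kurzweil_Integration.integral_combine int) auto
            moreover have "f (L / 8) * (L / 8 - 0) \<le> integral {0..L / 8} f"
              using F(1) by (intro integral_ge_const int F(8)) auto
            moreover have "f x * (x - L / 8) \<le> integral {L / 8..x} f"
              using F(1) 2 by (intro integral_ge_const int F(8)) auto
            moreover have "f x \<le> f (L / 4)" using 2 F(1) by (intro F(8)) auto
            hence "L / 8 * (f (L / 8) - f (L / 4)) \<le> L / 8 * (f (L / 8) - f x)"
              using F(1) by (intro mult_left_mono) auto
            ultimately show ?thesis using True by (simp add: l_def c2_def algebra_simps)
          next
            case False thus ?thesis using cell0[OF j] by (simp add: l_def)
          qed
        qed (use n in auto)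
        also have "(\<Sum>j<n. l j) = c2" using n0 by (simp add: l_def)
        finally have "(\<Sum>j<n. x * f (real (Suc j) * x)) + c2 \<le> curve_area L f"
          using sub[of "real n * x"] n x by simp
        moreover have "C * min 1 x \<le> c2 * 1" using C c x by (intro mult_mono) auto
        ultimately show ?thesis by simp
      next
        case 3
        have "n = 0"
        proof (rule ccontr)
          assume "n \<noteq> 0"
          hence "x \<le> real n * x" using mono[of 1 n] by simp
          thus False using n 3 by linarith
        qed
        moreover have "C * min 1 x \<le> c3 * 1" using C c x by (intro mult_mono) auto
        ultimately show ?thesis by (simp add: c3_def)
      qed
    qed
    hence "r\<^sup>2 * (\<Sum>j<n. x * f (real (Suc j) * x)) \<le> r\<^sup>2 * (curve_area L f - C * min 1 x)"
      by (rule mult_left_mono) simp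
    thus "real (lattice_count L f r s) \<le> r\<^sup>2 * (curve_area L f - C * min 1 (s / r))"
      using lattice_count_le_sum[OF f rs] unfolding x_def n_def by linarith
  qed
qed

section \<open>Optimal stretch factors\<close>

lemma the_inv_into_inverse:
  assumes f: "convex_decreasing L M f" and g: "\<forall>y\<in>{0..M}. g y = the_inv_into {0..L} f y"
  shows "\<forall>x\<in>{0..L}. f x = the_inv_into {0..M} g x"
proof
  fix x assume x: "x \<in> {0..L}"
  note inv = inverse_curve[OF f g] and F = convex_decreasing_facts[OF f]
  have "inj_on g {0..M}" using inv(2) by (rule inj_on_inverseI)
  moreover have "f x \<in> {0..M}" using F(9)[of x] x by auto
  ultimately have "the_inv_into {0..M} g (g (f x)) = f x" by (rule the_inv_into_f_f)
  thus "f x = the_inv_into {0..M} g x" using inv(1)[OF x] by simp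
qed

text \<open>Both areas are cut at (\<alpha>, \<beta>), and each piece next to an axis is converted
  through the derivative of the other function. The upper bound for the inverse curve thus has the
  same main term.\<close>

lemma curve_area_inverse:
  assumes f: "convex_decreasing L M f" and g: "\<forall>y\<in>{0..M}. g y = the_inv_into {0..L} f y"
    and \<alpha>: "0 < \<alpha>" "\<alpha> < L" and \<beta>: "\<beta> = f \<alpha>"
    and C2: "C2_on {\<alpha>..<L} f f' f''" "C2_on {\<beta>..<M} g g' g''"
  shows "curve_area M g = curve_area L f"
proof -
  note inv = inverse_curve[OF f g]
  note F = convex_decreasing_facts[OF f] and G = convex_decreasing_facts[OF inv(4)]
  have \<beta>': "0 < \<beta>" "\<beta> < M" "g \<beta> = \<alpha>"
    using F(7)[of 0 \<alpha>] F(7)[of \<alpha> L] F(5,6) \<alpha> inv(1)[of \<alpha>] by (auto simp: \<beta>)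
  have "integral {0..\<alpha>} f = \<alpha> * \<beta> + integral {\<beta>..M} g"
    using area_by_inverse[OF f g _ _ C2(2)] \<beta>' by simp
  moreover have "integral {0..f \<alpha>} g = f \<alpha> * \<alpha> + integral {\<alpha>..L} f"
    by (rule area_by_inverse[OF inv(4) the_inv_into_inverse[OF f g] _ _ C2(1)]) (use \<alpha> in auto)
  moreover have "integral {0..\<alpha>} f + integral {\<alpha>..L} f = integral {0..L} f"
    using \<alpha> by (intro Henstock_Kurzweil_Integration.integral_combine integrable_continuous_interval F(3)) auto
  moreover have "integral {0..\<beta>} g + integral {\<beta>..M} g = integral {0..M} g"
    using \<beta>' by (intro Henstock_Kurzweil_Integration.integral_combine integrable_continuous_interval G(3)) auto
  ultimately show ?thesis by (simp add: curve_area_def \<beta> mult.commute)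
qed

text \<open>The two bounds compare a deficit r^2 c min(1, s/r) with rK. For r > K/c the minimum
  cannot be 1, so c r s \<le> rK.\<close>

lemma stretch_bounded:
  assumes c: "0 < c" and upper: "real n \<le> r\<^sup>2 * (A - c * min 1 (s / r))"
    and lower: "r\<^sup>2 * A - r * K \<le> real n" and r: "0 < r" "K < c * r"
  shows "s \<le> K / c"
proof -
  have "r\<^sup>2 * (c * min 1 (s / r)) \<le> r * K" using upper lower by (simp add: algebra_simps)
  hence "r * (c * min 1 (s / r)) \<le> K" using r by (simp add: power2_eq_square mult.assoc)
  hence 1: "min 1 (s / r) \<le> K / (c * r)" using c r by (simp add: field_simps)
  moreover have "K / (c * r) < 1" using c r by simp
  ultimately have "s / r \<le> K / (c * r)" by (simp add: min_def split: if_splits)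
  thus ?thesis using c r by (simp add: field_simps)
qed

text \<open>L/s + sL - 2L = L (s - 1)^2 / s is quadratic at s = 1. An error r^{1 - 2e} against a
  main term of order r gives (s - 1)^2 = O(r^{-2e}), and the square root halves the
  exponent.\<close>

lemma optimal_stretch_bounds:
  fixes s E r L :: real
  assumes s: "0 < s" "s \<le> s1" and L: "0 < L" and r: "1 \<le> r"
    and ineq: "r * (L / s + s * L) / 2 \<le> r * L + 2 * E * r powr (1 - 2 * e)"
  shows "\<bar>s - 1\<bar> \<le> sqrt (4 * E * s1 / L) * r powr (- e)"
proof -
  have "r * (L * ((s - 1)\<^sup>2 / s)) = r * (L / s + s * L) - 2 * (r * L)"
    using s by (simp add: field_simps power2_eq_square)
  also have "\<dots> \<le> 4 * E * r powr (1 - 2 * e)" using ineq by simp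
  also have "r powr (1 - 2 * e) = r * (r powr (- e))\<^sup>2"
  proof -
    have "r powr (1 - 2 * e) = r powr 1 * (r powr (- e) * r powr (- e))"
      unfolding powr_add[symmetric] by simp
    thus ?thesis using r by (simp add: power2_eq_square)
  qed
  finally have "r * (L * ((s - 1)\<^sup>2 / s)) \<le> r * (4 * E * (r powr (- e))\<^sup>2)" by (simp add: mult_ac)
  hence 1: "L * ((s - 1)\<^sup>2 / s) \<le> 4 * E * (r powr (- e))\<^sup>2"
    using r by (subst (asm) mult_le_cancel_left_pos) auto
  have E: "0 \<le> 4 * E * (r powr (- e))\<^sup>2" by (rule order.trans[OF _ 1]) (use s L in auto)
  have "(s - 1)\<^sup>2 \<le> s * (4 * E * (r powr (- e))\<^sup>2) / L" using 1 s L by (simp add: field_simps)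
  also have "\<dots> \<le> s1 * (4 * E * (r powr (- e))\<^sup>2) / L"
    using s L E by (intro divide_right_mono mult_right_mono) auto
  also have "\<dots> = (4 * E * s1 / L) * (r powr (- e))\<^sup>2" by simp
  finally have "sqrt ((s - 1)\<^sup>2) \<le> sqrt ((4 * E * s1 / L) * (r powr (- e))\<^sup>2)" by (rule real_sqrt_le_mono)
  thus ?thesis by (simp only: real_sqrt_mult real_sqrt_abs) simp
qed

theorem theorem1:
  fixes L M \<alpha> \<beta> a1 a2 b1 b2 e :: real
    and f f' f'' g g' g'' \<delta> \<epsilon> :: "real \<Rightarrow> real"
  assumes curve: "convex_decreasing L M f"
    and g_inverse: "\<And>y. y \<in> {0..M} \<Longrightarrow> g y = the_inv_into {0..L} f y"
    and point: "(\<alpha>, \<beta>) \<in> curve L f" "0 < \<alpha>" "0 < \<beta>" "\<alpha> < L / 2" "\<beta> < M / 2"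
    and f_C2: "C2_on {\<alpha>..<L} f f' f''"
    and f_signs: "\<And>x. x \<in> {\<alpha>..<L} \<Longrightarrow> f' x < 0 \<and> f'' x > 0"
    and g_C2: "C2_on {\<beta>..<M} g g' g''"
    and g_signs: "\<And>y. y \<in> {\<beta>..<M} \<Longrightarrow> g' y < 0 \<and> g'' y > 0"
    and f''_monotonic: "piecewise_monotonic \<alpha> L f''"
    and g''_monotonic: "piecewise_monotonic \<beta> M g''"
    and \<delta>_range: "\<delta> \<in> {0<..} \<rightarrow> {0<..<L / 2 - \<alpha>}"
    and \<epsilon>_range: "\<epsilon> \<in> {0<..} \<rightarrow> {0<..<M / 2 - \<beta>}"
    and exponents: "0 < a1" "0 < a2" "0 < b1" "0 < b2"
    and \<delta>_decay: "\<delta> \<in> O[at_top](\<lambda>r. r powr (- 2 * a1))"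
    and f''_growth: "(\<lambda>r. 1 / f'' (L - \<delta> r)) \<in> O[at_top](\<lambda>r. r powr (1 - 4 * a2))"
    and \<epsilon>_decay: "\<epsilon> \<in> O[at_top](\<lambda>r. r powr (- 2 * b1))"
    and g''_growth: "(\<lambda>r. 1 / g'' (M - \<epsilon> r)) \<in> O[at_top](\<lambda>r. r powr (1 - 4 * b2))"
    and equal_intercepts: "L = M"
    and e: "e = Min {1 / 6, a1, a2, b1, b2}"
  shows "(\<forall>\<eta>>0. \<forall>\<^sub>F r in at_top. \<forall>s \<in> optimal_stretches L f r. \<bar>s - 1\<bar> < \<eta>) \<and>
    (\<exists>C>0. \<exists>r0>0. \<forall>r\<ge>r0. \<forall>s \<in> optimal_stretches L f r. \<bar>s - 1\<bar> \<le> C * r powr (- e)) \<and>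
    (\<lambda>r. real (max_lattice_count L f r) - (r\<^sup>2 * curve_area L f - r * L))
      \<in> O[at_top](\<lambda>r. r powr (1 - 2 * e))"
proof -
  have g_inv: "\<forall>y\<in>{0..M}. g y = the_inv_into {0..L} f y" using g_inverse by blast
  note F = convex_decreasing_facts[OF curve] and inv = inverse_curve[OF curve g_inv]
  have \<beta>: "\<beta> = f \<alpha>" using point(1) by (auto simp: curve_def)
  have \<alpha>: "0 < \<alpha>" "\<alpha> < L" using point F(1) by auto
  have \<beta>M: "\<beta> < M" using point F(2) by auto
  have e_le: "e \<le> 1 / 6" "e \<le> a1" "e \<le> a2" "e \<le> b1" "e \<le> b2" unfolding e by simp_all
  have e_pos: "0 < e" using exponents unfolding e by simp
  have \<delta>: "0 < \<delta> r \<and> \<delta> r \<le> L - \<alpha>" if "0 < r" for r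
    using \<delta>_range that F(1) by (force simp: Pi_iff)
  have \<epsilon>: "0 < \<epsilon> r \<and> \<epsilon> r \<le> M - \<beta>" if "0 < r" for r
    using \<epsilon>_range that F(2) by (force simp: Pi_iff)
  define A where "A = curve_area L f"
  define N where "N = lattice_count L f"
  have uniform: "\<exists>C>0. \<forall>\<^sub>F r in at_top. \<forall>s\<in>{s0..s1}.
      \<bar>real (N r s) - (r\<^sup>2 * A - r * (L / s + s * L) / 2)\<bar> \<le> C * r powr (1 - 2 * e)"
    if "0 < s0" "s0 \<le> s1" for s0 s1
  proof -
    have "\<exists>C>0. \<forall>\<^sub>F r in at_top. \<forall>s\<in>{s0..s1}.
        \<bar>real (lattice_count L f r s) - (r\<^sup>2 * curve_area L f - r * (L / s + s * M) / 2)\<bar> \<le> C * r powr (1 - 2 * e)"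
      by (rule lattice_count_asymptotic[OF curve g_inv \<alpha> \<beta> f_C2 _ f''_monotonic g_C2 _ g''_monotonic
          _ \<delta>_decay f''_growth _ \<epsilon>_decay g''_growth e_le that]) (use f_signs g_signs \<delta> \<epsilon> in auto)
    thus ?thesis using equal_intercepts by (simp add: A_def N_def)
  qed
  have optimal: "0 < s" "\<And>t. 0 < t \<Longrightarrow> N r t \<le> N r s" if "s \<in> optimal_stretches L f r" for r s
  proof -
    have *: "0 < s" "\<nexists>t. 0 < t \<and> N r s < N r t"
      using that by (auto simp: optimal_stretches_def is_arg_max_def N_def)
    show "0 < s" by fact
    show "N r t \<le> N r s" if "0 < t" for t using * that by (meson not_less)
  qed
  \<comment> \<open>The expansion at the single point s = 1 supplies the lower bound for the
    maximum, before any range for optimal s is known.\<close>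
  obtain C1 where C1: "0 < C1" "\<forall>\<^sub>F r in at_top. \<forall>s\<in>{1..1}.
      \<bar>real (N r s) - (r\<^sup>2 * A - r * (L / s + s * L) / 2)\<bar> \<le> C1 * r powr (1 - 2 * e)"
    using uniform[of 1 1] by auto
  obtain c where c: "0 < c" "\<And>r s. 0 < r \<Longrightarrow> 0 < s \<Longrightarrow> real (N r s) \<le> r\<^sup>2 * (A - c * min 1 (s / r))"
    using lattice_count_upper[OF curve] unfolding A_def N_def by blast
  obtain c' where c': "0 < c'" "\<And>r s. 0 < r \<Longrightarrow> 0 < s \<Longrightarrow> real (lattice_count M g r s) \<le> r\<^sup>2 * (A - c' * min 1 (s / r))"
    using lattice_count_upper[OF inv(4)] unfolding A_def curve_area_inverse[OF curve g_inv \<alpha> \<beta> f_C2 g_C2] by blast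
  \<comment> \<open>At s = 1 the count falls short of r^2 A by rL plus an error of at most C1
    r.\<close>
  define K where "K = L + C1"
  have K: "0 < K" using F(1) C1(1) by (simp add: K_def)
  \<comment> \<open>The range is enlarged to contain 1, so that s = 1 and the optimal s can be
    compared by one uniform expansion.\<close>
  define s0 s1 where "s0 = min 1 (c' / K)" and "s1 = max 1 (K / c)"
  have s01: "0 < s0" "s0 \<le> 1" "1 \<le> s1" using c(1) c'(1) K by (auto simp: s0_def s1_def)
  have bounded: "\<forall>\<^sub>F r in at_top. \<forall>s\<in>optimal_stretches L f r. s \<in> {s0..s1}"
    using C1(2) eventually_ge_at_top[of 1] eventually_gt_at_top[of "K / c"] eventually_gt_at_top[of "K / c'"]
  proof eventually_elim
    case (elim r)
    have r: "0 < r" "K < c * r" "K < c' * r" using elim c(1) c'(1) by (auto simp: pos_divide_less_eq mult.commute)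
    have "r powr (1 - 2 * e) \<le> r powr 1" using elim e_pos by (intro powr_mono) auto
    hence "C1 * r powr (1 - 2 * e) \<le> C1 * r" using C1(1) r by simp
    moreover have "\<bar>real (N r 1) - (r\<^sup>2 * A - r * (L / 1 + 1 * L) / 2)\<bar> \<le> C1 * r powr (1 - 2 * e)"
      using elim(1) by simp
    ultimately have N1: "r\<^sup>2 * A - r * K \<le> real (N r 1)" by (simp add: K_def algebra_simps abs_le_iff)
    show ?case
    proof
      fix s assume s: "s \<in> optimal_stretches L f r"
      note opt = optimal[OF s]
      have Ns: "r\<^sup>2 * A - r * K \<le> real (N r s)" using N1 opt(2)[of 1] by simp
      have "s \<le> K / c" by (rule stretch_bounded[OF c(1) c(2)[OF r(1) opt(1)] Ns r(1,2)])
      moreover have "1 / s \<le> K / c'"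
      proof (rule stretch_bounded[OF c'(1) _ _ r(1,3)])
        have "N r s = lattice_count M g r (1 / s)"
          unfolding N_def by (rule lattice_count_inverse[OF curve g_inv r(1) opt(1)])
        thus "r\<^sup>2 * A - r * K \<le> real (lattice_count M g r (1 / s))" using Ns by simp
        show "real (lattice_count M g r (1 / s)) \<le> r\<^sup>2 * (A - c' * min 1 (1 / s / r))"
          by (rule c'(2)) (use r opt in auto)
      qed
      hence "c' / K \<le> s" using c'(1) K opt(1) by (simp add: field_simps)
      ultimately show "s \<in> {s0..s1}" by (auto simp: s0_def s1_def min_le_iff_disj le_max_iff_disj)
    qed
  qed
  obtain C2 where C2: "0 < C2" "\<forall>\<^sub>F r in at_top. \<forall>s\<in>{s0..s1}.
      \<bar>real (N r s) - (r\<^sup>2 * A - r * (L / s + s * L) / 2)\<bar> \<le> C2 * r powr (1 - 2 * e)"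
    using uniform[of s0 s1] s01 by auto
  define D where "D = sqrt (4 * C2 * s1 / L)"
  have D: "0 < D" unfolding D_def using C2(1) s01 F(1) by simp
  have rate: "\<forall>\<^sub>F r in at_top. \<forall>s\<in>optimal_stretches L f r.
      \<bar>s - 1\<bar> \<le> D * r powr (- e) \<and> \<bar>real (N r s) - (r\<^sup>2 * A - r * L)\<bar> \<le> C2 * r powr (1 - 2 * e)"
    using bounded C2(2) eventually_ge_at_top[of 1]
  proof eventually_elim
    case (elim r)
    define T where "T = r powr (1 - 2 * e)"
    have N1: "\<bar>real (N r 1) - (r\<^sup>2 * A - r * L)\<bar> \<le> C2 * T"
      using elim(2) s01 by (auto simp: T_def dest!: bspec[of _ _ 1])
    show ?case
    proof
      fix s assume s: "s \<in> optimal_stretches L f r"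
      note opt = optimal[OF s]
      have Ns: "\<bar>real (N r s) - (r\<^sup>2 * A - r * (L / s + s * L) / 2)\<bar> \<le> C2 * T"
        using elim(1,2) s unfolding T_def by blast
      have N1s: "real (N r 1) \<le> real (N r s)" using opt(2)[of 1] by simp
      have "r * (L / s + s * L) / 2 \<le> r * L + 2 * C2 * T"
        using N1 Ns N1s by linarith
      hence "\<bar>s - 1\<bar> \<le> D * r powr (- e)"
        unfolding D_def using elim(1,3) s opt(1) F(1) by (intro optimal_stretch_bounds) (auto simp: T_def)
      \<comment> \<open>Arithmetic-geometric mean: the main term at s is at most that at 1. This
        bounds N(r,s) from above, and N(r,1) \<le> N(r,s) bounds it from below.\<close>
      moreover have "r * L \<le> r * (L / s + s * L) / 2"
      proof -
        have "0 \<le> r * (L * ((s - 1)\<^sup>2 / s))" using elim(3) opt(1) F(1) by simp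
        also have "\<dots> = r * (L / s + s * L) - 2 * (r * L)"
          using opt(1) by (simp add: field_simps power2_eq_square)
        finally show ?thesis by simp
      qed
      hence "\<bar>real (N r s) - (r\<^sup>2 * A - r * L)\<bar> \<le> C2 * T" using N1 Ns N1s by linarith
      ultimately show "\<bar>s - 1\<bar> \<le> D * r powr (- e) \<and> \<bar>real (N r s) - (r\<^sup>2 * A - r * L)\<bar> \<le> C2 * r powr (1 - 2 * e)"
        by (simp add: T_def)
    qed
  qed
  show ?thesis
  proof (intro conjI allI impI)
    fix \<eta> :: real assume \<eta>: "0 < \<eta>"
    have "((\<lambda>r. D * r powr (- e)) \<longlongrightarrow> D * 0) at_top"
      using e_pos by (intro tendsto_intros tendsto_neg_powr filterlim_ident) auto
    hence "\<forall>\<^sub>F r in at_top. D * r powr (- e) < \<eta>" using \<eta> by (simp add: order_tendsto_iff)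
    with rate show "\<forall>\<^sub>F r in at_top. \<forall>s\<in>optimal_stretches L f r. \<bar>s - 1\<bar> < \<eta>"
      by eventually_elim force
  next
    obtain R where R: "\<And>r. R \<le> r \<Longrightarrow> \<forall>s\<in>optimal_stretches L f r. \<bar>s - 1\<bar> \<le> D * r powr (- e)"
      using rate unfolding eventually_at_top_linorder by blast
    show "\<exists>C>0. \<exists>r0>0. \<forall>r\<ge>r0. \<forall>s\<in>optimal_stretches L f r. \<bar>s - 1\<bar> \<le> C * r powr (- e)"
      by (rule exI[of _ D], intro conjI D, rule exI[of _ "max 1 R"]) (use R in auto)
  next
    show "(\<lambda>r. real (max_lattice_count L f r) - (r\<^sup>2 * curve_area L f - r * L)) \<in> O(\<lambda>r. r powr (1 - 2 * e))"
    proof (rule bigoI[of _ C2])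
      show "\<forall>\<^sub>F r in at_top. norm (real (max_lattice_count L f r) - (r\<^sup>2 * curve_area L f - r * L))
          \<le> C2 * norm (r powr (1 - 2 * e))"
        using rate eventually_gt_at_top[of 0]
      proof eventually_elim
        case (elim r)
        obtain s where s: "s \<in> optimal_stretches L f r"
          using optimal_stretches_nonempty[OF curve elim(2)] by blast
        \<comment> \<open>Every optimal s attains the maximum, so the estimate at one of them is an
          estimate of the maximum.\<close>
        have "max_lattice_count L f r = N r s"
          unfolding max_lattice_count_def N_def using optimal[OF s]
          by (intro Max_eqI finite_lattice_counts[OF curve elim(2)]) (auto simp: N_def)
        thus ?case using elim(1) s by (simp add: A_def)
      qed
    qed
  qed
qed

end
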